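(* If $\Omega\subset\mathbb{R}^2$ is open and $u_0:\partial\Omega\to\mathbb{R}$ is $1$-Lipschitz for the usual euclidean distance, then there exists a $1$-Lipschitz function $w:\overline{\Omega}\to\mathbb{R}$, differentiable on $\Omega$, such that $|\nabla w|=1$ almost everywhere on $\Omega$ and $w=u_0$ on $\partial\Omega$; i.e., there exist almost classical solutions of the Eikonal equation $|\nabla w|=1$ on $\Omega$ with boundary value $u_0$.
   Context: $|\cdot|$ is the euclidean norm on $\mathbb{R}^2$, and $w$ is $1$-Lipschitz with respect to the euclidean distance, i.e. $|w(x)-w(y)|\leq|x-y|$ for all $x,y\in\overline{\Omega}$. "Almost everywhere" is with respect to Lebesgue measure. An almost classical solution of the Eikonal equation $|\nabla w|=1$ on $\Omega$ with boundary value $u_0$ is a continuous function $w:\overline{\Omega}\to\mathbb{R}$ such that $w=u_0$ on $\partial\Omega$, $w$ is differentiable on $\Omega$ with $|\nabla w(x)|\leq 1$ for all $x\in\Omega$, and $|\nabla w(x)|=1$ for almost every $x\in\Omega$. *)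

theory Defs
  imports "HOL-Analysis.Analysis"
begin

text \<open>The gradient as a vector; meaningful where \<open>f\<close> is differentiable, where it is
  the unique \<open>D\<close> such that \<open>\<lambda>h. h \<bullet> D\<close> is the Frechet derivative of \<open>f\<close>.\<close>

definition gradient :: "('a::euclidean_space \<Rightarrow> real) \<Rightarrow> 'a \<Rightarrow> 'a" where
  "gradient f x = (THE D. GDERIV f x :> D)"

text \<open>Functions on \<open>closure \<Omega>\<close> and on \<open>frontier \<Omega>\<close> are represented by total functions whose values
  elsewhere are irrelevant. As \<open>\<Omega>\<close> is open, differentiability at the points of \<open>\<Omega>\<close> depends only
  on the values on \<open>\<Omega>\<close>.\<close>

definition almost_classical_solution ::
  "'a::euclidean_space set \<Rightarrow> ('a \<Rightarrow> real) \<Rightarrow> ('a \<Rightarrow> real) \<Rightarrow> bool" where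
  "almost_classical_solution \<Omega> u\<^sub>0 w \<longleftrightarrow>
     continuous_on (closure \<Omega>) w \<and>
     (\<forall>x\<in>frontier \<Omega>. w x = u\<^sub>0 x) \<and>
     (\<forall>x\<in>\<Omega>. w differentiable (at x)) \<and>
     (\<forall>x\<in>\<Omega>. norm (gradient w x) \<le> 1) \<and>
     (AE x in lebesgue. x \<in> \<Omega> \<longrightarrow> norm (gradient w x) = 1)"

end

theory Submission
  imports Defs
begin

text \<open>Let \<open>F\<close> be the boundary of \<open>\<Omega>\<close>, and let \<open>a\<close> and \<open>b\<close> be the least and the greatest \<open>1\<close>-Lipschitz
extension of \<open>u\<^sub>0\<close> to the whole plane (a supremum of downward cones and an infimum of upward cones
with vertices on \<open>F\<close>). The solution is sought between \<open>a\<close> and \<open>b\<close>. Then the boundary values are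
right, and so is the global Lipschitz bound: if the segment from \<open>x\<close> to \<open>y\<close> meets \<open>F\<close> in \<open>z\<close>, both
values differ from \<open>u\<^sub>0 z\<close> by at most the distance to \<open>z\<close>, and if it does not, the mean value theorem
applies.

Where \<open>a = b\<close> off \<open>F\<close>, nothing is left to choose, and nothing has to be: \<open>b\<close> lies below a smooth
function touching it whose gradient is a unit vector, \<open>a\<close> lies above one, and whatever lies between
\<open>a\<close> and \<open>b\<close> is differentiable there with a gradient of length \<open>1\<close>
(\<open>GDERIV_between_envelopes\<close>). So only the open set \<open>U = {a < b}\<close> matters. There
\<open>w = b - s(b) + s(a)\<close>, where \<open>s\<close> is the softplus function, has local Lipschitz constant at most
\<open>1 - s'(b) + s'(a) < 1\<close>, and mollifying it with a slowly varying radius gives a \<open>C\<^sup>1\<close> function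
strictly between \<open>a\<close> and \<open>b\<close> whose gradient is everywhere shorter than \<open>1\<close>
(\<open>strict_interposition\<close>).

This function is then corrected by a series of oscillations that are tiny in the supremum norm
(\<open>eikonal_saturation\<close>). If \<open>p\<^sub>n\<close> is the gradient after \<open>n\<close> steps, the next oscillation moves it, up to a
negligible error, to \<open>p\<^sub>n + t\<^sub>n v\<^sub>n\<close>, where \<open>v\<^sub>n\<close> is a vector that can be prescribed as a
continuous function of the point, and the factor \<open>t\<^sub>n\<close> from \<open>[-1,1]\<close> cannot be controlled at a given point. The
sum of the series is differentiable wherever \<open>p\<^sub>n\<close> converges, provided that the scales of the
oscillations are widely separated and \<open>v\<^sub>n \<rightarrow> 0\<close> (\<open>GDERIV_separated_scales\<close>). Hence \<open>v\<^sub>n\<close> has to be chosen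
so that \<open>p\<^sub>n\<close> converges at every point, against every choice of the factors: a game in the style of
Maly and Zeleny. The strategy used here (\<open>hysteresis_game\<close>) takes \<open>v\<^sub>n\<close> parallel to \<open>(1, s\<^sub>n)\<close> with a
slope \<open>s\<^sub>n\<close> that depends on the past first coordinates as the force of a family of elements with dry
friction does. Moving the first coordinate back and forth dissipates energy, this energy is paid for by
the second coordinate, and the second coordinate is bounded. So both coordinates converge.

The same energy balance bounds the sum of \<open>t\<^sub>n\<^sup>2 |v\<^sub>n|\<^sup>2\<close>. The length of \<open>v\<^sub>n\<close> is about
\<open>(1 - |p\<^sub>n|) / sqrt n\<close>, and \<open>t\<^sub>n\<^sup>2\<close> is almost \<open>1/2\<close> or more on average. As the harmonic series diverges, \<open>|p\<^sub>n|\<close> must tend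
to \<open>1\<close> at almost every point.\<close>

section \<open>Gradients\<close>

lemma GDERIV_iff:
  fixes f :: "'a::real_inner \<Rightarrow> real"
  shows "GDERIV f q :> D \<longleftrightarrow> (\<forall>e>0. \<exists>d>0. \<forall>h. norm h < d \<longrightarrow> \<bar>f (q + h) - f q - h \<bullet> D\<bar> \<le> e * norm h)"
proof -
  have "(\<forall>y. norm (y - q) < d \<longrightarrow> norm (f y - f q - (y - q) \<bullet> D) \<le> e * norm (y - q)) \<longleftrightarrow>
        (\<forall>h. norm h < d \<longrightarrow> \<bar>f (q + h) - f q - h \<bullet> D\<bar> \<le> e * norm h)" for d e
    by (metis add_diff_cancel_left' diff_add_cancel add.commute real_norm_def)
  then show ?thesis
    by (simp add: gderiv_def has_derivative_at_alt bounded_linear_inner_left)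
qed

lemma GDERIV_unique: "GDERIV f q :> D \<Longrightarrow> GDERIV f q :> E \<Longrightarrow> D = E"
  by (metis gderiv_def has_derivative_unique inner_commute vector_eq_ldot ext)

lemma GDERIV_sum:
  "finite I \<Longrightarrow> (\<And>i. i \<in> I \<Longrightarrow> GDERIV (f i) q :> D i) \<Longrightarrow> GDERIV (\<lambda>q. \<Sum>i\<in>I. f i q) q :> (\<Sum>i\<in>I. D i)"
  by (induction I rule: finite_induct) (auto intro: GDERIV_add GDERIV_const)

text \<open>A local Lipschitz constant bounds the gradient: test the linearization with small multiples of the
gradient itself.\<close>

lemma GDERIV_norm_bound:
  fixes f :: "'a::real_inner \<Rightarrow> real"
  assumes f: "GDERIV f q :> D" and "0 < d" and "0 \<le> L"
    and lip: "\<And>h. norm h < d \<Longrightarrow> \<bar>f (q + h) - f q\<bar> \<le> L * norm h"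
  shows "norm D \<le> L"
proof (rule field_le_epsilon)
  fix e :: real assume "0 < e"
  then obtain d' where d': "d' > 0" "\<And>h. norm h < d' \<Longrightarrow> \<bar>f (q + h) - f q - h \<bullet> D\<bar> \<le> e * norm h"
    using f unfolding GDERIV_iff by blast
  show "norm D \<le> L + e"
  proof (cases "D = 0")
    case True
    then show ?thesis using \<open>0 \<le> L\<close> \<open>0 < e\<close> by simp
  next
    case False
    define k where "k = (min d d' / 2 / norm D) *\<^sub>R D"
    have k: "norm k = min d d' / 2" using False \<open>0 < d\<close> d'(1) by (simp add: k_def)
    have pos: "norm k > 0" "norm k < d" "norm k < d'" using k \<open>0 < d\<close> d'(1) by auto
    have "k \<bullet> D = norm k * norm D"
      using False k by (simp add: k_def dot_square_norm power2_eq_square)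
    moreover have "\<bar>f (q + k) - f q\<bar> \<le> L * norm k" using pos by (intro lip)
    moreover have "\<bar>f (q + k) - f q - k \<bullet> D\<bar> \<le> e * norm k" using pos by (intro d')
    ultimately have "norm k * norm D \<le> norm k * (L + e)" by (simp add: algebra_simps)
    then show ?thesis using pos by simp
  qed
qed

lemma GDERIV_imp_lipschitz_bound:
  fixes f :: "'a::real_inner \<Rightarrow> real"
  assumes "convex X" and f: "\<And>q. q \<in> X \<Longrightarrow> GDERIV f q :> D q"
    and D: "\<And>q. q \<in> X \<Longrightarrow> norm (D q) \<le> L"
    and "p \<in> X" "q \<in> X"
  shows "\<bar>f p - f q\<bar> \<le> L * norm (p - q)"
proof -
  have "norm (f p - f q) \<le> L * norm (p - q)"
  proof (rule differentiable_bound[OF assms(1)])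
    show "(f has_derivative (\<lambda>h. h \<bullet> D q)) (at q within X)" if "q \<in> X" for q
      using f[OF that] by (simp add: gderiv_def has_derivative_at_withinI)
    show "onorm (\<lambda>h. h \<bullet> D q) \<le> L" if "q \<in> X" for q
    proof (rule onorm_bound)
      show "0 \<le> L" using D[OF that] norm_ge_zero order_trans by blast
      show "norm (h \<bullet> D q) \<le> L * norm h" for h
        using Cauchy_Schwarz_ineq2[of h "D q"] mult_left_mono[OF D[OF that], of "norm h"]
        by (simp add: mult.commute)
    qed
  qed (use assms in auto)
  then show ?thesis by simp
qed

lemma uniformly_continuous_compact_support:
  fixes G :: "'a::euclidean_space \<Rightarrow> 'b::real_normed_vector"
  assumes "continuous_on UNIV G" and "compact K" and z: "\<And>q. q \<notin> K \<Longrightarrow> G q = 0"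
  shows "uniformly_continuous_on UNIV G"
proof -
  obtain R where R: "K \<subseteq> cball 0 R"
    using compact_imp_bounded[OF \<open>compact K\<close>] unfolding bounded_iff by (auto simp: subset_iff)
  have uc: "uniformly_continuous_on (cball 0 (R + 1)) G"
    using assms(1) by (intro compact_uniformly_continuous) (auto intro: continuous_on_subset)
  show ?thesis
    unfolding uniformly_continuous_on_def
  proof (intro allI impI)
    fix e :: real assume "0 < e"
    then obtain d where d: "d > 0" "\<And>p q. p \<in> cball 0 (R + 1) \<Longrightarrow> q \<in> cball 0 (R + 1) \<Longrightarrow> dist q p < d \<Longrightarrow> dist (G q) (G p) < e"
      using uc unfolding uniformly_continuous_on_def by metis
    have "dist (G q) (G p) < e" if "dist q p < min d 1" for p q
    proof (cases "p \<in> K \<or> q \<in> K")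
      case True
      then have "norm p \<le> R + 1 \<and> norm q \<le> R + 1"
      proof
        assume "p \<in> K"
        then have "norm p \<le> R" using R by auto
        moreover have "norm q \<le> norm p + dist q p"
          by (metis dist_norm norm_triangle_sub)
        ultimately show ?thesis using that by simp
      next
        assume "q \<in> K"
        then have "norm q \<le> R" using R by auto
        moreover have "norm p \<le> norm q + dist q p"
          by (metis dist_norm norm_triangle_sub dist_commute)
        ultimately show ?thesis using that by simp
      qed
      then show ?thesis using d that by (simp add: dist_norm)
    next
      case False
      then show ?thesis using z \<open>0 < e\<close> by simp
    qed
    then show "\<exists>d>0. \<forall>x\<in>UNIV. \<forall>x'\<in>UNIV. dist x' x < d \<longrightarrow> dist (G x') (G x) < e"
      using \<open>d > 0\<close> by (intro exI[of _ "min d 1"]) auto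
  qed
qed

text \<open>The mean value theorem for \<open>f - \<langle>\<cdot>, G q\<rangle>\<close> on a small ball around \<open>q\<close>; its radius depends only on the
modulus of continuity of \<open>G\<close>, so the linearization is uniform in \<open>q\<close>.\<close>

lemma uniform_linearization:
  fixes f :: "'a::euclidean_space \<Rightarrow> real"
  assumes f: "\<And>q. GDERIV f q :> G q" and uc: "uniformly_continuous_on UNIV G" and "0 < e"
  obtains d where "0 < d" "\<And>q h. norm h \<le> d \<Longrightarrow> \<bar>f (q + h) - f q - h \<bullet> G q\<bar> \<le> e * norm h"
proof -
  obtain d where d: "d > 0" "\<And>p q. dist p q < d \<Longrightarrow> dist (G p) (G q) < e"
    using uc \<open>0 < e\<close> unfolding uniformly_continuous_on_def by (metis UNIV_I)
  have "\<bar>f (q + h) - f q - h \<bullet> G q\<bar> \<le> e * norm h" if "norm h \<le> d / 2" for q h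
  proof -
    let ?g = "\<lambda>p. f p - p \<bullet> G q"
    have "\<bar>?g (q + h) - ?g q\<bar> \<le> e * norm (q + h - q)"
    proof (rule GDERIV_imp_lipschitz_bound)
      show "convex (ball q d)" by simp
      show "GDERIV ?g p :> (G p - G q)" for p
        by (intro GDERIV_diff f) (simp add: gderiv_def bounded_linear_imp_has_derivative bounded_linear_inner_left)
      show "norm (G p - G q) \<le> e" if "p \<in> ball q d" for p
        using d(2)[of p q] that by (simp add: dist_norm norm_minus_commute)
      show "q + h \<in> ball q d" "q \<in> ball q d" using that \<open>d > 0\<close> by (auto simp: dist_norm)
    qed
    then show ?thesis by (simp add: inner_add_left algebra_simps)
  qed
  then show ?thesis using that[of "d / 2"] \<open>d > 0\<close> by simp
qed

text \<open>Termwise differentiation without uniform convergence of the gradients. An increment \<open>h\<close> has a place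
in the decreasing sequence of scales, say \<open>\<delta> (Suc n) < |h| \<le> \<delta> n\<close>. The partial sum up to \<open>n\<close> is then
linear up to a small error, the terms after \<open>Suc n\<close> are negligible compared with \<open>|h|\<close>, and of the two terms in
between only their Lipschitz constants matter, which tend to \<open>0\<close>. So pointwise convergence of the
gradients at the single point \<open>q\<close> suffices.\<close>

lemma GDERIV_separated_scales:
  fixes f :: "nat \<Rightarrow> 'a::real_inner \<Rightarrow> real"
  assumes \<delta>: "\<And>n. 0 < \<delta> n" "decseq \<delta>" "\<delta> \<longlonglongrightarrow> 0"
    and lin: "\<And>n q h. norm h \<le> \<delta> n \<Longrightarrow>
      \<bar>(\<Sum>j<n. f j (q + h)) - (\<Sum>j<n. f j q) - h \<bullet> D n q\<bar> \<le> (1/2) ^ n * norm h"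
    and small: "\<And>n m q. n < m \<Longrightarrow> \<bar>f m q\<bar> \<le> (1/2) ^ m * \<delta> n"
    and lip: "\<And>n q h. \<bar>f n (q + h) - f n q\<bar> \<le> g n * norm h" and g: "g \<longlonglongrightarrow> 0"
    and conv: "(\<lambda>n. D n q) \<longlonglongrightarrow> P"
  shows "GDERIV (\<lambda>q. \<Sum>n. f n q) q :> P"
proof -
  \<comment> \<open>The relative error of the linearization at scale \<open>n\<close>.\<close>
  define c where "c n = 2 * (1/2) ^ n + g n + g (Suc n) + norm (D n q - P)" for n
  have c: "c \<longlonglongrightarrow> 2 * 0 + 0 + 0 + norm (P - P)"
    unfolding c_def using LIMSEQ_power_zero[of "1/2::real"] g LIMSEQ_Suc[OF g]
    by (intro tendsto_intros conv) auto
  have geo: "summable (\<lambda>m. (1/2::real) ^ m)" by (simp add: summable_geometric)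
  have sm: "summable (\<lambda>m. f m p)" for p
  proof (rule summable_comparison_test')
    show "summable (\<lambda>m. (1/2) ^ m * \<delta> 0)" by (intro summable_mult2 geo)
    show "norm (f m p) \<le> (1/2) ^ m * \<delta> 0" if "m \<ge> 1" for m using small[of 0 m p] that by simp
  qed
  have key: "\<bar>(\<Sum>m. f m (q + h)) - (\<Sum>m. f m q) - h \<bullet> P\<bar> \<le> c n * norm h"
    if h: "norm h \<le> \<delta> n" "\<delta> (Suc n) < norm h" for n h
  proof -
    let ?N = "Suc (Suc n)"
    have tail: "\<bar>\<Sum>m. f (m + ?N) p\<bar> \<le> (1/2) ^ Suc n * norm h" for p
    proof -
      have le: "norm (f (m + ?N) p) \<le> (1/2) ^ m * ((1/2) ^ ?N * norm h)" for m
      proof -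
        have "\<bar>f (m + ?N) p\<bar> \<le> (1/2) ^ (m + ?N) * \<delta> (Suc n)" by (rule small) simp
        also have "\<dots> \<le> (1/2) ^ (m + ?N) * norm h" using h by (intro mult_left_mono) auto
        finally show ?thesis by (simp add: power_add)
      qed
      have "norm (\<Sum>m. f (m + ?N) p) \<le> (\<Sum>m. (1/2) ^ m * ((1/2) ^ ?N * norm h))"
        by (rule norm_suminf_le[OF le]) (intro summable_mult2 geo)
      also have "\<dots> = 2 * ((1/2) ^ ?N * norm h)"
        by (subst suminf_mult2[symmetric, OF geo]) (simp add: suminf_geometric)
      finally show ?thesis by (simp add: mult.commute)
    qed
    have split: "(\<Sum>m. f m p) = (\<Sum>m. f (m + ?N) p) + ((\<Sum>j<n. f j p) + f n p + f (Suc n) p)" for p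
      using suminf_split_initial_segment[OF sm, of p ?N] by simp
    have hD: "\<bar>h \<bullet> D n q - h \<bullet> P\<bar> \<le> norm (D n q - P) * norm h"
      using Cauchy_Schwarz_ineq2[of h "D n q - P"] by (simp add: inner_diff_right mult.commute)
    have "\<bar>(\<Sum>m. f m (q + h)) - (\<Sum>m. f m q) - h \<bullet> P\<bar> \<le>
       (1/2) ^ n * norm h + g n * norm h + g (Suc n) * norm h + norm (D n q - P) * norm h
       + (1/2) ^ Suc n * norm h + (1/2) ^ Suc n * norm h"
      unfolding split
      using tail[of q] tail[of "q + h"] hD lin[OF h(1), of q] lip[of n q h] lip[of "Suc n" q h]
      by linarith
    also have "\<dots> = c n * norm h" by (simp add: c_def algebra_simps)
    finally show ?thesis .
  qed
  show ?thesis
    unfolding GDERIV_iff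
  proof (intro allI impI)
    fix e :: real assume "0 < e"
    then obtain K where K: "\<And>n. n \<ge> K \<Longrightarrow> c n < e"
      using order_tendstoD(2)[OF c, of e] by (auto simp: eventually_sequentially)
    have "\<bar>(\<Sum>m. f m (q + h)) - (\<Sum>m. f m q) - h \<bullet> P\<bar> \<le> e * norm h" if h: "norm h < \<delta> K" for h
    proof (cases "h = 0")
      case False
      then have ev: "\<exists>n. \<delta> n < norm h"
        using order_tendstoD(2)[OF \<delta>(3), of "norm h"] by (auto simp: eventually_sequentially)
      define N where "N = (LEAST n. \<delta> n < norm h)"
      have N: "\<delta> N < norm h" and lt: "\<And>n. n < N \<Longrightarrow> norm h \<le> \<delta> n"
        unfolding N_def using LeastI_ex[OF ev] not_less_Least by (auto simp: not_less[symmetric])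
      have "K < N"
      proof (rule ccontr)
        assume "\<not> K < N"
        then have "\<delta> K \<le> \<delta> N" using \<delta>(2) by (auto simp: decseq_def)
        then show False using N h by simp
      qed
      then obtain n where n: "N = Suc n" "K \<le> n" by (metis Suc_diff_1 gr0I less_Suc_eq_le not_less0)
      have "\<bar>(\<Sum>m. f m (q + h)) - (\<Sum>m. f m q) - h \<bullet> P\<bar> \<le> c n * norm h"
        using N lt[of n] n by (intro key) auto
      also have "\<dots> \<le> e * norm h" using K[OF n(2)] by (intro mult_right_mono) auto
      finally show ?thesis .
    qed simp
    then show "\<exists>d>0. \<forall>h. norm h < d \<longrightarrow> \<bar>(\<Sum>m. f m (q + h)) - (\<Sum>m. f m q) - h \<bullet> P\<bar> \<le> e * norm h"
      using \<delta>(1) by blast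
  qed
qed

section \<open>A game on the plane won by hysteresis\<close>

text \<open>The play operator: \<open>y\<close> is the midpoint of an interval of radius \<open>e\<close> that is dragged along by \<open>u\<close>
and moves only when \<open>u\<close> pushes against one of its ends.\<close>

definition play :: "real \<Rightarrow> real \<Rightarrow> real \<Rightarrow> real" where
  "play e u y = max (u - e) (min (u + e) y)"

lemma play_within: "0 \<le> e \<Longrightarrow> \<bar>u - play e u y\<bar> \<le> e"
  by (auto simp: play_def)

text \<open>The energy balance of an element with dry friction. The elastic energy \<open>(u - y)\<^sup>2 / 2\<close> available at
the new position \<open>u\<close> pays for the elastic energy that remains and for the work \<open>e |\<Delta>y|\<close> lost to
friction.\<close>

lemma play_dissipation:
  assumes "0 \<le> e"
  shows "(u - play e u y)\<^sup>2 / 2 + e * \<bar>play e u y - y\<bar> \<le> (u - y)\<^sup>2 / 2"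
proof -
  consider "\<bar>u - y\<bar> \<le> e" | "u - y > e" | "y - u > e" by linarith
  then show ?thesis
  proof cases
    case 1
    then have "play e u y = y" by (auto simp: play_def)
    then show ?thesis by simp
  next
    case 2
    then have p: "play e u y = u - e" using assms by (auto simp: play_def)
    have "0 \<le> (u - y - e)\<^sup>2" by simp
    with 2 show ?thesis unfolding p by (simp add: power2_eq_square field_simps)
  next
    case 3
    then have p: "play e u y = u + e" using assms by (auto simp: play_def)
    have "0 \<le> (y - u - e)\<^sup>2" by simp
    with 3 show ?thesis unfolding p by (simp add: power2_eq_square field_simps)
  qed
qed

lemma sum_half_powers_le: "(\<Sum>k<n. (1/2) ^ Suc k) \<le> (1::real)"
proof -
  have "(\<Sum>k<n. (1/2) ^ Suc k) = 1 - (1/2::real) ^ n"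
    by (induction n) auto
  then show ?thesis by simp
qed

text \<open>The opponent chooses the first coordinates \<open>x n\<close>; the strategy answers with the slope of the line on
which the next point has to lie, up to an error \<open>\<epsilon> n\<close>. The slope is that of the tangent of a downward
parabola, which makes every step gain energy, plus the forces of play operators of all radii
\<open>(1/2)^k\<close>. The \<open>k\<close>-th operator is at rest on \<open>x\<close> up to time \<open>k\<close>, so that only finitely many operators are active at
any time.\<close>

locale hysteresis_game =
  fixes x z :: "nat \<Rightarrow> real" and y :: "nat \<Rightarrow> nat \<Rightarrow> real" and \<epsilon> :: "nat \<Rightarrow> real"
  assumes bounded: "\<bar>x n\<bar> \<le> 1" "\<bar>z n\<bar> \<le> 1"
    and start: "y k 0 = x 0"
    and move: "y k (Suc n) = (if n < k then x (Suc n) else play ((1/2) ^ k) (x (Suc n)) (y k n))"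
    and slope: "\<bar>z (Suc n) - z n - ((\<Sum>k<n. (1/2) ^ Suc k * (x n - y k n)) - 2 * x n) * (x (Suc n) - x n)\<bar> \<le> \<epsilon> n"
    and summable: "summable \<epsilon>" and total: "suminf \<epsilon> \<le> 1"
begin

definition var where "var k n = (\<Sum>j=k..<n. \<bar>y k (Suc j) - y k j\<bar>)"
definition stored where "stored k n = (x n - y k n)\<^sup>2 / 2"
definition work where "work k n = stored k n + (1/2) ^ k * var k n"
definition potential where
  "potential n = z n + (x n)\<^sup>2 - (\<Sum>k<n. (1/2) ^ Suc k * work k n)"

lemma not_started: "n \<le> k \<Longrightarrow> y k n = x n"
  by (cases n) (auto simp: start move)

lemma near: "\<bar>x n - y k n\<bar> \<le> (1/2) ^ k"
proof (cases "n \<le> k")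
  case False
  then obtain m where "n = Suc m" "k \<le> m" by (metis Suc_diff_1 le_simps(2) linorder_not_le not_gr_zero)
  then show ?thesis using play_within by (simp add: move)
qed (simp add: not_started)

text \<open>The work of an operator grows at most by the force \<open>x n - y k n\<close> times the displacement, up to a
quadratic error.\<close>

lemma work_step:
  assumes "k \<le> n"
  shows "work k (Suc n) \<le> work k n + (x n - y k n) * (x (Suc n) - x n) + (x (Suc n) - x n)\<^sup>2 / 2"
proof -
  have "(x (Suc n) - y k (Suc n))\<^sup>2 / 2 + (1/2) ^ k * \<bar>y k (Suc n) - y k n\<bar> \<le> (x (Suc n) - y k n)\<^sup>2 / 2"
    using assms play_dissipation[of "(1/2) ^ k" "x (Suc n)" "y k n"] by (simp add: move)
  moreover have "(x (Suc n) - y k n)\<^sup>2 / 2 = (x n - y k n)\<^sup>2 / 2 + (x n - y k n) * (x (Suc n) - x n) + (x (Suc n) - x n)\<^sup>2 / 2"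
    by (simp add: power2_eq_square field_simps)
  ultimately show ?thesis
    using assms by (simp add: work_def stored_def var_def distrib_left)
qed

text \<open>The slope is chosen such that all first order terms cancel. Of the quadratic terms, the parabola
contributes \<open>(\<Delta>x)\<^sup>2\<close> and the operators, whose weights add up to at most \<open>1\<close>, at most \<open>(\<Delta>x)\<^sup>2 / 2\<close>.\<close>

lemma potential_step: "potential (Suc n) \<ge> potential n + (x (Suc n) - x n)\<^sup>2 / 2 - \<epsilon> n"
proof -
  define D where "D = x (Suc n) - x n"
  define S where "S = (\<Sum>k<n. (1/2) ^ Suc k * (x n - y k n))"
  have S': "(\<Sum>k<Suc n. (1/2) ^ Suc k * (x n - y k n)) = S"
    by (simp add: S_def not_started)
  have T': "(\<Sum>k<Suc n. (1/2) ^ Suc k * work k n) = (\<Sum>k<n. (1/2) ^ Suc k * work k n)"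
    by (simp add: work_def stored_def var_def not_started)
  have "(\<Sum>k<Suc n. (1/2) ^ Suc k * work k (Suc n))
      \<le> (\<Sum>k<Suc n. (1/2) ^ Suc k * (work k n + (x n - y k n) * D + D\<^sup>2 / 2))"
    using work_step D_def by (intro sum_mono mult_left_mono) auto
  also have "\<dots> = (\<Sum>k<Suc n. (1/2) ^ Suc k * work k n)
     + (\<Sum>k<Suc n. (1/2) ^ Suc k * (x n - y k n)) * D + (\<Sum>k<Suc n. (1/2) ^ Suc k) * (D\<^sup>2 / 2)"
    unfolding sum_distrib_right sum.distrib[symmetric]
    by (rule sum.cong) (simp_all only: distrib_left mult.assoc)
  also have "\<dots> \<le> (\<Sum>k<n. (1/2) ^ Suc k * work k n) + S * D + 1 * (D\<^sup>2 / 2)"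
    unfolding S' T' by (intro add_left_mono mult_right_mono sum_half_powers_le) auto
  finally have 1: "(\<Sum>k<Suc n. (1/2) ^ Suc k * work k (Suc n)) \<le> (\<Sum>k<n. (1/2) ^ Suc k * work k n) + S * D + D\<^sup>2 / 2"
    by simp
  have 2: "z (Suc n) \<ge> z n + (S - 2 * x n) * D - \<epsilon> n"
    using slope[of n] unfolding S_def D_def by linarith
  have 3: "(x (Suc n))\<^sup>2 = (x n)\<^sup>2 + 2 * x n * D + D\<^sup>2"
    by (simp add: D_def power2_eq_square algebra_simps)
  show ?thesis
    using 1 2 3 unfolding potential_def D_def[symmetric] by (simp add: algebra_simps)
qed

lemma work_nonneg: "0 \<le> work k n" "0 \<le> var k n"
  by (auto simp: work_def stored_def var_def intro!: add_nonneg_nonneg mult_nonneg_nonneg sum_nonneg)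

lemma error_nonneg: "0 \<le> \<epsilon> n"
  using slope[of n] by linarith

lemma error_sum: "(\<Sum>j<n. \<epsilon> j) \<le> 1"
  using sum_le_suminf[OF summable, of "{..<n}"] error_nonneg total by force

lemma potential_lower:
  "potential n \<ge> -1 + (\<Sum>j<n. (x (Suc j) - x j)\<^sup>2) / 2 - (\<Sum>j<n. \<epsilon> j)"
proof (induction n)
  case 0
  have "-1 \<le> z 0" "0 \<le> (x 0)\<^sup>2" using bounded(2)[of 0] by auto
  then show ?case unfolding potential_def lessThan_0 sum.empty by linarith
next
  case (Suc n)
  then show ?case using potential_step[of n] by (simp add: add_divide_distrib)
qed

text \<open>The potential starts at \<open>-1\<close> or above and the coordinates are bounded, so its gains bound both the quadratic
variation of \<open>x\<close> and the total work of the operators.\<close>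

lemma energy_bound:
  "(\<Sum>j<n. (x (Suc j) - x j)\<^sup>2) / 2 + (\<Sum>k<n. (1/2) ^ Suc k * work k n) \<le> 4"
proof -
  have "(x n)\<^sup>2 \<le> 1" using bounded(1)[of n] by (simp add: abs_square_le_1)
  then show ?thesis
    using potential_lower[of n] error_sum[of n] bounded(2)[of n] unfolding potential_def by linarith
qed

lemma step_energy: "(\<Sum>j<n. (x (Suc j) - x j)\<^sup>2) \<le> 8"
proof -
  have "0 \<le> (\<Sum>k<n. (1/2) ^ Suc k * work k n)" using work_nonneg by (intro sum_nonneg) auto
  then show ?thesis using energy_bound[of n] by linarith
qed

lemma var_bound: "(1/2) ^ Suc k * ((1/2) ^ k * var k n) \<le> 4"
proof (cases "k < n")
  case True
  have "(1/2) ^ Suc k * ((1/2) ^ k * var k n) \<le> (1/2) ^ Suc k * work k n"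
    by (intro mult_left_mono) (auto simp: work_def stored_def)
  also have "\<dots> \<le> (\<Sum>k<n. (1/2) ^ Suc k * work k n)"
    using True work_nonneg by (intro member_le_sum) auto
  also have "\<dots> \<le> 4"
    using energy_bound[of n] sum_nonneg[of "{..<n}" "\<lambda>j. (x (Suc j) - x j)\<^sup>2"] by simp
  finally show ?thesis .
qed (simp add: var_def)

text \<open>The work bounds the total variation of each operator, with a bound that depends on its radius.\<close>

lemma convergent_play: "convergent (y k)"
proof -
  have "summable (\<lambda>j. \<bar>y k (Suc (j + k)) - y k (j + k)\<bar>)"
  proof (rule bounded_imp_summable)
    fix n
    have "(\<Sum>j\<le>n. \<bar>y k (Suc (j + k)) - y k (j + k)\<bar>) = var k (Suc n + k)"
      unfolding var_def using sum.shift_bounds_nat_ivl[of "\<lambda>j. \<bar>y k (Suc j) - y k j\<bar>" 0 k "Suc n"]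
      by (simp add: atLeast0LessThan lessThan_Suc_atMost)
    also have "\<dots> \<le> 4 / ((1/2) ^ Suc k * (1/2) ^ k)"
      using var_bound[of k "Suc n + k"] by (simp add: field_simps)
    finally show "(\<Sum>j\<le>n. \<bar>y k (Suc (j + k)) - y k (j + k)\<bar>) \<le> 4 / ((1/2) ^ Suc k * (1/2) ^ k)" .
  qed simp
  then have "summable (\<lambda>j. y k (Suc j + k) - y k (j + k))"
    using summable_rabs_cancel[of "\<lambda>j. y k (Suc j + k) - y k (j + k)"] by simp
  then have "convergent (\<lambda>n. (\<Sum>j<n. y k (Suc j + k) - y k (j + k)) + y k k)"
    unfolding summable_iff_convergent by (intro convergent_add convergent_const)
  moreover have "(\<Sum>j<n. y k (Suc j + k) - y k (j + k)) + y k k = y k (n + k)" for n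
    using sum_lessThan_telescope[of "\<lambda>j. y k (j + k)" n] by simp
  ultimately have "convergent (\<lambda>n. y k (n + k))" by simp
  then show ?thesis by (simp add: convergent_ignore_initial_segment)
qed

text \<open>The sequence \<open>x\<close> stays within \<open>(1/2)^k\<close> of the convergent sequence \<open>y k\<close>, for every \<open>k\<close>.\<close>

lemma convergent_x: "convergent x"
proof (rule Cauchy_convergent, rule metric_CauchyI)
  fix e :: real assume "0 < e"
  then obtain k where k: "(1/2) ^ k < e / 3"
    using real_arch_pow_inv[of "e/3" "1/2"] by auto
  obtain N where N: "\<And>m n. m \<ge> N \<Longrightarrow> n \<ge> N \<Longrightarrow> dist (y k m) (y k n) < e / 3"
    using convergent_Cauchy[OF convergent_play[of k]] \<open>0 < e\<close> metric_CauchyD[of "y k" "e/3"] by auto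
  have "dist (x m) (x n) < e" if "m \<ge> N" "n \<ge> N" for m n
    using N[OF that] near[of m k] near[of n k] k unfolding dist_real_def by linarith
  then show "\<exists>M. \<forall>m\<ge>M. \<forall>n\<ge>M. dist (x m) (x n) < e" by blast
qed

text \<open>An operator that is not yet active stores no energy, so the finite sum is an infinite series, to
which Tannery's theorem applies.\<close>

lemma convergent_stored: "convergent (\<lambda>n. \<Sum>k<n. (1/2) ^ Suc k * stored k n)"
proof -
  have st: "stored k n \<le> 1" for k n
  proof -
    have "\<bar>x n - y k n\<bar> \<le> 1" using near[of n k] power_le_one[of "1/2::real" k] by linarith
    then have "(x n - y k n)\<^sup>2 \<le> 1" by (simp add: abs_square_le_1)
    then show ?thesis by (simp add: stored_def)
  qed
  have s: "summable (\<lambda>k. (1/2::real) ^ Suc k)"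
    by (subst summable_Suc_iff) (simp add: summable_geometric)
  have lim: "\<exists>L. stored k \<longlonglongrightarrow> L" for k
  proof -
    from convergent_x convergent_play[of k] obtain a b where "x \<longlonglongrightarrow> a" "y k \<longlonglongrightarrow> b"
      by (auto simp: convergent_def)
    then have "(\<lambda>n. (x n - y k n)\<^sup>2 / 2) \<longlonglongrightarrow> (a - b)\<^sup>2 / 2"
      by (intro tendsto_intros) auto
    then show ?thesis unfolding stored_def by blast
  qed
  then obtain l where l: "\<And>k. stored k \<longlonglongrightarrow> l k" by metis
  have "(\<lambda>n. \<Sum>k. (1/2) ^ Suc k * stored k n) \<longlonglongrightarrow> (\<Sum>k. (1/2) ^ Suc k * l k)"
  proof (rule tannerys_theorem[THEN conjunct2, THEN conjunct2])
    show "(\<lambda>n. (1/2) ^ Suc k * stored k n) \<longlonglongrightarrow> (1/2) ^ Suc k * l k" for k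
      by (intro tendsto_mult tendsto_const l)
    have "norm ((1/2) ^ Suc k * stored k n) \<le> (1/2) ^ Suc k" for k n
      using st[of k n] by (simp add: stored_def abs_mult)
    then have "\<forall>k n. norm ((1/2) ^ Suc k * stored k n) \<le> (1/2) ^ Suc k" by blast
    then show "\<forall>\<^sub>F (k, n) in sequentially \<times>\<^sub>F sequentially. norm ((1/2) ^ Suc k * stored k n) \<le> (1/2) ^ Suc k"
      by (intro always_eventually) (simp only: split_paired_All prod.case, blast)
    show "summable (\<lambda>k. (1/2::real) ^ Suc k)" by (rule s)
  qed simp
  moreover have "(\<Sum>k. (1/2) ^ Suc k * stored k n) = (\<Sum>k<n. (1/2) ^ Suc k * stored k n)" for n
    by (rule suminf_finite) (auto simp: stored_def not_started)
  ultimately show ?thesis by (auto simp: convergent_def)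
qed

lemma convergent_dissipated: "convergent (\<lambda>n. \<Sum>k<n. (1/2) ^ Suc k * ((1/2) ^ k * var k n))"
proof (rule Bseq_mono_convergent)
  let ?f = "\<lambda>n. \<Sum>k<n. (1/2) ^ Suc k * ((1/2) ^ k * var k n)"
  have nn: "0 \<le> ?f n" for n using work_nonneg by (intro sum_nonneg) auto
  have "?f n \<le> (\<Sum>k<n. (1/2) ^ Suc k * work k n)" for n
    by (intro sum_mono mult_left_mono) (auto simp: work_def stored_def)
  moreover have "(\<Sum>k<n. (1/2) ^ Suc k * work k n) \<le> 4" for n
    using energy_bound[of n] sum_nonneg[of "{..<n}" "\<lambda>j. (x (Suc j) - x j)\<^sup>2"] by simp
  ultimately have "?f n \<le> 4" for n by (meson order_trans)
  then show "Bseq ?f" using nn by (intro BseqI[of 4]) auto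
  have "?f n \<le> ?f (Suc n)" for n
  proof -
    have "?f n \<le> (\<Sum>k<n. (1/2) ^ Suc k * ((1/2) ^ k * var k (Suc n)))"
      by (intro sum_mono mult_left_mono) (auto simp: var_def)
    also have "\<dots> \<le> ?f (Suc n)" using work_nonneg(2)[of n "Suc n"] by simp
    finally show ?thesis .
  qed
  then show "\<forall>m. \<forall>n\<ge>m. ?f m \<le> ?f n" using lift_Suc_mono_le[of ?f] by blast
qed

lemma convergent_potential: "convergent potential"
proof -
  let ?g = "\<lambda>n. potential n + (\<Sum>j<n. \<epsilon> j)"
  have "?g n \<le> ?g (Suc n)" for n
    using potential_step[of n] zero_le_power2[of "x (Suc n) - x n"] unfolding sum.lessThan_Suc by linarith
  then have mono: "\<forall>m. \<forall>n\<ge>m. ?g m \<le> ?g n" using lift_Suc_mono_le[of ?g] by blast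
  have up: "?g n \<le> 3" for n
  proof -
    have "(x n)\<^sup>2 \<le> 1" using bounded(1)[of n] by (simp add: abs_square_le_1)
    moreover have "0 \<le> (\<Sum>k<n. (1/2) ^ Suc k * work k n)" using work_nonneg by (intro sum_nonneg) auto
    ultimately show ?thesis using bounded(2)[of n] error_sum[of n] unfolding potential_def by linarith
  qed
  have low: "?g n \<ge> -1" for n
    using potential_lower[of n] sum_nonneg[of "{..<n}" "\<lambda>j. (x (Suc j) - x j)\<^sup>2"] by simp
  have "\<bar>?g n\<bar> \<le> 3" for n using up[of n] low[of n] by linarith
  then have "Bseq ?g" by (intro BseqI[of 3]) auto
  then have "convergent ?g" using mono by (rule Bseq_mono_convergent)
  moreover have "convergent (\<lambda>n. \<Sum>j<n. \<epsilon> j)"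
    using summable by (simp add: summable_iff_convergent)
  ultimately have "convergent (\<lambda>n. ?g n - (\<Sum>j<n. \<epsilon> j))" by (rule convergent_diff)
  then show ?thesis by simp
qed

text \<open>The second coordinate is the potential minus a square plus the total work, and each of these converges.\<close>

lemma convergent_z: "convergent z"
proof -
  have "z n = potential n - x n * x n + ((\<Sum>k<n. (1/2) ^ Suc k * stored k n)
     + (\<Sum>k<n. (1/2) ^ Suc k * ((1/2) ^ k * var k n)))" for n
    unfolding potential_def work_def sum.distrib[symmetric] distrib_left by (simp add: power2_eq_square)
  then have "z = (\<lambda>n. potential n - x n * x n + ((\<Sum>k<n. (1/2) ^ Suc k * stored k n)
     + (\<Sum>k<n. (1/2) ^ Suc k * ((1/2) ^ k * var k n))))"
    by (rule ext)
  moreover have "convergent (\<lambda>n. potential n - x n * x n + ((\<Sum>k<n. (1/2) ^ Suc k * stored k n)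
     + (\<Sum>k<n. (1/2) ^ Suc k * ((1/2) ^ k * var k n))))"
    by (intro convergent_add convergent_diff convergent_mult convergent_x convergent_stored convergent_dissipated convergent_potential)
  ultimately show ?thesis by (simp only:)
qed

end

section \<open>Oscillating perturbations\<close>

text \<open>This makes squares of positive parts \<open>C\<^sup>1\<close>, which is all the smoothness that the bump functions and
mollifiers below need.\<close>

lemma DERIV_max_0_squared: "((\<lambda>s::real. (max 0 s)\<^sup>2) has_real_derivative 2 * max 0 s) (at s)"
proof -
  consider "s < 0" | "s > 0" | "s = 0" by linarith
  then show ?thesis
  proof cases
    case 1
    have "((\<lambda>s::real. 0) has_real_derivative 2 * max 0 s) (at s)" using 1 by simp
    then show ?thesis
      by (rule has_field_derivative_transform_within_open[of _ _ _ "{..<0}"]) (use 1 in auto)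
  next
    case 2
    have "((\<lambda>s::real. s\<^sup>2) has_real_derivative 2 * max 0 s) (at s)"
      using 2 by (auto intro!: derivative_eq_intros)
    then show ?thesis
      by (rule has_field_derivative_transform_within_open[of _ _ _ "{0<..}"]) (use 2 in auto)
  next
    case 3
    have "((\<lambda>h. ((max 0 (0 + h))\<^sup>2 - (max 0 0)\<^sup>2) / h) \<longlongrightarrow> 0) (at (0::real))"
    proof (rule tendsto_rabs_zero_cancel, rule tendsto_sandwich[of "\<lambda>_. 0" _ _ "\<lambda>h. \<bar>h\<bar>"])
      have "\<bar>((max 0 (0 + h))\<^sup>2 - (max 0 0)\<^sup>2) / h\<bar> \<le> \<bar>h\<bar>" for h :: real
        by (cases "h \<le> 0") (auto simp: max_def power2_eq_square)
      then show "\<forall>\<^sub>F h in at (0::real). \<bar>((max 0 (0 + h))\<^sup>2 - (max 0 0)\<^sup>2) / h\<bar> \<le> \<bar>h\<bar>" by simp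
      show "((\<lambda>h::real. \<bar>h\<bar>) \<longlongrightarrow> 0) (at 0)" by (rule tendsto_rabs_zero) simp
    qed auto
    then show ?thesis using 3 by (simp add: DERIV_def)
  qed
qed

definition bump :: "'a::real_inner \<Rightarrow> real \<Rightarrow> 'a \<Rightarrow> real" where
  "bump c \<rho> q = (max 0 (1 - (q - c) \<bullet> (q - c) / \<rho>\<^sup>2))\<^sup>2"

definition bump_gradient :: "'a::real_inner \<Rightarrow> real \<Rightarrow> 'a \<Rightarrow> 'a" where
  "bump_gradient c \<rho> q = (2 * max 0 (1 - (q - c) \<bullet> (q - c) / \<rho>\<^sup>2)) *\<^sub>R ((- 2 / \<rho>\<^sup>2) *\<^sub>R (q - c))"

lemma GDERIV_bump: "GDERIV (bump c \<rho>) q :> bump_gradient c \<rho> q"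
proof -
  have "((\<lambda>q. 1 - k * ((q - c) \<bullet> (q - c))) has_derivative (\<lambda>h. h \<bullet> ((- 2 * k) *\<^sub>R (q - c)))) (at q)" for k :: real
    by (auto intro!: derivative_eq_intros simp: fun_eq_iff inner_commute algebra_simps)
  from this[of "1 / \<rho>\<^sup>2"] have "GDERIV (\<lambda>q. 1 - (q - c) \<bullet> (q - c) / \<rho>\<^sup>2) q :> (- 2 / \<rho>\<^sup>2) *\<^sub>R (q - c)"
    by (simp add: gderiv_def)
  then show ?thesis
    unfolding bump_def bump_gradient_def by (rule GDERIV_DERIV_compose) (rule DERIV_max_0_squared)
qed

lemma continuous_bump: "continuous_on X (bump c \<rho>)" "continuous_on X (bump_gradient c \<rho>)"
proof -
  have "continuous_on X (\<lambda>q. (max 0 (1 - k * ((q - c) \<bullet> (q - c))))\<^sup>2)"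
    "continuous_on X (\<lambda>q. (2 * max 0 (1 - k * ((q - c) \<bullet> (q - c)))) *\<^sub>R (l *\<^sub>R (q - c)))" for k l :: real
    by (intro continuous_intros)+
  from this(1)[of "1 / \<rho>\<^sup>2"] this(2)[of "1 / \<rho>\<^sup>2" "- 2 / \<rho>\<^sup>2"]
  show "continuous_on X (bump c \<rho>)" "continuous_on X (bump_gradient c \<rho>)"
    unfolding bump_def bump_gradient_def by simp_all
qed

lemma bump_range: "0 \<le> bump c \<rho> q" "bump c \<rho> q \<le> 1"
proof -
  have "(q - c) \<bullet> (q - c) / \<rho>\<^sup>2 \<ge> 0" by simp
  then have "max 0 (1 - (q - c) \<bullet> (q - c) / \<rho>\<^sup>2) \<le> 1" by simp
  then show "bump c \<rho> q \<le> 1" unfolding bump_def by (intro power_le_one) auto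
qed (simp add: bump_def)

lemma bump_support:
  assumes "0 < \<rho>"
  shows "0 < bump c \<rho> q \<longleftrightarrow> q \<in> ball c \<rho>"
    and "q \<notin> ball c \<rho> \<Longrightarrow> bump c \<rho> q = 0" "q \<notin> ball c \<rho> \<Longrightarrow> bump_gradient c \<rho> q = 0"
proof -
  have "(q - c) \<bullet> (q - c) / \<rho>\<^sup>2 < 1 \<longleftrightarrow> (norm (q - c))\<^sup>2 < \<rho>\<^sup>2"
    unfolding power2_norm_eq_inner using assms by (subst pos_divide_less_eq) auto
  also have "\<dots> \<longleftrightarrow> norm (q - c) < \<rho>" using assms by (metis norm_ge_zero less_eq_real_def power2_less_imp_less power_strict_mono zero_less_numeral)
  also have "\<dots> \<longleftrightarrow> q \<in> ball c \<rho>" by (simp add: dist_norm norm_minus_commute)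
  finally have *: "(q - c) \<bullet> (q - c) / \<rho>\<^sup>2 < 1 \<longleftrightarrow> q \<in> ball c \<rho>" .
  have "0 < (max 0 (1 - u))\<^sup>2 \<longleftrightarrow> u < 1" for u :: real by (auto simp: max_def)
  then show "0 < bump c \<rho> q \<longleftrightarrow> q \<in> ball c \<rho>" unfolding *[symmetric] bump_def .
  show "q \<notin> ball c \<rho> \<Longrightarrow> bump c \<rho> q = 0" "q \<notin> ball c \<rho> \<Longrightarrow> bump_gradient c \<rho> q = 0"
    unfolding *[symmetric] by (auto simp: bump_def bump_gradient_def)
qed

text \<open>As \<open>n\<close> grows, these \<open>C\<^sup>1\<close> functions increase to the indicator function of the open ball.\<close>

definition cutoff :: "'a::real_inner \<Rightarrow> real \<Rightarrow> nat \<Rightarrow> 'a \<Rightarrow> real" where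
  "cutoff c \<rho> n q = 1 - (1 - bump c \<rho> q) ^ n"

definition cutoff_gradient :: "'a::real_inner \<Rightarrow> real \<Rightarrow> nat \<Rightarrow> 'a \<Rightarrow> 'a" where
  "cutoff_gradient c \<rho> n q = (real n * (1 - bump c \<rho> q) ^ (n - 1)) *\<^sub>R bump_gradient c \<rho> q"

lemma GDERIV_cutoff: "GDERIV (cutoff c \<rho> n) q :> cutoff_gradient c \<rho> n q"
  unfolding cutoff_def cutoff_gradient_def
  by (rule GDERIV_DERIV_compose[OF GDERIV_bump]) (auto intro!: derivative_eq_intros)

lemma continuous_cutoff: "continuous_on X (cutoff c \<rho> n)" "continuous_on X (cutoff_gradient c \<rho> n)"
  unfolding cutoff_def cutoff_gradient_def by (intro continuous_intros continuous_bump)+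

lemma cutoff_range: "0 \<le> cutoff c \<rho> n q" "cutoff c \<rho> n q \<le> 1"
  using bump_range[of c \<rho> q] by (auto simp: cutoff_def power_le_one)

lemma cutoff_support:
  assumes "0 < \<rho>" and "q \<notin> ball c \<rho>"
  shows "cutoff c \<rho> n q = 0" "cutoff_gradient c \<rho> n q = 0"
  using bump_support(2,3)[OF assms] by (simp_all add: cutoff_def cutoff_gradient_def)

lemma cutoff_tendsto:
  assumes "0 < \<rho>" and "q \<in> ball c \<rho>"
  shows "(\<lambda>n. cutoff c \<rho> n q) \<longlonglongrightarrow> 1"
proof -
  have "0 < bump c \<rho> q" "bump c \<rho> q \<le> 1" using assms bump_support(1) bump_range by blast+
  then have "(\<lambda>n. 1 - (1 - bump c \<rho> q) ^ n) \<longlonglongrightarrow> 1 - 0"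
    by (intro tendsto_intros LIMSEQ_power_zero) auto
  then show ?thesis by (simp add: cutoff_def)
qed

text \<open>In each ball the function \<open>\<eta> s(q \<bullet> v / \<eta>)\<close> is a wave of wave length proportional to \<open>\<eta>\<close> whose
gradient is a multiple of \<open>v\<close>. Multiplying it by the cutoff disturbs the gradient by at most \<open>\<eta>\<close> times the
gradient of the cutoff. The same \<open>\<eta>\<close> works for all profiles \<open>s\<close>; it is used for the sine and for the
cosine.\<close>

lemma oscillation_on_disjoint_balls:
  fixes c v :: "'i \<Rightarrow> 'a::euclidean_space" and \<kappa> :: "'i \<Rightarrow> 'a \<Rightarrow> real"
  assumes I: "finite I" "\<And>i j. i \<in> I \<Longrightarrow> j \<in> I \<Longrightarrow> i \<noteq> j \<Longrightarrow> ball (c i) (\<rho> i) \<inter> ball (c j) (\<rho> j) = {}"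
    and \<kappa>: "\<And>i q. i \<in> I \<Longrightarrow> GDERIV (\<kappa> i) q :> \<kappa>' i q"
      "\<And>i. i \<in> I \<Longrightarrow> continuous_on UNIV (\<kappa> i)" "\<And>i. i \<in> I \<Longrightarrow> continuous_on UNIV (\<kappa>' i)"
      "\<And>i q. i \<in> I \<Longrightarrow> 0 \<le> \<kappa> i q \<and> \<kappa> i q \<le> 1"
      "\<And>i q. i \<in> I \<Longrightarrow> q \<notin> ball (c i) (\<rho> i) \<Longrightarrow> \<kappa> i q = 0 \<and> \<kappa>' i q = 0"
    and "0 < \<epsilon>"
  obtains \<eta> where "0 < \<eta>"
    "\<And>s s' :: real \<Rightarrow> real. \<lbrakk>\<And>\<theta>. (s has_real_derivative s' \<theta>) (at \<theta>); \<And>\<theta>. \<bar>s \<theta>\<bar> \<le> 1; \<And>\<theta>. \<bar>s' \<theta>\<bar> \<le> 1; continuous_on UNIV s'\<rbrakk> \<Longrightarrow>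
     \<exists>\<phi> G. (\<forall>q. GDERIV \<phi> q :> G q) \<and> continuous_on UNIV G \<and> (\<forall>q. \<bar>\<phi> q\<bar> \<le> \<epsilon>) \<and>
       (\<forall>q. q \<notin> (\<Union>i\<in>I. ball (c i) (\<rho> i)) \<longrightarrow> \<phi> q = 0 \<and> G q = 0) \<and>
       (\<forall>i\<in>I. \<forall>q\<in>ball (c i) (\<rho> i). norm (G q - (\<kappa> i q * s' (q \<bullet> v i / \<eta>)) *\<^sub>R v i) \<le> \<epsilon>)"
proof -
  have sum_on: "(\<Sum>j\<in>I. F j) = F i" if "i \<in> I" "q \<in> ball (c i) (\<rho> i)" "\<And>j. j \<in> I \<Longrightarrow> q \<notin> ball (c j) (\<rho> j) \<Longrightarrow> F j = 0"
    for F :: "'i \<Rightarrow> 'b::comm_monoid_add" and i q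
  proof -
    have "F j = 0" if "j \<in> I - {i}" for j
      using that I(2)[of i j] \<open>i \<in> I\<close> \<open>q \<in> ball (c i) (\<rho> i)\<close>
      by (intro \<open>\<And>j. j \<in> I \<Longrightarrow> _ \<Longrightarrow> F j = 0\<close>) (blast, blast)
    then have "(\<Sum>j\<in>I. F j) = (\<Sum>j\<in>{i}. F j)"
      using that(1) I(1) by (intro sum.mono_neutral_right) auto
    then show ?thesis by simp
  qed
  have "bounded ((\<lambda>q. \<Sum>i\<in>I. norm (\<kappa>' i q)) ` (\<Union>i\<in>I. cball (c i) (\<rho> i)))"
    using I(1) \<kappa>(3) by (intro compact_imp_bounded compact_continuous_image continuous_intros compact_UN)
      (auto intro: continuous_on_subset)
  then obtain B where B0: "B > 0" and "\<And>q. q \<in> (\<Union>i\<in>I. cball (c i) (\<rho> i)) \<Longrightarrow> (\<Sum>i\<in>I. norm (\<kappa>' i q)) \<le> B"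
    unfolding bounded_pos by force
  then have B: "norm (\<kappa>' i q) \<le> B" if "i \<in> I" "q \<in> ball (c i) (\<rho> i)" for i q
  proof -
    have "norm (\<kappa>' i q) \<le> (\<Sum>i\<in>I. norm (\<kappa>' i q))" using that(1) I(1) by (intro member_le_sum) auto
    also have "\<dots> \<le> B" using that ball_subset_cball by (intro \<open>\<And>q. _ \<Longrightarrow> _ \<le> B\<close>) blast
    finally show ?thesis .
  qed
  define \<eta> where "\<eta> = \<epsilon> / (B + 1)"
  have \<eta>: "0 < \<eta>" "\<eta> \<le> \<epsilon>" "\<eta> * B \<le> \<epsilon>" using B0 \<open>0 < \<epsilon>\<close> by (auto simp: \<eta>_def field_simps)
  show thesis
  proof (rule that[OF \<eta>(1)])
    fix s s' :: "real \<Rightarrow> real"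
    assume s: "\<And>\<theta>. (s has_real_derivative s' \<theta>) (at \<theta>)" "\<And>\<theta>. \<bar>s \<theta>\<bar> \<le> 1" "\<And>\<theta>. \<bar>s' \<theta>\<bar> \<le> 1" "continuous_on UNIV s'"
    define \<phi> where "\<phi> q = (\<Sum>i\<in>I. \<kappa> i q * (\<eta> * s (q \<bullet> v i / \<eta>)))" for q
    define G where "G q = (\<Sum>i\<in>I. \<kappa> i q *\<^sub>R (s' (q \<bullet> v i / \<eta>) *\<^sub>R v i) + (\<eta> * s (q \<bullet> v i / \<eta>)) *\<^sub>R \<kappa>' i q)" for q
    have osc: "GDERIV (\<lambda>q. \<eta> * s (q \<bullet> v i / \<eta>)) q :> s' (q \<bullet> v i / \<eta>) *\<^sub>R v i" for i q
    proof -
      have "GDERIV (\<lambda>q. q \<bullet> v i) q :> v i"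
        by (simp add: gderiv_def bounded_linear_imp_has_derivative bounded_linear_inner_left)
      moreover have "((\<lambda>r. \<eta> * s (r / \<eta>)) has_real_derivative s' (q \<bullet> v i / \<eta>)) (at (q \<bullet> v i))"
        using \<eta>(1) by (auto intro!: derivative_eq_intros DERIV_chain2[OF s(1)])
      ultimately show ?thesis by (rule GDERIV_DERIV_compose)
    qed
    have grad: "GDERIV \<phi> q :> G q" for q
      unfolding \<phi>_def G_def using \<kappa>(1) osc by (intro GDERIV_sum I(1) GDERIV_mult) auto
    have "continuous_on UNIV s" using s(1) by (meson DERIV_isCont continuous_at_imp_continuous_on)
    then have cs: "continuous_on UNIV (\<lambda>q. s (q \<bullet> v i / \<eta>))" "continuous_on UNIV (\<lambda>q. s' (q \<bullet> v i / \<eta>))" for i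
      using \<eta>(1) by (auto intro!: continuous_on_compose2[OF \<open>continuous_on UNIV s\<close>]
          continuous_on_compose2[OF s(4)] continuous_on_divide continuous_on_inner continuous_on_id continuous_on_const)
    have cG: "continuous_on UNIV G"
      unfolding G_def using \<kappa>(2,3) cs by (intro continuous_intros) auto
    have on: "\<phi> q = \<kappa> i q * (\<eta> * s (q \<bullet> v i / \<eta>))"
      "G q = \<kappa> i q *\<^sub>R (s' (q \<bullet> v i / \<eta>) *\<^sub>R v i) + (\<eta> * s (q \<bullet> v i / \<eta>)) *\<^sub>R \<kappa>' i q"
      if "i \<in> I" "q \<in> ball (c i) (\<rho> i)" for i q
      unfolding \<phi>_def G_def using \<kappa>(5) by (intro sum_on[OF that]; simp)+
    have off: "\<phi> q = 0" "G q = 0" if "q \<notin> (\<Union>i\<in>I. ball (c i) (\<rho> i))" for q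
      unfolding \<phi>_def G_def using \<kappa>(5) that by (intro sum.neutral; simp)+
    have le: "\<bar>\<eta> * s \<theta>\<bar> \<le> \<eta>" for \<theta> using s(2)[of \<theta>] \<eta>(1) by (simp add: abs_mult)
    have small: "\<bar>\<phi> q\<bar> \<le> \<epsilon>" for q
    proof (cases "q \<in> (\<Union>i\<in>I. ball (c i) (\<rho> i))")
      case True
      then obtain i where i: "i \<in> I" "q \<in> ball (c i) (\<rho> i)" by blast
      have "\<bar>\<phi> q\<bar> \<le> 1 * \<eta>"
        unfolding on[OF i] abs_mult[of "\<kappa> i q"] using \<kappa>(4)[OF i(1)] le by (intro mult_mono) auto
      then show ?thesis using \<eta>(2) by simp
    qed (use off \<open>0 < \<epsilon>\<close> in simp)
    have err: "norm (G q - (\<kappa> i q * s' (q \<bullet> v i / \<eta>)) *\<^sub>R v i) \<le> \<epsilon>" if i: "i \<in> I" "q \<in> ball (c i) (\<rho> i)" for i q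
    proof -
      have "norm (G q - (\<kappa> i q * s' (q \<bullet> v i / \<eta>)) *\<^sub>R v i) = \<bar>\<eta> * s (q \<bullet> v i / \<eta>)\<bar> * norm (\<kappa>' i q)"
        by (simp add: on[OF i])
      also have "\<dots> \<le> \<eta> * B" using le B[OF i] \<eta>(1) by (intro mult_mono) auto
      finally show ?thesis using \<eta>(3) by simp
    qed
    show "\<exists>\<phi> G. (\<forall>q. GDERIV \<phi> q :> G q) \<and> continuous_on UNIV G \<and> (\<forall>q. \<bar>\<phi> q\<bar> \<le> \<epsilon>) \<and>
       (\<forall>q. q \<notin> (\<Union>i\<in>I. ball (c i) (\<rho> i)) \<longrightarrow> \<phi> q = 0 \<and> G q = 0) \<and>
       (\<forall>i\<in>I. \<forall>q\<in>ball (c i) (\<rho> i). norm (G q - (\<kappa> i q * s' (q \<bullet> v i / \<eta>)) *\<^sub>R v i) \<le> \<epsilon>)"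
      using grad cG small off err by blast
  qed
qed

text \<open>The direction field \<open>v\<close> is frozen at the centres of small disjoint balls. By Vitali's covering
theorem, finitely many of them carry almost all of the finite measure \<open>\<mu>\<close>. The size of \<open>t\<^sup>2\<close> needs no equidistribution
argument: the factors that belong to the sine and to the cosine have squares with sum equal to the
square of the cutoff, so one of the two has a weighted mean square of almost \<open>1/2\<close> at least.\<close>

lemma oscillating_perturbation:
  fixes U :: "'a::euclidean_space set" and v :: "'a \<Rightarrow> 'a" and f m :: "'a \<Rightarrow> real"
  assumes "open U" and v: "continuous_on U v" and m: "continuous_on U m" "\<And>q. q \<in> U \<Longrightarrow> 0 < m q"
    and "finite_measure \<mu>" and \<mu>: "sets \<mu> = sets borel" "absolutely_continuous lborel \<mu>"
    and f: "f \<in> borel_measurable borel" "\<And>q. 0 \<le> f q" "\<And>q. f q \<le> 1" "\<And>q. q \<notin> U \<Longrightarrow> f q = 0"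
    and "0 < \<epsilon>"
  obtains K \<phi> G t where "compact K" "K \<subseteq> U" "\<And>q. GDERIV \<phi> q :> G q" "continuous_on UNIV G"
    "\<And>q. q \<notin> K \<Longrightarrow> \<phi> q = 0 \<and> G q = 0" "\<And>q. q \<in> U \<Longrightarrow> \<bar>\<phi> q\<bar> \<le> m q"
    "\<And>q. q \<in> U \<Longrightarrow> norm (G q - t q *\<^sub>R v q) \<le> m q" "\<And>q. \<bar>t q\<bar> \<le> 1" "t \<in> borel_measurable borel"
    "(\<integral>q. f q * (t q)\<^sup>2 \<partial>\<mu>) \<ge> (\<integral>q. f q \<partial>\<mu>) / 2 - \<epsilon>"
proof -
  interpret finite_measure \<mu> by fact
  note result = that
  note [measurable_cong] = \<mu>(1)
  note f(1)[measurable]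
  define K0 where "K0 = {i. fst i \<in> U \<and> 0 < snd i \<and> cball (fst i) (snd i) \<subseteq> U \<and>
     (\<forall>q\<in>cball (fst i) (snd i). norm (v q - v (fst i)) \<le> m q / 2)}"
  have fine: "\<exists>i. i \<in> K0 \<and> x \<in> ball (fst i) (snd i) \<and> snd i < d" if "x \<in> U" "0 < d" for x d
  proof -
    have mx: "0 < m x" using m that by blast
    obtain e1 where e1: "e1 > 0" "cball x e1 \<subseteq> U" using \<open>open U\<close> \<open>x \<in> U\<close> open_contains_cball by blast
    obtain e2 where e2: "e2 > 0" "\<And>q. q \<in> U \<Longrightarrow> dist q x < e2 \<Longrightarrow> dist (v q) (v x) < m x / 4"
      using v \<open>x \<in> U\<close> mx unfolding continuous_on_iff by (metis divide_pos_pos zero_less_numeral)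
    obtain e3 where e3: "e3 > 0" "\<And>q. q \<in> U \<Longrightarrow> dist q x < e3 \<Longrightarrow> dist (m q) (m x) < m x / 2"
      using m(1) \<open>x \<in> U\<close> mx unfolding continuous_on_iff by (metis half_gt_zero)
    define r where "r = Min {e1, e2, e3, d} / 2"
    have r: "0 < r" "r \<le> e1" "r < e2" "r < e3" "r < d"
      using e1(1) e2(1) e3(1) \<open>0 < d\<close> by (auto simp: r_def min_def)
    have "norm (v q - v x) \<le> m q / 2" if "q \<in> cball x r" for q
    proof -
      have q: "q \<in> U" "dist q x < e2" "dist q x < e3" using that r e1(2) by (auto simp: dist_commute)
      have "dist (v q) (v x) < m x / 4" "dist (m q) (m x) < m x / 2" using e2(2) e3(2) q by auto
      then show ?thesis unfolding dist_norm real_norm_def by linarith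
    qed
    moreover have "cball x r \<subseteq> U" using e1(2) r(2) by auto
    ultimately have "(x, r) \<in> K0" using r \<open>x \<in> U\<close> by (simp add: K0_def)
    then show ?thesis using r by (intro exI[of _ "(x, r)"]) auto
  qed
  obtain C where C: "countable C" "C \<subseteq> K0" "pairwise (\<lambda>i j. disjnt (ball (fst i) (snd i)) (ball (fst j) (snd j))) C"
    "negligible (U - (\<Union>i\<in>C. ball (fst i) (snd i)))"
    by (rule Vitali_covering_theorem_balls[OF fine])
  have C0: "0 < snd i" "cball (fst i) (snd i) \<subseteq> U" "\<And>q. q \<in> cball (fst i) (snd i) \<Longrightarrow> norm (v q - v (fst i)) \<le> m q / 2"
    if "i \<in> C" for i
    using C(2) that by (auto simp: K0_def)
  have uniq: "i = j" if "i \<in> C" "j \<in> C" "q \<in> ball (fst i) (snd i)" "q \<in> ball (fst j) (snd j)" for i j q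
    using C(3) that unfolding pairwise_def disjnt_def by blast
  define I where "I n = {i\<in>C. to_nat_on C i < n}" for n
  have finI: "finite (I n)" for n
  proof (rule finite_imageD[of "to_nat_on C"])
    show "finite (to_nat_on C ` I n)" by (rule finite_subset[of _ "{..<n}"]) (auto simp: I_def)
    show "inj_on (to_nat_on C) (I n)" using inj_on_to_nat_on[OF C(1)] by (rule inj_on_subset) (auto simp: I_def)
  qed
  have IC: "I n \<subseteq> C" for n by (auto simp: I_def)
  define X where "X n q = (\<Sum>i\<in>I n. cutoff (fst i) (snd i) n q)" for n q
  have sum_ball: "(\<Sum>j\<in>I n. F j) = (if i \<in> I n then F i else 0)"
    if "i \<in> C" "q \<in> ball (fst i) (snd i)" "\<And>j. j \<in> C \<Longrightarrow> q \<notin> ball (fst j) (snd j) \<Longrightarrow> F j = 0" for n q i and F :: "_ \<Rightarrow> real"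
  proof -
    have "F j = 0" if "j \<in> I n" "j \<noteq> i" for j
      using uniq[OF \<open>i \<in> C\<close> _ \<open>q \<in> ball _ _\<close>, of j] that IC \<open>\<And>j. j \<in> C \<Longrightarrow> _ \<Longrightarrow> F j = 0\<close> by blast
    then have "(\<Sum>j\<in>I n. F j) = (\<Sum>j\<in>I n. if i = j then F i else 0)" by (intro sum.cong) auto
    then show ?thesis using finI by simp
  qed
  have X_ball: "X n q = (if i \<in> I n then cutoff (fst i) (snd i) n q else 0)" if "i \<in> C" "q \<in> ball (fst i) (snd i)" for n q i
    unfolding X_def using that C0(1) by (intro sum_ball cutoff_support) auto
  have X_off: "X n q = 0" if "q \<notin> (\<Union>i\<in>C. ball (fst i) (snd i))" for n q
    unfolding X_def
  proof (rule sum.neutral, rule ballI)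
    fix i assume "i \<in> I n"
    then show "cutoff (fst i) (snd i) n q = 0" using that IC by (intro cutoff_support C0(1)) auto
  qed
  have X01: "0 \<le> X n q" "X n q \<le> 1" for n q
  proof -
    show "0 \<le> X n q" unfolding X_def by (intro sum_nonneg cutoff_range)
    show "X n q \<le> 1"
      using X_ball[of _ q n] X_off[of q n] cutoff_range(2) by (cases "\<exists>i\<in>C. q \<in> ball (fst i) (snd i)") auto
  qed
  have X_lim: "(\<lambda>n. X n q) \<longlonglongrightarrow> 1" if q: "q \<in> (\<Union>i\<in>C. ball (fst i) (snd i))" for q
  proof -
    obtain i where i: "i \<in> C" "q \<in> ball (fst i) (snd i)" using q by blast
    have "cutoff (fst i) (snd i) n q = X n q" if "n > to_nat_on C i" for n
      using i that by (simp add: X_ball[OF i] I_def)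
    then have ev: "\<forall>\<^sub>F n in sequentially. cutoff (fst i) (snd i) n q = X n q"
      unfolding eventually_sequentially by (intro exI[of _ "Suc (to_nat_on C i)"]) auto
    show ?thesis by (rule Lim_transform_eventually[OF cutoff_tendsto[OF C0(1)[OF i(1)] i(2)] ev])
  qed
  have X_meas[measurable]: "X n \<in> borel_measurable borel" for n
    unfolding X_def by (intro borel_measurable_continuous_onI continuous_intros continuous_cutoff)
  have "U - (\<Union>i\<in>C. ball (fst i) (snd i)) \<in> sets borel"
    by (intro sets.Diff borel_open open_UN ballI open_ball \<open>open U\<close>)
  then have "U - (\<Union>i\<in>C. ball (fst i) (snd i)) \<in> null_sets lborel"
    by (metis C(4) negligible_iff_null_sets null_sets_completion_iff sets_lborel)
  then have "U - (\<Union>i\<in>C. ball (fst i) (snd i)) \<in> null_sets \<mu>"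
    by (rule subsetD[OF \<mu>(2)[unfolded absolutely_continuous_def]])
  then have ae: "AE q in \<mu>. q \<notin> U - (\<Union>i\<in>C. ball (fst i) (snd i))"
    by (rule AE_not_in)
  have "(\<lambda>n. \<integral>q. f q * (X n q)\<^sup>2 \<partial>\<mu>) \<longlonglongrightarrow> (\<integral>q. f q \<partial>\<mu>)"
  proof (rule integral_dominated_convergence[where w = "\<lambda>_. 1"])
    show "AE q in \<mu>. (\<lambda>n. f q * (X n q)\<^sup>2) \<longlonglongrightarrow> f q"
      using ae
    proof eventually_elim
      case (elim q)
      show ?case
      proof (cases "q \<in> U")
        case True
        then have "(\<lambda>n. f q * (X n q)\<^sup>2) \<longlonglongrightarrow> f q * 1\<^sup>2" using elim by (intro tendsto_intros X_lim) auto
        then show ?thesis by simp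
      qed (simp add: f(4))
    qed
    show "AE q in \<mu>. norm (f q * (X n q)\<^sup>2) \<le> 1" for n
    proof (rule AE_I2)
      fix q
      have "f q * (X n q)\<^sup>2 \<le> 1 * 1" using f X01 by (intro mult_mono power_le_one) auto
      then show "norm (f q * (X n q)\<^sup>2) \<le> 1" using f(2) by simp
    qed
  qed auto
  then have "\<forall>\<^sub>F n in sequentially. (\<integral>q. f q * (X n q)\<^sup>2 \<partial>\<mu>) > (\<integral>q. f q \<partial>\<mu>) - 2 * \<epsilon>"
    using \<open>0 < \<epsilon>\<close> by (intro order_tendstoD) auto
  then obtain n where n: "(\<integral>q. f q * (X n q)\<^sup>2 \<partial>\<mu>) > (\<integral>q. f q \<partial>\<mu>) - 2 * \<epsilon>"
    by (auto simp: eventually_sequentially)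
  define K where "K = (\<Union>i\<in>I n. cball (fst i) (snd i))"
  have K: "compact K" "K \<subseteq> U"
    unfolding K_def by (intro compact_UN finI ballI compact_cball) (use C0(2) IC in blast)
  obtain m0 where m0: "0 < m0" "\<And>q. q \<in> K \<Longrightarrow> 2 * m0 \<le> m q"
  proof (cases "K = {}")
    case True
    then show ?thesis using that[of 1] by simp
  next
    case False
    have "continuous_on K m" using m(1) K(2) continuous_on_subset by blast
    then obtain p where "p \<in> K" "\<And>q. q \<in> K \<Longrightarrow> m p \<le> m q"
      using continuous_attains_inf[OF K(1) False] by blast
    moreover have "0 < m p" using m(2) K(2) \<open>p \<in> K\<close> by blast
    ultimately show ?thesis by (intro that[of "m p / 2"]) simp_all
  qed
  obtain \<eta> where \<eta>: "0 < \<eta>" 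
    "\<And>s s' :: real \<Rightarrow> real. \<lbrakk>\<And>\<theta>. (s has_real_derivative s' \<theta>) (at \<theta>); \<And>\<theta>. \<bar>s \<theta>\<bar> \<le> 1; \<And>\<theta>. \<bar>s' \<theta>\<bar> \<le> 1; continuous_on UNIV s'\<rbrakk> \<Longrightarrow>
     \<exists>\<phi> G. (\<forall>q. GDERIV \<phi> q :> G q) \<and> continuous_on UNIV G \<and> (\<forall>q. \<bar>\<phi> q\<bar> \<le> m0) \<and>
       (\<forall>q. q \<notin> (\<Union>i\<in>I n. ball (fst i) (snd i)) \<longrightarrow> \<phi> q = 0 \<and> G q = 0) \<and>
       (\<forall>i\<in>I n. \<forall>q\<in>ball (fst i) (snd i). norm (G q - (cutoff (fst i) (snd i) n q * s' (q \<bullet> v (fst i) / \<eta>)) *\<^sub>R v (fst i)) \<le> m0)"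
  proof (rule oscillation_on_disjoint_balls[of "I n" fst snd "\<lambda>i. cutoff (fst i) (snd i) n" "\<lambda>i. cutoff_gradient (fst i) (snd i) n" m0 "\<lambda>i. v (fst i)"])
    show "ball (fst i) (snd i) \<inter> ball (fst j) (snd j) = {}" if "i \<in> I n" "j \<in> I n" "i \<noteq> j" for i j
      using uniq that IC by blast
    show "cutoff (fst i) (snd i) n q = 0 \<and> cutoff_gradient (fst i) (snd i) n q = 0"
      if "i \<in> I n" "q \<notin> ball (fst i) (snd i)" for i q
      using that IC C0(1) cutoff_support by blast
  qed (use finI GDERIV_cutoff continuous_cutoff cutoff_range m0(1) in auto)
  define T where "T s' q = (\<Sum>i\<in>I n. cutoff (fst i) (snd i) n q * s' (q \<bullet> v (fst i) / \<eta>))" for s' :: "real \<Rightarrow> real" and q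
  have T_ball: "T s' q = (if i \<in> I n then cutoff (fst i) (snd i) n q * s' (q \<bullet> v (fst i) / \<eta>) else 0)"
    if "i \<in> C" "q \<in> ball (fst i) (snd i)" for s' i q
    unfolding T_def
  proof (rule sum_ball[OF that])
    show "cutoff (fst j) (snd j) n q * s' (q \<bullet> v (fst j) / \<eta>) = 0" if "j \<in> C" "q \<notin> ball (fst j) (snd j)" for j
      using cutoff_support(1)[OF C0(1)[OF that(1)] that(2)] by simp
  qed
  have T_off: "T s' q = 0" if "q \<notin> (\<Union>i\<in>I n. ball (fst i) (snd i))" for s' q
    unfolding T_def
  proof (rule sum.neutral, rule ballI)
    fix i assume i: "i \<in> I n"
    then have "cutoff (fst i) (snd i) n q = 0" using that IC by (intro cutoff_support(1) C0(1)) auto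
    then show "cutoff (fst i) (snd i) n q * s' (q \<bullet> v (fst i) / \<eta>) = 0" by simp
  qed
  have T_meas[measurable]: "T s' \<in> borel_measurable borel" if "continuous_on UNIV s'" for s'
    unfolding T_def using \<eta>(1)
    by (intro borel_measurable_continuous_onI continuous_intros continuous_cutoff continuous_on_compose2[OF that]) auto
  \<comment> \<open>Sine and cosine as profiles have these two functions as derivatives; the balls are disjoint.\<close>
  have pythagoras: "(T cos q)\<^sup>2 + (T (\<lambda>\<theta>. - sin \<theta>) q)\<^sup>2 = (X n q)\<^sup>2" for q
  proof (cases "q \<in> (\<Union>i\<in>C. ball (fst i) (snd i))")
    case True
    then obtain i where i: "i \<in> C" "q \<in> ball (fst i) (snd i)" by blast
    have "a\<^sup>2 * (cos b)\<^sup>2 + a\<^sup>2 * (sin b)\<^sup>2 = a\<^sup>2" for a b :: real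
      unfolding distrib_left[symmetric] by simp
    then show ?thesis by (simp add: T_ball[OF i] X_ball[OF i] power_mult_distrib)
  next
    case False
    then have "q \<notin> (\<Union>i\<in>I n. ball (fst i) (snd i))" using IC by blast
    then show ?thesis using X_off[OF False] T_off by simp
  qed
  have T1: "\<bar>T s' q\<bar> \<le> 1" if "\<And>\<theta>. \<bar>s' \<theta>\<bar> \<le> 1" for s' q
  proof (cases "q \<in> (\<Union>i\<in>I n. ball (fst i) (snd i))")
    case True
    then obtain i where i: "i \<in> I n" "q \<in> ball (fst i) (snd i)" by blast
    have "\<bar>cutoff (fst i) (snd i) n q * s' (q \<bullet> v (fst i) / \<eta>)\<bar> \<le> 1"
      unfolding abs_mult using cutoff_range[of "fst i" "snd i" n q] that by (intro mult_le_one) auto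
    moreover have "i \<in> C" using i(1) IC by blast
    ultimately show ?thesis using i by (simp add: T_ball)
  qed (simp add: T_off)
  have int_T: "integrable \<mu> (\<lambda>q. f q * (T s' q)\<^sup>2)" if "\<And>\<theta>. \<bar>s' \<theta>\<bar> \<le> 1" "continuous_on UNIV s'" for s'
  proof (rule integrable_const_bound[of _ 1])
    show "AE q in \<mu>. norm (f q * (T s' q)\<^sup>2) \<le> 1"
    proof (rule AE_I2)
      fix q
      have "f q * (T s' q)\<^sup>2 \<le> 1 * 1" using f T1[OF that(1)] by (intro mult_mono) (auto simp: abs_square_le_1)
      then show "norm (f q * (T s' q)\<^sup>2) \<le> 1" using f(2) by simp
    qed
    have "(\<lambda>q. f q * (T s' q)\<^sup>2) \<in> borel_measurable borel"
      by (intro borel_measurable_times borel_measurable_power f(1) T_meas that(2))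
    then show "(\<lambda>q. f q * (T s' q)\<^sup>2) \<in> borel_measurable \<mu>"
      by (simp only: measurable_cong_sets[OF \<mu>(1) refl])
  qed
  have finish: thesis
    if s: "\<And>\<theta>. (s has_real_derivative s' \<theta>) (at \<theta>)" "\<And>\<theta>. \<bar>s \<theta>\<bar> \<le> 1" "\<And>\<theta>. \<bar>s' \<theta>\<bar> \<le> 1" "continuous_on UNIV s'"
      and large: "(\<integral>q. f q * (T s' q)\<^sup>2 \<partial>\<mu>) \<ge> (\<integral>q. f q \<partial>\<mu>) / 2 - \<epsilon>" for s s'
  proof -
    obtain \<phi> G where \<phi>: "\<And>q. GDERIV \<phi> q :> G q" "continuous_on UNIV G" "\<And>q. \<bar>\<phi> q\<bar> \<le> m0"
       "\<And>q. q \<notin> (\<Union>i\<in>I n. ball (fst i) (snd i)) \<Longrightarrow> \<phi> q = 0 \<and> G q = 0"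
       "\<And>i q. i \<in> I n \<Longrightarrow> q\<in>ball (fst i) (snd i) \<Longrightarrow> norm (G q - (cutoff (fst i) (snd i) n q * s' (q \<bullet> v (fst i) / \<eta>)) *\<^sub>R v (fst i)) \<le> m0"
      using \<eta>(2)[OF s] by blast
    have BK: "(\<Union>i\<in>I n. ball (fst i) (snd i)) \<subseteq> K" by (auto simp: K_def less_imp_le)
    show thesis
    proof (rule result[OF K \<phi>(1,2)])
      show "\<phi> q = 0 \<and> G q = 0" if "q \<notin> K" for q using that BK by (intro \<phi>(4)) blast
      show "\<bar>\<phi> q\<bar> \<le> m q" if "q \<in> U" for q
      proof (cases "q \<in> K")
        case True
        then show ?thesis using \<phi>(3)[of q] m0(1) m0(2)[of q] by linarith
      next
        case False
        then have "\<phi> q = 0" using BK by (intro \<phi>(4)[THEN conjunct1]) blast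
        then show ?thesis using m(2)[OF that] by simp
      qed
      show "norm (G q - T s' q *\<^sub>R v q) \<le> m q" if "q \<in> U" for q
      proof (cases "q \<in> (\<Union>i\<in>I n. ball (fst i) (snd i))")
        case True
        then obtain i where i: "i \<in> I n" "q \<in> ball (fst i) (snd i)" by blast
        have iC: "i \<in> C" using i(1) IC by blast
        have Tq: "T s' q = cutoff (fst i) (snd i) n q * s' (q \<bullet> v (fst i) / \<eta>)" using T_ball[OF iC i(2)] i(1) by simp
        have "norm (T s' q *\<^sub>R (v q - v (fst i))) \<le> 1 * (m q / 2)"
          unfolding norm_scaleR using T1[OF s(3)] C0(3)[OF iC, of q] i(2) by (intro mult_mono) simp_all
        moreover have "norm (G q - T s' q *\<^sub>R v (fst i)) \<le> m0" unfolding Tq by (rule \<phi>(5)[OF i])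
        moreover have eq: "G q - T s' q *\<^sub>R v q = (G q - T s' q *\<^sub>R v (fst i)) - T s' q *\<^sub>R (v q - v (fst i))"
          by (simp add: algebra_simps)
        moreover have "2 * m0 \<le> m q" using True BK m0(2) by blast
        ultimately show ?thesis
          using norm_triangle_ineq4[of "G q - T s' q *\<^sub>R v (fst i)" "T s' q *\<^sub>R (v q - v (fst i))"]
          unfolding eq by linarith
      next
        case False
        then show ?thesis using \<phi>(4)[OF False] T_off[OF False] m(2)[OF that] by simp
      qed
      show "\<bar>T s' q\<bar> \<le> 1" for q using s(3) by (rule T1)
      show "T s' \<in> borel_measurable borel" using s(4) by (rule T_meas)
    qed (rule large)
  qed
  have "(\<integral>q. f q * (X n q)\<^sup>2 \<partial>\<mu>) = (\<integral>q. f q * (T cos q)\<^sup>2 \<partial>\<mu>) + (\<integral>q. f q * (T (\<lambda>\<theta>. - sin \<theta>) q)\<^sup>2 \<partial>\<mu>)"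
    unfolding pythagoras[symmetric] distrib_left
    by (intro Bochner_Integration.integral_add int_T continuous_intros) auto
  then consider "(\<integral>q. f q * (T cos q)\<^sup>2 \<partial>\<mu>) \<ge> (\<integral>q. f q \<partial>\<mu>) / 2 - \<epsilon>"
    | "(\<integral>q. f q * (T (\<lambda>\<theta>. - sin \<theta>) q)\<^sup>2 \<partial>\<mu>) \<ge> (\<integral>q. f q \<partial>\<mu>) / 2 - \<epsilon>"
    using n by linarith
  then show thesis
  proof cases
    case 1
    show thesis
    proof (rule finish[of sin cos, OF _ _ _ _ 1])
      show "(sin has_real_derivative cos \<theta>) (at \<theta>)" for \<theta> :: real by (rule DERIV_sin)
      show "continuous_on UNIV (\<lambda>\<theta>::real. cos \<theta>)" by (intro continuous_on_cos continuous_on_id)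
    qed simp_all
  next
    case 2
    show thesis
    proof (rule finish[of cos "\<lambda>\<theta>. - sin \<theta>", OF _ _ _ _ 2])
      show "(cos has_real_derivative - sin \<theta>) (at \<theta>)" for \<theta> :: real by (rule DERIV_cos)
      show "continuous_on UNIV (\<lambda>\<theta>::real. - sin \<theta>)" by (intro continuous_on_minus continuous_on_sin continuous_on_id)
    qed simp_all
  qed
qed

section \<open>Saturating the eikonal equation\<close>

text \<open>The slope played in \<open>hysteresis_game\<close>.\<close>

definition slope :: "nat \<Rightarrow> (nat \<Rightarrow> real) \<Rightarrow> real \<Rightarrow> real" where
  "slope n y x = (\<Sum>k<n. (1/2) ^ Suc k * (x - y k)) - 2 * x"

text \<open>The factor \<open>1 - norm p\<close> keeps the gradient inside the unit disc; the squares of the other factors have a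
divergent sum, although they tend to \<open>0\<close>.\<close>

definition amplitude :: "nat \<Rightarrow> real^2 \<Rightarrow> real" where
  "amplitude n p = (1 - norm p) / (8 * sqrt (real (Suc n)))"

definition drift :: "nat \<Rightarrow> (nat \<Rightarrow> real) \<Rightarrow> real^2 \<Rightarrow> real^2" where
  "drift n y p = amplitude n p *\<^sub>R (axis 1 1 + slope n y (p $ 1) *\<^sub>R axis 2 1)"

lemma slope_bound:
  assumes "\<bar>x\<bar> \<le> 1" "\<And>k. \<bar>x - y k\<bar> \<le> 1"
  shows "\<bar>slope n y x\<bar> \<le> 3"
proof -
  have "\<bar>\<Sum>k<n. (1/2) ^ Suc k * (x - y k)\<bar> \<le> (\<Sum>k<n. \<bar>(1/2) ^ Suc k * (x - y k)\<bar>)"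
    by (rule sum_abs)
  also have "\<dots> \<le> (\<Sum>k<n. (1/2) ^ Suc k)"
    using assms(2) by (intro sum_mono) (auto simp: abs_mult intro!: mult_left_le)
  also have "\<dots> \<le> 1" by (rule sum_half_powers_le)
  finally show ?thesis using assms(1) unfolding slope_def by linarith
qed

lemma drift_components:
  "drift n y p $ 1 = amplitude n p" "drift n y p $ 2 = amplitude n p * slope n y (p $ 1)"
  by (simp_all add: drift_def axis_def)

lemma amplitude_bounds:
  assumes "norm p < 1"
  shows "0 < amplitude n p" "amplitude n p \<le> (1 - norm p) / 8" "amplitude n p \<le> 1 / (8 * sqrt (real (Suc n)))"
proof -
  have s: "1 \<le> sqrt (real (Suc n))" by simp
  then show "0 < amplitude n p" using assms by (simp add: amplitude_def)
  have "8 * 1 \<le> 8 * sqrt (real (Suc n))" using s by simp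
  then show "amplitude n p \<le> (1 - norm p) / 8"
    unfolding amplitude_def using assms by (intro divide_left_mono) auto
  show "amplitude n p \<le> 1 / (8 * sqrt (real (Suc n)))"
    unfolding amplitude_def using s by (intro divide_right_mono) auto
qed

lemma drift_bound:
  assumes "norm p < 1" "\<And>k. \<bar>p $ 1 - y k\<bar> \<le> 1"
  shows "norm (drift n y p) \<le> (1 - norm p) / 2" "norm (drift n y p) \<le> 1 / sqrt (real (Suc n))"
proof -
  have "\<bar>p $ 1\<bar> \<le> 1" using component_le_norm_cart[of p 1] assms(1) by linarith
  then have sl: "\<bar>slope n y (p $ 1)\<bar> \<le> 3" using assms(2) by (intro slope_bound)
  have "norm (axis 1 1 + slope n y (p $ 1) *\<^sub>R axis 2 1 :: real^2) \<le> 1 + \<bar>slope n y (p $ 1)\<bar> * 1"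
    by (rule norm_triangle_le) (simp add: norm_axis_1)
  then have "norm (axis 1 1 + slope n y (p $ 1) *\<^sub>R axis 2 1 :: real^2) \<le> 4" using sl by linarith
  then have *: "norm (drift n y p) \<le> amplitude n p * 4"
    unfolding drift_def norm_scaleR using amplitude_bounds(1)[OF assms(1), of n] by (intro mult_mono) auto
  show "norm (drift n y p) \<le> (1 - norm p) / 2"
    using * amplitude_bounds(2)[OF assms(1), of n] by linarith
  have "amplitude n p * 4 \<le> 1 / (8 * sqrt (real (Suc n))) * 4"
    using amplitude_bounds(3)[OF assms(1)] by (intro mult_right_mono) auto
  also have "\<dots> \<le> 1 / sqrt (real (Suc n))" by (simp add: field_simps)
  finally show "norm (drift n y p) \<le> 1 / sqrt (real (Suc n))" using * by linarith
qed

lemma continuous_drift: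
  assumes "continuous_on U p" "\<And>k. continuous_on U (Y k)"
  shows "continuous_on U (\<lambda>q. drift n (\<lambda>k. Y k q) (p q))"
  unfolding drift_def amplitude_def slope_def
  by (intro continuous_intros continuous_on_component assms) auto

definition deficit :: "'a set \<Rightarrow> ('a \<Rightarrow> 'b::real_normed_vector) \<Rightarrow> 'a \<Rightarrow> real" where
  "deficit U p q = indicator U q * (1 - norm (p q))\<^sup>2"

lemma deficit_range:
  assumes "\<And>q. q \<in> U \<Longrightarrow> norm (p q) \<le> 1"
  shows "0 \<le> deficit U p q" "deficit U p q \<le> 1"
  using assms[of q] by (auto simp: deficit_def indicator_def abs_square_le_1)

lemma deficit_measurable:
  assumes "open U" "continuous_on U p"
  shows "deficit U p \<in> borel_measurable borel"
proof -
  have "(\<lambda>q. indicator U q *\<^sub>R (1 - norm (p q))\<^sup>2) \<in> borel_measurable borel"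
    using assms by (intro borel_measurable_continuous_on_indicator continuous_intros) auto
  then show ?thesis by (simp add: deficit_def[abs_def])
qed

text \<open>One oscillation in the direction \<open>drift\<close>, so small that the new gradient stays in the open unit disc,
that it respects the bound \<open>m\<close> on the total correction, and that it is negligible on the scale \<open>\<delta>\<close> of
the oscillations before it.\<close>

lemma saturation_step:
  fixes U :: "(real^2) set" and p :: "real^2 \<Rightarrow> real^2" and Y :: "nat \<Rightarrow> real^2 \<Rightarrow> real"
  assumes "open U" and p: "continuous_on U p" "\<And>q. q \<in> U \<Longrightarrow> norm (p q) < 1"
    and Y: "\<And>k. continuous_on U (Y k)" "\<And>k q. q \<in> U \<Longrightarrow> \<bar>p q $ 1 - Y k q\<bar> \<le> 1"
    and m: "continuous_on U m" "\<And>q. q \<in> U \<Longrightarrow> 0 < m q" and "0 < \<delta>"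
    and \<mu>: "finite_measure \<mu>" "sets \<mu> = sets borel" "absolutely_continuous lborel \<mu>"
  obtains K \<phi> G t where "compact K" "K \<subseteq> U" "\<And>q. GDERIV \<phi> q :> G q" "continuous_on UNIV G"
    "\<And>q. q \<notin> K \<Longrightarrow> \<phi> q = 0 \<and> G q = 0"
    "\<And>q. q \<in> U \<Longrightarrow> \<bar>\<phi> q\<bar> \<le> (1/2) ^ Suc n * m q" "\<And>q. \<bar>\<phi> q\<bar> \<le> (1/2) ^ n * \<delta>"
    "\<And>q. q \<in> U \<Longrightarrow> norm (G q - t q *\<^sub>R drift n (\<lambda>k. Y k q) (p q)) \<le> (1/2) ^ (n + 3)"
    "\<And>q. \<bar>t q\<bar> \<le> 1" "t \<in> borel_measurable borel"
    "\<And>q. q \<in> U \<Longrightarrow> norm (p q + G q) < 1" "\<And>q. norm (G q) \<le> 1 / sqrt (real (Suc n)) + (1/2) ^ n"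
    "(\<integral>q. deficit U p q * (t q)\<^sup>2 \<partial>\<mu>) \<ge> (\<integral>q. deficit U p q \<partial>\<mu>) / 2 - (1/2) ^ n"
proof -
  note result = that
  let ?v = "\<lambda>q. drift n (\<lambda>k. Y k q) (p q)"
  \<comment> \<open>The drift uses at most half of the distance to the unit circle, so a quarter is left for the error.\<close>
  define M where "M q = min (min ((1/2) ^ (n + 3)) ((1 - norm (p q)) / 4)) (min ((1/2) ^ Suc n * m q) ((1/2) ^ n * \<delta>))" for q
  have M: "continuous_on U M" "\<And>q. q \<in> U \<Longrightarrow> 0 < M q"
    unfolding M_def using p m \<open>0 < \<delta>\<close> by (auto intro!: continuous_intros)
  have Mle: "M q \<le> (1/2) ^ (n + 3)" "M q \<le> (1 - norm (p q)) / 4" "M q \<le> (1/2) ^ Suc n * m q" "M q \<le> (1/2) ^ n * \<delta>" for q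
    unfolding M_def by linarith+
  have le1: "\<And>q. q \<in> U \<Longrightarrow> norm (p q) \<le> 1" using p(2) less_imp_le by blast
  have d: "deficit U p \<in> borel_measurable borel" "\<And>q. 0 \<le> deficit U p q" "\<And>q. deficit U p q \<le> 1"
    "\<And>q. q \<notin> U \<Longrightarrow> deficit U p q = 0" "0 < (1/2::real) ^ n"
    by (rule deficit_measurable[OF \<open>open U\<close> p(1)], (rule deficit_range, rule le1, assumption)+) (simp_all add: deficit_def)
  have v: "continuous_on U ?v" by (rule continuous_drift[OF p(1) Y(1)])
  obtain K \<phi> G t where *: "compact K" "K \<subseteq> U" "\<And>q. GDERIV \<phi> q :> G q" "continuous_on UNIV G"
    "\<And>q. q \<notin> K \<Longrightarrow> \<phi> q = 0 \<and> G q = 0" "\<And>q. q \<in> U \<Longrightarrow> \<bar>\<phi> q\<bar> \<le> M q"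
    "\<And>q. q \<in> U \<Longrightarrow> norm (G q - t q *\<^sub>R ?v q) \<le> M q" "\<And>q. \<bar>t q\<bar> \<le> 1" "t \<in> borel_measurable borel"
    "(\<integral>q. deficit U p q * (t q)\<^sup>2 \<partial>\<mu>) \<ge> (\<integral>q. deficit U p q \<partial>\<mu>) / 2 - (1/2) ^ n"
    by (rule oscillating_perturbation[OF \<open>open U\<close> v M \<mu> d], assumption, assumption, rule that)
  have dv: "norm (?v q) \<le> (1 - norm (p q)) / 2" "norm (?v q) \<le> 1 / sqrt (real (Suc n))" if "q \<in> U" for q
    using drift_bound[of "p q" "\<lambda>k. Y k q", OF p(2)[OF that] Y(2)[OF that]] by (simp_all only:)
  have tv: "norm (t q *\<^sub>R ?v q) \<le> norm (?v q)" for q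
    using *(8)[of q] by (simp add: mult_left_le_one_le)
  have G: "norm (G q) \<le> norm (?v q) + M q" if "q \<in> U" for q
    using norm_triangle_sub[of "G q" "t q *\<^sub>R ?v q"] tv[of q] *(7)[OF that] by linarith
  show thesis
  proof (rule result[OF *(1-5)])
    show "\<bar>\<phi> q\<bar> \<le> (1/2) ^ Suc n * m q" if "q \<in> U" for q using *(6)[OF that] Mle(3)[of q] by linarith
    show "\<bar>\<phi> q\<bar> \<le> (1/2) ^ n * \<delta>" for q
    proof (cases "q \<in> U")
      case True
      then show ?thesis using *(6)[OF True] Mle(4)[of q] by linarith
    next
      case False
      then have "\<phi> q = 0" using *(2,5) by blast
      then show ?thesis using \<open>0 < \<delta>\<close> by simp
    qed
    show "norm (G q - t q *\<^sub>R ?v q) \<le> (1/2) ^ (n + 3)" if "q \<in> U" for q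
      using *(7)[OF that] Mle(1)[of q] by linarith
    show "norm (p q + G q) < 1" if "q \<in> U" for q
    proof -
      have "norm (G q) \<le> (1 - norm (p q)) / 2 + (1 - norm (p q)) / 4"
        using G[OF that] Mle(2)[of q] dv(1)[OF that] by linarith
      then have "norm (G q) \<le> 3 / 4 * (1 - norm (p q))" by simp
      moreover have "3 / 4 * (1 - norm (p q)) < 1 * (1 - norm (p q))"
        using p(2)[OF that] by (intro mult_strict_right_mono) auto
      ultimately have "norm (p q) + norm (G q) < 1" by simp
      then show ?thesis using norm_triangle_ineq[of "p q" "G q"] by (rule le_less_trans[rotated])
    qed
    show "norm (G q) \<le> 1 / sqrt (real (Suc n)) + (1/2) ^ n" for q
    proof (cases "q \<in> U")
      case True
      have "(1/2::real) ^ (n + 3) \<le> (1/2) ^ n" by (rule power_decreasing) auto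
      then show ?thesis
        using G[OF True] Mle(1)[of q] dv(2)[OF True] by linarith
    next
      case False
      then have "G q = 0" using *(2,5) by blast
      then show ?thesis by simp
    qed
  qed (assumption | rule *(8-10))+
qed

text \<open>If the limit were positive, the series would dominate a multiple of the harmonic series.\<close>

lemma not_summable_harmonic_weight:
  fixes a :: "nat \<Rightarrow> real"
  assumes sum: "summable (\<lambda>n. a n / real (Suc n))" and lim: "a \<longlonglongrightarrow> c" and nonneg: "0 \<le> c"
  shows "c = 0"
proof (rule ccontr)
  assume "c \<noteq> 0"
  then have "c / 2 < c" "0 < c" using nonneg by auto
  then obtain N where N: "\<And>n. n \<ge> N \<Longrightarrow> c / 2 < a n"
    using order_tendstoD(1)[OF lim, of "c / 2"] by (auto simp: eventually_sequentially)
  have "summable (\<lambda>n. inverse (real (Suc n)))"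
  proof (rule summable_comparison_test')
    show "summable (\<lambda>n. 2 / c * (a n / real (Suc n)))" by (rule summable_mult[OF sum])
    show "norm (inverse (real (Suc n))) \<le> 2 / c * (a n / real (Suc n))" if "n \<ge> N" for n
    proof -
      have "1 \<le> 2 / c * a n" using N[OF that] \<open>0 < c\<close> by (simp add: field_simps)
      then have "1 / real (Suc n) \<le> 2 / c * a n / real (Suc n)" by (intro divide_right_mono) auto
      then show ?thesis by (simp add: inverse_eq_divide)
    qed
  qed
  then have "summable (\<lambda>n. inverse (real n))" by (subst (asm) summable_Suc_iff)
  then show False using not_summable_harmonic[where 'a = real] by simp
qed

text \<open>With a finite measure, the almost everywhere statement on all of \<open>U\<close> follows from integrals, without
cutting \<open>U\<close> into bounded pieces.\<close>

lemma finite_measure_equivalent_to_lborel: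
  obtains \<mu> :: "'a::euclidean_space measure" where "finite_measure \<mu>" "sets \<mu> = sets borel" "absolutely_continuous lborel \<mu>"
    "\<And>P. (AE q in \<mu>. P q) \<longleftrightarrow> (AE q in lborel. P q)"
proof -
  obtain h :: "'a \<Rightarrow> ennreal" where h: "h \<in> borel_measurable lborel" "integral\<^sup>N lborel h \<noteq> \<infinity>" "\<And>x. 0 < h x"
    using sigma_finite_measure.Ex_finite_integrable_function[OF lborel.sigma_finite_measure_axioms] by auto
  let ?\<mu> = "density lborel h"
  have "finite_measure ?\<mu>"
    using h(1,2) by (intro finite_measureI) (simp add: emeasure_density)
  moreover have "absolutely_continuous lborel ?\<mu>"
    using h(1) by (intro absolutely_continuousI_density)
  moreover have "(AE q in ?\<mu>. P q) \<longleftrightarrow> (AE q in lborel. P q)" for P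
    using h(1,3) by (simp add: AE_density)
  ultimately show thesis by (intro that[of ?\<mu>]) simp_all
qed

lemma play_continuous:
  assumes "continuous_on U f" "continuous_on U g"
  shows "continuous_on U (\<lambda>q. play e (f q) (g q))"
  unfolding play_def by (intro continuous_intros assms)

text \<open>The invariant of the partial sums: \<open>S\<close> has the continuous gradient \<open>D\<close>, and both vanish off a
compact subset of \<open>U\<close>.\<close>

definition C1_supported where
  "C1_supported U S D \<longleftrightarrow> (\<forall>q. GDERIV S q :> D q) \<and> continuous_on UNIV D \<and>
     (\<exists>K. compact K \<and> K \<subseteq> U \<and> (\<forall>q. q \<notin> K \<longrightarrow> S q = 0 \<and> D q = 0))"

lemma C1_supported_add:
  assumes "C1_supported U S D" and "\<And>q. GDERIV \<phi> q :> G q" "continuous_on UNIV G"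
    "compact K" "K \<subseteq> U" "\<And>q. q \<notin> K \<Longrightarrow> \<phi> q = 0 \<and> G q = 0"
  shows "C1_supported U (\<lambda>q. S q + \<phi> q) (\<lambda>q. D q + G q)"
proof -
  obtain L where L: "compact L" "L \<subseteq> U" "\<And>q. q \<notin> L \<Longrightarrow> S q = 0 \<and> D q = 0"
    using assms(1) by (auto simp: C1_supported_def)
  have "compact (L \<union> K) \<and> L \<union> K \<subseteq> U \<and> (\<forall>q. q \<notin> L \<union> K \<longrightarrow> S q + \<phi> q = 0 \<and> D q + G q = 0)"
    using L assms(4-6) by (simp add: compact_Un)
  then show ?thesis
    using assms(1-3) unfolding C1_supported_def by (blast intro: GDERIV_add continuous_on_add)
qed

text \<open>The iteration described at the beginning. At each point of \<open>U\<close> the two coordinates of the gradients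
form a run of \<open>hysteresis_game\<close> and hence converge; integrating the energy bound over \<open>U\<close> gives the statement
on the length of the limit.\<close>

theorem eikonal_saturation:
  fixes U :: "(real^2) set" and v\<^sub>0 :: "real^2 \<Rightarrow> real" and p\<^sub>0 :: "real^2 \<Rightarrow> real^2"
  assumes "open U" and v\<^sub>0: "\<And>q. q \<in> U \<Longrightarrow> GDERIV v\<^sub>0 q :> p\<^sub>0 q" "continuous_on U p\<^sub>0" "\<And>q. q \<in> U \<Longrightarrow> norm (p\<^sub>0 q) < 1"
    and m: "continuous_on U m" "\<And>q. q \<in> U \<Longrightarrow> 0 < m q"
  obtains v p where "\<And>q. q \<notin> U \<Longrightarrow> v q = v\<^sub>0 q" "\<And>q. q \<in> U \<Longrightarrow> \<bar>v q - v\<^sub>0 q\<bar> \<le> m q"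
    "\<And>q. q \<in> U \<Longrightarrow> GDERIV v q :> p q" "\<And>q. q \<in> U \<Longrightarrow> norm (p q) \<le> 1"
    "AE q in lborel. q \<in> U \<longrightarrow> norm (p q) = 1"
proof -
  note result = that
  obtain \<mu> :: "(real^2) measure" where \<mu>: "finite_measure \<mu>" "sets \<mu> = sets borel" "absolutely_continuous lborel \<mu>"
    and ae_\<mu>: "\<And>P. (AE q in \<mu>. P q) \<longleftrightarrow> (AE q in lborel. P q)"
    by (rule finite_measure_equivalent_to_lborel) (rule that)
  interpret finite_measure \<mu> by (rule \<mu>(1))
  \<comment> \<open>The state consists of the partial sum, its gradient, the play operators at every point, and the
    scale below which the partial sum is nearly linear.\<close>
  define inv where "inv n st \<longleftrightarrow> (case st of (S, D, Y, \<delta>) \<Rightarrow>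
      C1_supported U S D \<and> (\<forall>q\<in>U. norm (p\<^sub>0 q + D q) < 1) \<and> (\<forall>k. continuous_on U (Y k)) \<and>
      (\<forall>k. \<forall>q\<in>U. \<bar>(p\<^sub>0 q + D q) $ 1 - Y k q\<bar> \<le> 1) \<and> 0 < \<delta> \<and> \<delta> \<le> (1/2) ^ n \<and>
      (\<forall>q h. norm h \<le> \<delta> \<longrightarrow> \<bar>S (q + h) - S q - h \<bullet> D q\<bar> \<le> (1/2) ^ n * norm h) \<and>
      (n = 0 \<longrightarrow> S = (\<lambda>_. 0) \<and> D = (\<lambda>_. 0) \<and> (\<forall>k. Y k = (\<lambda>q. p\<^sub>0 q $ 1))))"
    for n and st :: "(real^2 \<Rightarrow> real) \<times> (real^2 \<Rightarrow> real^2) \<times> (nat \<Rightarrow> real^2 \<Rightarrow> real) \<times> real"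
  define nxt where "nxt n st st' \<longleftrightarrow> (case st of (S, D, Y, \<delta>) \<Rightarrow> case st' of (S', D', Y', \<delta>') \<Rightarrow>
      \<delta>' \<le> \<delta> \<and> (\<forall>q. \<bar>S' q - S q\<bar> \<le> (1/2) ^ n * \<delta>) \<and> (\<forall>q\<in>U. \<bar>S' q - S q\<bar> \<le> (1/2) ^ Suc n * m q) \<and>
      (\<forall>q. GDERIV (\<lambda>q. S' q - S q) q :> D' q - D q) \<and>
      (\<forall>q. norm (D' q - D q) \<le> 1 / sqrt (real (Suc n)) + (1/2) ^ n) \<and>
      (\<forall>k q. Y' k q = (if n < k then (p\<^sub>0 q + D' q) $ 1 else play ((1/2) ^ k) ((p\<^sub>0 q + D' q) $ 1) (Y k q))) \<and>
      (\<exists>t. t \<in> borel_measurable borel \<and> (\<forall>q. \<bar>t q\<bar> \<le> 1) \<and>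
         (\<forall>q\<in>U. norm (D' q - D q - t q *\<^sub>R drift n (\<lambda>k. Y k q) (p\<^sub>0 q + D q)) \<le> (1/2) ^ (n + 3)) \<and>
         (\<integral>q. deficit U (\<lambda>q. p\<^sub>0 q + D q) q * (t q)\<^sup>2 \<partial>\<mu>) \<ge> (\<integral>q. deficit U (\<lambda>q. p\<^sub>0 q + D q) q \<partial>\<mu>) / 2 - (1/2) ^ n))"
    for n and st st' :: "(real^2 \<Rightarrow> real) \<times> (real^2 \<Rightarrow> real^2) \<times> (nat \<Rightarrow> real^2 \<Rightarrow> real) \<times> real"
  have "\<exists>st. \<forall>n. inv n (st n) \<and> nxt n (st n) (st (Suc n))"
  proof (rule dependent_nat_choice)
    have "continuous_on U (\<lambda>q. p\<^sub>0 q $ 1)" by (intro continuous_on_component v\<^sub>0)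
    moreover have "C1_supported U (\<lambda>_. 0) (\<lambda>_. 0)"
      unfolding C1_supported_def by (intro conjI allI GDERIV_const continuous_on_const exI[of _ "{}"]) auto
    ultimately show "\<exists>st. inv 0 st"
      unfolding inv_def by (intro exI[of _ "(\<lambda>_. 0, \<lambda>_. 0, \<lambda>k q. p\<^sub>0 q $ 1, 1)"]) (simp add: v\<^sub>0(3))
  next
    fix st n assume "inv n st"
    obtain S D Y \<delta> where st: "st = (S, D, Y, \<delta>)" by (metis prod_cases4)
    have I: "C1_supported U S D" "\<And>q. q \<in> U \<Longrightarrow> norm (p\<^sub>0 q + D q) < 1" "\<And>k. continuous_on U (Y k)"
      "\<And>k q. q \<in> U \<Longrightarrow> \<bar>(p\<^sub>0 q + D q) $ 1 - Y k q\<bar> \<le> 1" "0 < \<delta>" "\<delta> \<le> (1/2) ^ n"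
      using \<open>inv n st\<close> by (auto simp: inv_def st)
    have "continuous_on U D" using I(1) continuous_on_subset by (auto simp: C1_supported_def)
    then have cp: "continuous_on U (\<lambda>q. p\<^sub>0 q + D q)" using v\<^sub>0(2) by (intro continuous_intros)
    obtain K \<phi> G t where *: "compact K" "K \<subseteq> U" "\<And>q. GDERIV \<phi> q :> G q" "continuous_on UNIV G"
      "\<And>q. q \<notin> K \<Longrightarrow> \<phi> q = 0 \<and> G q = 0"
      "\<And>q. q \<in> U \<Longrightarrow> \<bar>\<phi> q\<bar> \<le> (1/2) ^ Suc n * m q" "\<And>q. \<bar>\<phi> q\<bar> \<le> (1/2) ^ n * \<delta>"
      "\<And>q. q \<in> U \<Longrightarrow> norm (G q - t q *\<^sub>R drift n (\<lambda>k. Y k q) (p\<^sub>0 q + D q)) \<le> (1/2) ^ (n + 3)"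
      "\<And>q. \<bar>t q\<bar> \<le> 1" "t \<in> borel_measurable borel"
      "\<And>q. q \<in> U \<Longrightarrow> norm (p\<^sub>0 q + D q + G q) < 1" "\<And>q. norm (G q) \<le> 1 / sqrt (real (Suc n)) + (1/2) ^ n"
      "(\<integral>q. deficit U (\<lambda>q. p\<^sub>0 q + D q) q * (t q)\<^sup>2 \<partial>\<mu>) \<ge> (\<integral>q. deficit U (\<lambda>q. p\<^sub>0 q + D q) q \<partial>\<mu>) / 2 - (1/2) ^ n"
      by (rule saturation_step[OF \<open>open U\<close> cp I(2) I(3) I(4) m I(5) \<mu>], assumption, assumption, assumption, rule that)
    define S' where "S' q = S q + \<phi> q" for q
    define D' where "D' q = D q + G q" for q
    define Y' where "Y' k q = (if n < k then (p\<^sub>0 q + D' q) $ 1 else play ((1/2) ^ k) ((p\<^sub>0 q + D' q) $ 1) (Y k q))" for k q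
    have C': "C1_supported U S' D'"
      unfolding S'_def D'_def using C1_supported_add[OF I(1) *(3,4,1,2,5)] by blast
    then obtain K' where K': "compact K'" "\<And>q. q \<notin> K' \<Longrightarrow> D' q = 0" by (auto simp: C1_supported_def)
    have "uniformly_continuous_on UNIV D'"
      using C' K' by (intro uniformly_continuous_compact_support[of D' K']) (auto simp: C1_supported_def)
    moreover have "\<And>q. GDERIV S' q :> D' q" using C' by (auto simp: C1_supported_def)
    ultimately obtain d where d: "0 < d" "\<And>q h. norm h \<le> d \<Longrightarrow> \<bar>S' (q + h) - S' q - h \<bullet> D' q\<bar> \<le> (1/2) ^ Suc n * norm h"
      using uniform_linearization[of S' D' "(1/2) ^ Suc n"] by (metis half_gt_zero_iff power_Suc zero_less_one zero_less_power)
    \<comment> \<open>The scales decrease to \<open>0\<close>, and the next oscillation will be negligible on all of them.\<close>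
    define \<delta>' where "\<delta>' = min d (min \<delta> ((1/2) ^ Suc n))"
    have cD': "continuous_on U D'" using C' continuous_on_subset by (auto simp: C1_supported_def)
    have cY': "continuous_on U (Y' k)" for k
      unfolding Y'_def using v\<^sub>0(2) cD' I(3)
      by (cases "n < k") (auto intro!: play_continuous continuous_on_component continuous_on_add)
    have nearY': "\<bar>(p\<^sub>0 q + D' q) $ 1 - Y' k q\<bar> \<le> 1" for k q
      using play_within[of "(1/2) ^ k" "(p\<^sub>0 q + D' q) $ 1" "Y k q"] power_le_one[of "1/2::real" k] by (simp add: Y'_def)
    have \<delta>': "0 < \<delta>'" "\<delta>' \<le> d" "\<delta>' \<le> \<delta>" "\<delta>' \<le> (1/2) ^ Suc n"
      using d(1) I(5) unfolding \<delta>'_def by auto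
    have less1: "norm (p\<^sub>0 q + D' q) < 1" if "q \<in> U" for q using *(11)[OF that] by (simp add: D'_def add.assoc)
    have "inv (Suc n) (S', D', Y', \<delta>')"
      unfolding inv_def prod.case
    proof (intro conjI allI ballI impI)
      show "\<bar>S' (q + h) - S' q - h \<bullet> D' q\<bar> \<le> (1/2) ^ Suc n * norm h" if "norm h \<le> \<delta>'" for q h
        using that \<delta>'(2) by (intro d(2)) linarith
    qed (use C' less1 cY' nearY' \<delta>' in auto)
    moreover have "nxt n st (S', D', Y', \<delta>')"
      unfolding nxt_def st prod.case
    proof (intro conjI allI ballI exI[of _ t])
      show "GDERIV (\<lambda>q. S' q - S q) q :> D' q - D q" for q using *(3) by (simp add: S'_def D'_def)
      show "Y' k q = (if n < k then (p\<^sub>0 q + D' q) $ 1 else play ((1/2) ^ k) ((p\<^sub>0 q + D' q) $ 1) (Y k q))" for k q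
        by (simp only: Y'_def)
      show "norm (D' q - D q - t q *\<^sub>R drift n (\<lambda>k. Y k q) (p\<^sub>0 q + D q)) \<le> (1/2) ^ (n + 3)" if "q \<in> U" for q
        using *(8)[OF that] by (simp add: D'_def)
      show "\<bar>S' q - S q\<bar> \<le> (1/2) ^ Suc n * m q" if "q \<in> U" for q using *(6)[OF that] by (simp add: S'_def)
      show "\<bar>S' q - S q\<bar> \<le> (1/2) ^ n * \<delta>" for q using *(7)[of q] by (simp add: S'_def)
      show "norm (D' q - D q) \<le> 1 / sqrt (real (Suc n)) + (1/2) ^ n" for q using *(12)[of q] by (simp add: D'_def)
    qed (use *(9,10,13) \<delta>' in auto)
    ultimately show "\<exists>st'. inv (Suc n) st' \<and> nxt n st st'" by blast
  qed
  then obtain st where st: "\<And>n. inv n (st n)" "\<And>n. nxt n (st n) (st (Suc n))" by blast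
  define S where "S n = fst (st n)" for n
  define D where "D n = fst (snd (st n))" for n
  define Y where "Y n = fst (snd (snd (st n)))" for n
  define \<delta> where "\<delta> n = snd (snd (snd (st n)))" for n
  have st_eq: "st n = (S n, D n, Y n, \<delta> n)" for n by (simp add: S_def D_def Y_def \<delta>_def)
  define P where "P n q = p\<^sub>0 q + D n q" for n q
  have inv: "C1_supported U (S n) (D n)" "\<And>q. q \<in> U \<Longrightarrow> norm (P n q) < 1" "0 < \<delta> n" "\<delta> n \<le> (1/2) ^ n"
      "\<And>q h. norm h \<le> \<delta> n \<Longrightarrow> \<bar>S n (q + h) - S n q - h \<bullet> D n q\<bar> \<le> (1/2) ^ n * norm h"
      "S 0 = (\<lambda>_. 0)" "D 0 = (\<lambda>_. 0)" "\<And>k. Y 0 k = (\<lambda>q. p\<^sub>0 q $ 1)" for n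
    using st(1)[of n] st(1)[of 0] unfolding st_eq inv_def prod.case P_def by blast+
  have nxt: "\<delta> (Suc n) \<le> \<delta> n" "\<And>q. \<bar>S (Suc n) q - S n q\<bar> \<le> (1/2) ^ n * \<delta> n"
      "\<And>q. q \<in> U \<Longrightarrow> \<bar>S (Suc n) q - S n q\<bar> \<le> (1/2) ^ Suc n * m q"
      "\<And>q. GDERIV (\<lambda>q. S (Suc n) q - S n q) q :> D (Suc n) q - D n q"
      "\<And>q. norm (D (Suc n) q - D n q) \<le> 1 / sqrt (real (Suc n)) + (1/2) ^ n"
      "\<And>k q. Y (Suc n) k q = (if n < k then P (Suc n) q $ 1 else play ((1/2) ^ k) (P (Suc n) q $ 1) (Y n k q))"
      "\<exists>t. t \<in> borel_measurable borel \<and> (\<forall>q. \<bar>t q\<bar> \<le> 1) \<and>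
         (\<forall>q\<in>U. norm (D (Suc n) q - D n q - t q *\<^sub>R drift n (\<lambda>k. Y n k q) (P n q)) \<le> (1/2) ^ (n + 3)) \<and>
         (\<integral>q. deficit U (P n) q * (t q)\<^sup>2 \<partial>\<mu>) \<ge> (\<integral>q. deficit U (P n) q \<partial>\<mu>) / 2 - (1/2) ^ n" for n
    using st(2)[of n] unfolding st_eq nxt_def prod.case P_def[abs_def] by blast+
  obtain t where t: "\<And>n. t n \<in> borel_measurable borel" "\<And>n q. \<bar>t n q\<bar> \<le> 1"
      "\<And>n q. q \<in> U \<Longrightarrow> norm (D (Suc n) q - D n q - t n q *\<^sub>R drift n (\<lambda>k. Y n k q) (P n q)) \<le> (1/2) ^ (n + 3)"
      "\<And>n. (\<integral>q. deficit U (P n) q * (t n q)\<^sup>2 \<partial>\<mu>) \<ge> (\<integral>q. deficit U (P n) q \<partial>\<mu>) / 2 - (1/2) ^ n"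
  proof -
    have "\<exists>t. \<forall>n. t n \<in> borel_measurable borel \<and> (\<forall>q. \<bar>t n q\<bar> \<le> 1) \<and>
         (\<forall>q\<in>U. norm (D (Suc n) q - D n q - t n q *\<^sub>R drift n (\<lambda>k. Y n k q) (P n q)) \<le> (1/2) ^ (n + 3)) \<and>
         (\<integral>q. deficit U (P n) q * (t n q)\<^sup>2 \<partial>\<mu>) \<ge> (\<integral>q. deficit U (P n) q \<partial>\<mu>) / 2 - (1/2) ^ n"
      using nxt(7) by (intro choice allI)
    then show thesis using that by blast
  qed
  have game: "hysteresis_game (\<lambda>n. P n q $ 1) (\<lambda>n. P n q $ 2) (\<lambda>k n. Y n k q) (\<lambda>n. (1/2) ^ Suc n)"
    and energy: "\<And>N. (\<Sum>n<N. deficit U (P n) q * (t n q)\<^sup>2 / real (Suc n)) \<le> 1088" if q: "q \<in> U" for q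
  proof -
    define x where "x n = P n q $ 1" for n
    define e where "e n = D (Suc n) q - D n q - t n q *\<^sub>R drift n (\<lambda>k. Y n k q) (P n q)" for n
    have e: "norm (e n) \<le> (1/2) ^ (n + 3)" for n unfolding e_def using t(3)[OF q] .
    then have e1: "\<bar>e n $ 1\<bar> \<le> (1/2) ^ (n + 3)" and e2: "\<bar>e n $ 2\<bar> \<le> (1/2) ^ (n + 3)" for n
      using component_le_norm_cart order_trans by blast+
    have "P (Suc n) q - P n q = t n q *\<^sub>R drift n (\<lambda>k. Y n k q) (P n q) + e n" for n
      by (simp add: P_def e_def)
    then have "(P (Suc n) q - P n q) $ i = (t n q *\<^sub>R drift n (\<lambda>k. Y n k q) (P n q) + e n) $ i" for n i by simp
    from this[of _ 1] this[of _ 2]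
    have dx: "x (Suc n) - x n = t n q * amplitude n (P n q) + e n $ 1"
      and dz: "P (Suc n) q $ 2 - P n q $ 2 = t n q * amplitude n (P n q) * slope n (\<lambda>k. Y n k q) (x n) + e n $ 2" for n
      by (simp_all add: drift_components x_def)
    have near: "\<bar>x n - Y n k q\<bar> \<le> 1" for n k
      using st(1)[of n] q unfolding st_eq inv_def P_def x_def by simp
    have bounds: "\<bar>P n q $ i\<bar> \<le> 1" for n i
      using component_le_norm_cart[of "P n q" i] inv(2)[OF q, of n] by linarith
    have sl: "\<bar>slope n (\<lambda>k. Y n k q) (x n)\<bar> \<le> 3" for n
      using bounds[of n 1] near unfolding x_def by (intro slope_bound)
    show g: "hysteresis_game (\<lambda>n. P n q $ 1) (\<lambda>n. P n q $ 2) (\<lambda>k n. Y n k q) (\<lambda>n. (1/2) ^ Suc n)"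
    proof
      show "\<bar>P n q $ 1\<bar> \<le> 1" "\<bar>P n q $ 2\<bar> \<le> 1" for n by (rule bounds)+
      show "Y 0 k q = P 0 q $ 1" for k by (simp add: inv P_def)
      show "Y (Suc n) k q = (if n < k then P (Suc n) q $ 1 else play ((1/2) ^ k) (P (Suc n) q $ 1) (Y n k q))" for k n
        by (rule nxt(6))
      show "\<bar>P (Suc n) q $ 2 - P n q $ 2 - ((\<Sum>k<n. (1/2) ^ Suc k * (P n q $ 1 - Y n k q)) - 2 * P n q $ 1) * (P (Suc n) q $ 1 - P n q $ 1)\<bar> \<le> (1/2) ^ Suc n" for n
      proof -
        let ?s = "slope n (\<lambda>k. Y n k q) (x n)"
        have "P (Suc n) q $ 2 - P n q $ 2 - ?s * (x (Suc n) - x n) = e n $ 2 - ?s * e n $ 1"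
          unfolding dz dx by (simp add: algebra_simps)
        also have "\<bar>\<dots>\<bar> \<le> \<bar>e n $ 2\<bar> + \<bar>?s\<bar> * \<bar>e n $ 1\<bar>"
          using abs_triangle_ineq4[of "e n $ 2" "?s * e n $ 1"] by (simp add: abs_mult)
        also have "\<dots> \<le> (1/2) ^ (n + 3) + 3 * (1/2) ^ (n + 3)"
          using e1 e2 sl by (intro add_mono mult_mono) auto
        also have "\<dots> = (1/2) ^ Suc n" by (simp add: power_add power3_eq_cube)
        finally show ?thesis unfolding slope_def x_def .
      qed
      show "summable (\<lambda>n. (1/2::real) ^ Suc n)"
        by (subst summable_Suc_iff) (simp add: summable_geometric)
      show "(\<Sum>n. (1/2::real) ^ Suc n) \<le> 1"
        by (rule suminf_le_const) (auto simp: summable_Suc_iff summable_geometric sum_half_powers_le simp del: power_Suc)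
    qed
    show "(\<Sum>n<N. deficit U (P n) q * (t n q)\<^sup>2 / real (Suc n)) \<le> 1088" for N
    proof -
      interpret hysteresis_game "\<lambda>n. P n q $ 1" "\<lambda>n. P n q $ 2" "\<lambda>k n. Y n k q" "\<lambda>n. (1/2) ^ Suc n" by (rule g)
      have "deficit U (P n) q * (t n q)\<^sup>2 / real (Suc n) \<le> 128 * (x (Suc n) - x n)\<^sup>2 + 64 * (1/2) ^ Suc n" for n
      proof -
        have "deficit U (P n) q * (t n q)\<^sup>2 / real (Suc n) = 64 * (t n q * amplitude n (P n q))\<^sup>2"
          using q by (simp add: deficit_def amplitude_def power_mult_distrib power_divide del: of_nat_Suc)
        also have "t n q * amplitude n (P n q) = (x (Suc n) - x n) - e n $ 1" using dx[of n] by simp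
        also have "64 * ((x (Suc n) - x n) - e n $ 1)\<^sup>2 \<le> 64 * (2 * (x (Suc n) - x n)\<^sup>2 + 2 * (e n $ 1)\<^sup>2)"
        proof -
          have "0 \<le> ((x (Suc n) - x n) + e n $ 1)\<^sup>2" by simp
          then show ?thesis by (simp add: power2_eq_square algebra_simps)
        qed
        also have "(e n $ 1)\<^sup>2 \<le> (1/2) ^ (n + 3)"
        proof -
          have "\<bar>e n $ 1\<bar> * \<bar>e n $ 1\<bar> \<le> (1/2) ^ (n + 3) * 1"
            using e1[of n] power_le_one[of "1/2::real" "n + 3"] by (intro mult_mono) auto
          then show ?thesis by (simp add: power2_eq_square abs_mult_self_eq)
        qed
        also have "(1/2::real) ^ (n + 3) = (1/2) ^ Suc n / 4" by (simp add: power_add power3_eq_cube)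
        finally show ?thesis by (simp add: field_simps)
      qed
      then have "(\<Sum>n<N. deficit U (P n) q * (t n q)\<^sup>2 / real (Suc n)) \<le> (\<Sum>n<N. 128 * (x (Suc n) - x n)\<^sup>2 + 64 * (1/2) ^ Suc n)"
        by (intro sum_mono)
      also have "\<dots> = 128 * (\<Sum>n<N. (x (Suc n) - x n)\<^sup>2) + 64 * (\<Sum>n<N. (1/2) ^ Suc n)"
        by (simp only: sum.distrib sum_distrib_left)
      also have "\<dots> \<le> 128 * 8 + 64 * 1"
        using step_energy[of N] unfolding x_def by (intro add_mono mult_left_mono sum_half_powers_le) auto
      finally show ?thesis by simp
    qed
  qed
  define p where "p q = lim (\<lambda>n. P n q)" for q
  have lim: "(\<lambda>n. P n q) \<longlonglongrightarrow> p q" if "q \<in> U" for q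
  proof -
    interpret hysteresis_game "\<lambda>n. P n q $ 1" "\<lambda>n. P n q $ 2" "\<lambda>k n. Y n k q" "\<lambda>n. (1/2) ^ Suc n" by (rule game[OF that])
    obtain a b where "(\<lambda>n. P n q $ 1) \<longlonglongrightarrow> a" "(\<lambda>n. P n q $ 2) \<longlonglongrightarrow> b"
      using convergent_x convergent_z by (auto simp: convergent_def)
    then have "\<forall>i. (\<lambda>n. P n q $ i) \<longlonglongrightarrow> vector [a, b] $ i"
      by (simp add: forall_2 vector_2)
    then have "(\<lambda>n. P n q) \<longlonglongrightarrow> vector [a, b]" by (intro vec_tendstoI) blast
    then show ?thesis unfolding p_def by (simp add: limI)
  qed
  define \<phi> where "\<phi> n q = S (Suc n) q - S n q" for n q
  have S_sum: "(\<Sum>j<n. \<phi> j q) = S n q" for n q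
    using sum_lessThan_telescope[of "\<lambda>j. S j q" n] by (simp add: \<phi>_def inv(6))
  have \<phi>_grad: "GDERIV (\<lambda>q. \<Sum>n. \<phi> n q) q :> p q - p\<^sub>0 q" if q: "q \<in> U" for q
  proof (rule GDERIV_separated_scales[where \<delta> = \<delta> and D = D and g = "\<lambda>n. 1 / sqrt (real (Suc n)) + (1/2) ^ n"])
    show "0 < \<delta> n" for n by (rule inv(3))
    show dec: "decseq \<delta>" using nxt(1) by (rule decseq_SucI)
    show "\<delta> \<longlonglongrightarrow> 0"
    proof (rule tendsto_sandwich[of "\<lambda>_. 0" \<delta> sequentially "\<lambda>n. (1/2) ^ n"])
      show "(\<lambda>n. (1/2::real) ^ n) \<longlonglongrightarrow> 0" by (simp add: LIMSEQ_power_zero)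
    qed (simp_all add: inv(4) less_imp_le[OF inv(3)])
    show "\<bar>(\<Sum>j<n. \<phi> j (q + h)) - (\<Sum>j<n. \<phi> j q) - h \<bullet> D n q\<bar> \<le> (1/2) ^ n * norm h" if "norm h \<le> \<delta> n" for n q h
      unfolding S_sum by (rule inv(5)[OF that])
    show "\<bar>\<phi> m q\<bar> \<le> (1/2) ^ m * \<delta> n" if "n < m" for n m q
    proof -
      have "\<bar>\<phi> m q\<bar> \<le> (1/2) ^ m * \<delta> m" unfolding \<phi>_def by (rule nxt(2))
      also have "\<dots> \<le> (1/2) ^ m * \<delta> n" using dec that by (intro mult_left_mono) (auto simp: decseq_def)
      finally show ?thesis .
    qed
    show "\<bar>\<phi> n (q + h) - \<phi> n q\<bar> \<le> (1 / sqrt (real (Suc n)) + (1/2) ^ n) * norm h" for n q h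
      using GDERIV_imp_lipschitz_bound[of UNIV "\<phi> n" "\<lambda>q. D (Suc n) q - D n q" _ "q + h" q] nxt(4,5)
      unfolding \<phi>_def by simp
    have "(\<lambda>n. 1 / sqrt (real (Suc n)) + (1/2) ^ n) \<longlonglongrightarrow> 0 + 0"
    proof (intro tendsto_add)
      have "(\<lambda>n. sqrt (inverse (real (Suc n)))) \<longlonglongrightarrow> sqrt 0"
        by (intro tendsto_real_sqrt LIMSEQ_inverse_real_of_nat)
      then show "(\<lambda>n. 1 / sqrt (real (Suc n))) \<longlonglongrightarrow> 0"
        by (simp add: real_sqrt_divide inverse_eq_divide del: of_nat_Suc)
      show "(\<lambda>n. (1/2::real) ^ n) \<longlonglongrightarrow> 0" by (simp add: LIMSEQ_power_zero)
    qed
    then show "(\<lambda>n. 1 / sqrt (real (Suc n)) + (1/2) ^ n) \<longlonglongrightarrow> 0" by simp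
    have "(\<lambda>n. P n q - p\<^sub>0 q) \<longlonglongrightarrow> p q - p\<^sub>0 q" by (intro tendsto_diff lim[OF q] tendsto_const)
    then show "(\<lambda>n. D n q) \<longlonglongrightarrow> p q - p\<^sub>0 q" by (simp add: P_def)
  qed
  define v where "v q = v\<^sub>0 q + (\<Sum>n. \<phi> n q)" for q
  have le1: "norm (P n q) \<le> 1" if "q \<in> U" for n q using inv(2)[OF that, of n] by simp
  have le1p: "norm (p q) \<le> 1" if "q \<in> U" for q
    using lim[OF that] le1[OF that] by (intro Lim_norm_ubound[of sequentially "\<lambda>n. P n q"]) auto
  have range: "0 \<le> deficit U (P n) q" "deficit U (P n) q \<le> 1" for n q by (rule deficit_range, rule le1, assumption)+
  have rangep: "0 \<le> deficit U p q" "deficit U p q \<le> 1" for q by (rule deficit_range, rule le1p, assumption)+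
  have meas: "deficit U (P n) \<in> borel_measurable borel" for n
  proof -
    have "continuous_on U (D n)" using inv(1)[of n] continuous_on_subset by (auto simp: C1_supported_def)
    then have "continuous_on U (P n)" unfolding P_def using v\<^sub>0(2) by (intro continuous_intros)
    then show ?thesis by (rule deficit_measurable[OF \<open>open U\<close>])
  qed
  have dlim: "(\<lambda>n. deficit U (P n) q) \<longlonglongrightarrow> deficit U p q" for q
  proof (cases "q \<in> U")
    case True
    then show ?thesis unfolding deficit_def by (intro tendsto_intros lim)
  qed (simp add: deficit_def)
  have measp: "deficit U p \<in> borel_measurable borel"
    using borel_measurable_LIMSEQ_real[of borel "\<lambda>n. deficit U (P n)" "deficit U p"] dlim meas by blast
  note meas_cong = measurable_cong_sets[OF \<mu>(2) refl]
  define a where "a n = (\<integral>q. deficit U (P n) q \<partial>\<mu>)" for n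
  have alim: "a \<longlonglongrightarrow> (\<integral>q. deficit U p q \<partial>\<mu>)"
    unfolding a_def
  proof (rule integral_dominated_convergence[where w = "\<lambda>_. 1"])
    show "deficit U p \<in> borel_measurable \<mu>" "deficit U (P n) \<in> borel_measurable \<mu>" for n
      using meas measp by (simp_all only: meas_cong)
    show "AE q in \<mu>. (\<lambda>n. deficit U (P n) q) \<longlonglongrightarrow> deficit U p q" using dlim by (intro AE_I2)
    show "AE q in \<mu>. norm (deficit U (P n) q) \<le> 1" for n using range by (intro AE_I2) simp
  qed simp
  \<comment> \<open>The pointwise energy bound is integrated, and \<open>t\<^sup>2\<close> is replaced by its lower bound in the mean.\<close>
  have weighted: "(\<Sum>n<N. a n / real (Suc n)) \<le> 2 * (1088 * measure \<mu> (space \<mu>) + 2)" for N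
  proof -
    let ?f = "\<lambda>n q. deficit U (P n) q * (t n q)\<^sup>2"
    have int: "integrable \<mu> (?f n)" for n
    proof (rule integrable_const_bound[of _ 1])
      show "AE q in \<mu>. norm (?f n q) \<le> 1"
      proof (rule AE_I2)
        fix q
        have "?f n q \<le> 1 * 1" using range t(2) by (intro mult_mono) (auto simp: abs_square_le_1)
        then show "norm (?f n q) \<le> 1" using range(1) by simp
      qed
      have "?f n \<in> borel_measurable borel" by (intro borel_measurable_times borel_measurable_power meas t(1))
      then show "?f n \<in> borel_measurable \<mu>" by (simp only: meas_cong)
    qed
    have "(\<Sum>n<N. (a n / 2 - (1/2) ^ n) / real (Suc n)) \<le> (\<Sum>n<N. (\<integral>q. ?f n q \<partial>\<mu>) / real (Suc n))"
      using t(4) unfolding a_def by (intro sum_mono divide_right_mono) auto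
    also have "\<dots> = (\<integral>q. (\<Sum>n<N. ?f n q / real (Suc n)) \<partial>\<mu>)"
      using int by (subst Bochner_Integration.integral_sum) auto
    also have "\<dots> \<le> (\<integral>q. 1088 \<partial>\<mu>)"
    proof (rule integral_mono)
      show "integrable \<mu> (\<lambda>q. \<Sum>n<N. ?f n q / real (Suc n))" using int by (intro Bochner_Integration.integrable_sum integrable_divide)
      show "(\<Sum>n<N. ?f n q / real (Suc n)) \<le> 1088" for q
      proof (cases "q \<in> U")
        case False
        then show ?thesis by (simp add: deficit_def)
      qed (rule energy)
    qed simp
    also have "\<dots> = 1088 * measure \<mu> (space \<mu>)" by simp
    finally have 1: "(\<Sum>n<N. (a n / 2 - (1/2) ^ n) / real (Suc n)) \<le> 1088 * measure \<mu> (space \<mu>)" .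
    have "(\<Sum>n<N. (1/2) ^ n / real (Suc n)) \<le> (\<Sum>n<N. 2 * (1/2) ^ Suc n)"
    proof (rule sum_mono)
      fix n
      have "(1/2::real) ^ n / real (Suc n) \<le> (1/2) ^ n / 1" by (intro divide_left_mono) auto
      then show "(1/2::real) ^ n / real (Suc n) \<le> 2 * (1/2) ^ Suc n" by simp
    qed
    also have "\<dots> \<le> 2 * 1" unfolding sum_distrib_left[symmetric] by (intro mult_left_mono sum_half_powers_le) auto
    finally have 2: "(\<Sum>n<N. (1/2) ^ n / real (Suc n)) \<le> 2" by simp
    have "(\<Sum>n<N. a n / real (Suc n)) = (\<Sum>n<N. 2 * ((a n / 2 - (1/2) ^ n) / real (Suc n)) + 2 * ((1/2) ^ n / real (Suc n)))"
      by (intro sum.cong) (simp_all add: diff_divide_distrib del: of_nat_Suc)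
    also have "\<dots> = 2 * (\<Sum>n<N. (a n / 2 - (1/2) ^ n) / real (Suc n)) + 2 * (\<Sum>n<N. (1/2) ^ n / real (Suc n))"
      by (simp only: sum.distrib sum_distrib_left)
    finally have 3: "(\<Sum>n<N. a n / real (Suc n)) = \<dots>" .
    have "x = 2 * y + 2 * z \<Longrightarrow> y \<le> c \<Longrightarrow> z \<le> 2 \<Longrightarrow> x \<le> 2 * (c + 2)" for x y z c :: real by simp
    from this[OF 3 1 2] show ?thesis .
  qed
  have a0: "0 \<le> a n" for n unfolding a_def using range by (intro integral_nonneg_AE AE_I2)
  have "(\<integral>q. deficit U p q \<partial>\<mu>) = 0"
  proof (rule not_summable_harmonic_weight[OF _ alim])
    show "summable (\<lambda>n. a n / real (Suc n))"
    proof (rule bounded_imp_summable)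
      show "(\<Sum>k\<le>n. a k / real (Suc k)) \<le> 2 * (1088 * measure \<mu> (space \<mu>) + 2)" for n
        using weighted[of "Suc n"] by (simp only: lessThan_Suc_atMost)
    qed (use a0 in simp)
    show "0 \<le> (\<integral>q. deficit U p q \<partial>\<mu>)" using rangep by (intro integral_nonneg_AE AE_I2)
  qed
  moreover have "integrable \<mu> (deficit U p)"
    using rangep measp by (intro integrable_const_bound[of _ 1] AE_I2) (simp_all only: meas_cong, simp)
  ultimately have "AE q in \<mu>. deficit U p q = 0"
    using rangep by (subst (asm) integral_nonneg_eq_0_iff_AE) auto
  then have ae: "AE q in lborel. q \<in> U \<longrightarrow> norm (p q) = 1"
    unfolding ae_\<mu> by eventually_elim (auto simp: deficit_def)
  show thesis
  proof (rule result[OF _ _ _ le1p ae])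
    show "v q = v\<^sub>0 q" if "q \<notin> U" for q
    proof -
      have "S n q = 0" for n using inv(1)[of n] that unfolding C1_supported_def by blast
      then show ?thesis by (simp add: v_def \<phi>_def)
    qed
    show "\<bar>v q - v\<^sub>0 q\<bar> \<le> m q" if q: "q \<in> U" for q
    proof -
      have geo: "(\<lambda>n. (1/2) ^ Suc n * m q) sums (1 * m q)" by (intro sums_mult2 power_half_series)
      have "norm (\<Sum>n. \<phi> n q) \<le> (\<Sum>n. (1/2) ^ Suc n * m q)"
        using nxt(3)[OF q] geo by (intro norm_suminf_le) (auto simp: \<phi>_def sums_iff)
      then show ?thesis using geo by (simp add: v_def sums_iff)
    qed
    show "GDERIV v q :> p q" if q: "q \<in> U" for q
      using GDERIV_add[OF v\<^sub>0(1)[OF q] \<phi>_grad[OF q]] by (simp add: v_def[abs_def])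
  qed
qed

section \<open>Smoothing strict subsolutions\<close>

lemma GDERIV_suminf:
  fixes f :: "nat \<Rightarrow> 'a::euclidean_space \<Rightarrow> real"
  assumes f: "\<And>i q. GDERIV (f i) q :> G i q" "\<And>i. continuous_on UNIV (G i)"
    and M: "\<And>i q. \<bar>f i q\<bar> \<le> M i" "\<And>i q. norm (G i q) \<le> M i" "summable M"
  shows "GDERIV (\<lambda>q. \<Sum>i. f i q) q :> (\<Sum>i. G i q)" "continuous_on UNIV (\<lambda>q. \<Sum>i. G i q)"
proof -
  have ul: "uniform_limit UNIV (\<lambda>n q. \<Sum>i<n. G i q) (\<lambda>q. \<Sum>i. G i q) sequentially"
    using M by (intro Weierstrass_m_test) auto
  show "continuous_on UNIV (\<lambda>q. \<Sum>i. G i q)"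
  proof (rule uniform_limit_theorem[OF _ ul])
    show "\<forall>\<^sub>F n in sequentially. continuous_on UNIV (\<lambda>q. \<Sum>i<n. G i q)"
      using f(2) by (intro always_eventually allI continuous_on_sum)
  qed simp
  have sums: "(\<lambda>i. f i q) sums (\<Sum>i. f i q)" for q
    using M by (intro summable_sums summable_comparison_test'[OF M(3), of 0]) auto
  have "\<exists>g. \<forall>q\<in>UNIV. (\<lambda>n. f n q) sums g q \<and> (g has_derivative (\<lambda>h. h \<bullet> (\<Sum>i. G i q))) (at q within UNIV)"
  proof (rule has_derivative_series[where f' = "\<lambda>i q h. h \<bullet> G i q" and x = 0])
    show "(\<lambda>i. f i 0) sums (\<Sum>i. f i 0)" by (rule sums)
    show "(f n has_derivative (\<lambda>h. h \<bullet> G n q)) (at q within UNIV)" for n q using f(1) by (simp add: gderiv_def)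
    show "\<forall>\<^sub>F n in sequentially. \<forall>q\<in>UNIV. \<forall>h. norm ((\<Sum>i<n. h \<bullet> G i q) - h \<bullet> (\<Sum>i. G i q)) \<le> e * norm h" if "e > 0" for e
      using uniform_limitD[OF ul that]
    proof eventually_elim
      case (elim n)
      show ?case
      proof (intro ballI allI)
        fix q h
        have "norm ((\<Sum>i<n. G i q) - (\<Sum>i. G i q)) \<le> e" using elim by (simp add: dist_norm less_imp_le)
        then have "norm (h \<bullet> ((\<Sum>i<n. G i q) - (\<Sum>i. G i q))) \<le> norm h * e"
          unfolding real_norm_def by (intro order_trans[OF Cauchy_Schwarz_ineq2 mult_left_mono]) auto
        then show "norm ((\<Sum>i<n. h \<bullet> G i q) - h \<bullet> (\<Sum>i. G i q)) \<le> e * norm h"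
          by (simp add: inner_diff_right inner_sum_right mult.commute)
      qed
    qed
  qed simp_all
  then obtain g where g: "\<And>q. (\<lambda>n. f n q) sums g q" "\<And>q. GDERIV g q :> (\<Sum>i. G i q)"
    by (auto simp: gderiv_def)
  then have "g = (\<lambda>q. \<Sum>i. f i q)" by (auto simp: sums_iff)
  then show "GDERIV (\<lambda>q. \<Sum>i. f i q) q :> (\<Sum>i. G i q)" using g(2) by simp
qed

lemma bump_gradient_bound:
  assumes "0 < \<rho>"
  shows "norm (bump_gradient c \<rho> q) \<le> 4 / \<rho>"
proof (cases "q \<in> ball c \<rho>")
  case True
  have "(q - c) \<bullet> (q - c) / \<rho>\<^sup>2 \<ge> 0" by simp
  then have "\<bar>2 * max 0 (1 - (q - c) \<bullet> (q - c) / \<rho>\<^sup>2)\<bar> \<le> 2" by simp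
  moreover have "norm ((- 2 / \<rho>\<^sup>2) *\<^sub>R (q - c)) \<le> 2 / \<rho>\<^sup>2 * \<rho>"
    using True assms by (auto simp: dist_norm norm_minus_commute intro!: divide_right_mono)
  ultimately have "norm (bump_gradient c \<rho> q) \<le> 2 * (2 / \<rho>\<^sup>2 * \<rho>)"
    unfolding bump_gradient_def norm_scaleR[of "2 * _"] by (intro mult_mono) auto
  also have "\<dots> = 4 / \<rho>" using assms by (simp add: power2_eq_square)
  finally show ?thesis .
next
  case False
  then show ?thesis using bump_support(3)[OF assms False] assms by simp
qed

text \<open>A series of bumps on countably many balls covering \<open>U\<close>, with coefficients so small that each bump and
its gradient stay below a fraction \<open>(1/2)^(i+1)\<close> of \<open>m\<close>. It provides the radius of the mollification.\<close>

lemma smooth_minorant: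
  fixes U :: "'a::euclidean_space set"
  assumes "open U" "continuous_on U m" "\<And>q. q \<in> U \<Longrightarrow> 0 < m q"
  obtains r r' where "\<And>q. GDERIV r q :> r' q" "continuous_on UNIV r'"
    "\<And>q. q \<in> U \<Longrightarrow> 0 < r q" "\<And>q. q \<in> U \<Longrightarrow> r q \<le> m q" "\<And>q. q \<in> U \<Longrightarrow> norm (r' q) \<le> m q"
proof (cases "U = {}")
  case True
  show thesis by (rule that[of "\<lambda>_. 0" "\<lambda>_. 0"]) (use True in \<open>simp_all only: GDERIV_const continuous_on_const empty_iff\<close>)
next
  case False
  note result = that
  define \<F> where "\<F> = {ball c \<rho> |c \<rho>. c \<in> U \<and> 0 < \<rho> \<and> cball c \<rho> \<subseteq> U}"
  obtain \<F>' where \<F>': "\<F>' \<subseteq> \<F>" "countable \<F>'" "\<Union>\<F>' = \<Union>\<F>"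
    using Lindelof[of \<F>] by (auto simp: \<F>_def)
  have cover: "U \<subseteq> \<Union>\<F>"
  proof
    fix q assume "q \<in> U"
    then obtain \<rho> where "\<rho> > 0" "cball q \<rho> \<subseteq> U" using \<open>open U\<close> open_contains_cball by blast
    then have "ball q \<rho> \<in> \<F>" "q \<in> ball q \<rho>" using \<open>q \<in> U\<close> by (auto simp: \<F>_def)
    then show "q \<in> \<Union>\<F>" by blast
  qed
  then have "\<F>' \<noteq> {}" using False \<F>'(3) by auto
  define B where "B = from_nat_into \<F>'"
  have B: "B i \<in> \<F>" for i using from_nat_into[OF \<open>\<F>' \<noteq> {}\<close>] \<F>'(1) by (auto simp: B_def)
  then have "\<forall>i. \<exists>c \<rho>. B i = ball c \<rho> \<and> c \<in> U \<and> 0 < \<rho> \<and> cball c \<rho> \<subseteq> U" by (auto simp: \<F>_def)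
  then have "\<exists>c. \<forall>i. \<exists>\<rho>. B i = ball (c i) \<rho> \<and> c i \<in> U \<and> 0 < \<rho> \<and> cball (c i) \<rho> \<subseteq> U" by (rule choice)
  then obtain c where "\<forall>i. \<exists>\<rho>. B i = ball (c i) \<rho> \<and> c i \<in> U \<and> 0 < \<rho> \<and> cball (c i) \<rho> \<subseteq> U" by blast
  then have "\<exists>\<rho>. \<forall>i. B i = ball (c i) (\<rho> i) \<and> c i \<in> U \<and> 0 < \<rho> i \<and> cball (c i) (\<rho> i) \<subseteq> U" by (rule choice)
  then obtain \<rho> where c: "\<And>i. B i = ball (c i) (\<rho> i)" "\<And>i. 0 < \<rho> i" "\<And>i. cball (c i) (\<rho> i) \<subseteq> U" by blast
  have B_cover: "\<exists>i. q \<in> ball (c i) (\<rho> i)" if q: "q \<in> U" for q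
  proof -
    obtain X where "X \<in> \<F>'" "q \<in> X" using q cover \<F>'(3) by blast
    moreover obtain i where "B i = X" using from_nat_into_surj[OF \<F>'(2) \<open>X \<in> \<F>'\<close>] by (auto simp: B_def)
    ultimately show ?thesis using c(1)[of i] by (intro exI[of _ i]) simp
  qed
  have "\<exists>\<beta>>0. \<beta> \<le> 1 \<and> (\<forall>q\<in>cball (c i) (\<rho> i). \<beta> \<le> m q)" for i
  proof -
    have "continuous_on (cball (c i) (\<rho> i)) m" using assms(2) c(3) continuous_on_subset by blast
    moreover have "cball (c i) (\<rho> i) \<noteq> {}" using c(2)[of i] by simp
    ultimately obtain p where p: "p \<in> cball (c i) (\<rho> i)" "\<And>q. q \<in> cball (c i) (\<rho> i) \<Longrightarrow> m p \<le> m q"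
      using continuous_attains_inf[OF compact_cball] by blast
    have "0 < m p" using p(1) c(3) assms(3) by blast
    then show ?thesis using p(2) by (intro exI[of _ "min 1 (m p)"]) (auto simp: min.coboundedI2)
  qed
  then obtain \<beta> where \<beta>: "\<And>i. 0 < \<beta> i" "\<And>i. \<beta> i \<le> 1" "\<And>i q. q \<in> cball (c i) (\<rho> i) \<Longrightarrow> \<beta> i \<le> m q" by metis
  define \<kappa> where "\<kappa> i = (1/2) ^ Suc i * \<beta> i / (1 + 4 / \<rho> i)" for i
  have \<kappa>: "0 < \<kappa> i" "\<kappa> i \<le> (1/2) ^ Suc i * \<beta> i" "\<kappa> i * (4 / \<rho> i) \<le> (1/2) ^ Suc i * \<beta> i" for i
  proof -
    have "0 < 4 / \<rho> i" using c(2) by simp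
    moreover have "0 < (1/2) ^ Suc i * \<beta> i" using \<beta>(1) by simp
    moreover have "0 < a / (1 + b) \<and> a / (1 + b) \<le> a \<and> a / (1 + b) * b \<le> a" if "0 < b" "0 < a" for a b :: real
      using that by (simp add: field_simps)
    ultimately show "0 < \<kappa> i" "\<kappa> i \<le> (1/2) ^ Suc i * \<beta> i" "\<kappa> i * (4 / \<rho> i) \<le> (1/2) ^ Suc i * \<beta> i"
      unfolding \<kappa>_def by blast+
  qed
  define f where "f i q = \<kappa> i * bump (c i) (\<rho> i) q" for i q
  define G where "G i q = \<kappa> i *\<^sub>R bump_gradient (c i) (\<rho> i) q" for i q
  have fG: "\<bar>f i q\<bar> \<le> (1/2) ^ Suc i * \<beta> i" "norm (G i q) \<le> (1/2) ^ Suc i * \<beta> i" for i q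
  proof -
    have "\<bar>f i q\<bar> \<le> \<kappa> i * 1" unfolding f_def abs_mult using \<kappa>(1)[of i] bump_range[of "c i" "\<rho> i" q] by (intro mult_mono) auto
    then show "\<bar>f i q\<bar> \<le> (1/2) ^ Suc i * \<beta> i" using \<kappa>(2)[of i] by linarith
    have "norm (G i q) \<le> \<kappa> i * (4 / \<rho> i)"
      unfolding G_def norm_scaleR using \<kappa>(1)[of i] bump_gradient_bound[OF c(2)] by (intro mult_mono) auto
    then show "norm (G i q) \<le> (1/2) ^ Suc i * \<beta> i" using \<kappa>(3)[of i] by linarith
  qed
  have geo: "(\<lambda>i. (1/2) ^ Suc i * a) sums a" for a :: real
    using sums_mult2[OF power_half_series, of a] by simp
  have \<beta>_le: "(1/2) ^ Suc i * \<beta> i \<le> (1/2) ^ Suc i" for i using \<beta>(2) by (intro mult_left_le) auto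
  have fG1: "\<bar>f i q\<bar> \<le> (1/2) ^ Suc i" "norm (G i q) \<le> (1/2) ^ Suc i" for i q
    using fG[of i q] \<beta>_le[of i] by linarith+
  have grad: "GDERIV (f i) q :> G i q" for i q
  proof -
    have "GDERIV (\<lambda>q. \<kappa> i * bump (c i) (\<rho> i) q) q :> \<kappa> i *\<^sub>R bump_gradient (c i) (\<rho> i) q + bump (c i) (\<rho> i) q *\<^sub>R 0"
      by (rule GDERIV_mult[OF GDERIV_const GDERIV_bump])
    then show ?thesis by (simp add: f_def[abs_def] G_def)
  qed
  have cG: "continuous_on UNIV (G i)" for i unfolding G_def by (intro continuous_intros continuous_bump)
  have sm: "summable (\<lambda>i. (1/2::real) ^ Suc i)" using power_half_series sums_summable by blast
  have le_m: "\<bar>f i q\<bar> \<le> (1/2) ^ Suc i * m q" "norm (G i q) \<le> (1/2) ^ Suc i * m q" if "q \<in> U" for i q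
  proof -
    have "\<bar>f i q\<bar> \<le> (1/2) ^ Suc i * m q \<and> norm (G i q) \<le> (1/2) ^ Suc i * m q"
    proof (cases "q \<in> ball (c i) (\<rho> i)")
      case True
      then have "\<beta> i \<le> m q" using ball_subset_cball by (intro \<beta>(3)) blast
      then have "(1/2) ^ Suc i * \<beta> i \<le> (1/2) ^ Suc i * m q" by (intro mult_left_mono) auto
      then show ?thesis using fG[of i q] by linarith
    next
      case False
      then have "f i q = 0" "G i q = 0" using bump_support(2,3)[OF c(2) False] by (simp_all add: f_def G_def)
      then show ?thesis using assms(3)[OF that] by simp
    qed
    then show "\<bar>f i q\<bar> \<le> (1/2) ^ Suc i * m q" "norm (G i q) \<le> (1/2) ^ Suc i * m q" by blast+
  qed
  show thesis
  proof (rule result[of "\<lambda>q. \<Sum>i. f i q" "\<lambda>q. \<Sum>i. G i q"])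
    show "GDERIV (\<lambda>q. \<Sum>i. f i q) q :> (\<Sum>i. G i q)" for q by (rule GDERIV_suminf[OF grad cG fG1 sm])
    show "continuous_on UNIV (\<lambda>q. \<Sum>i. G i q)" by (rule GDERIV_suminf[OF grad cG fG1 sm])
    fix q assume q: "q \<in> U"
    have sf: "summable (\<lambda>i. f i q)" using fG1(1) by (intro summable_comparison_test'[OF sm, of 0]) auto
    obtain i where i: "q \<in> ball (c i) (\<rho> i)" using B_cover[OF q] by blast
    show "0 < (\<Sum>i. f i q)"
    proof (rule suminf_pos2[OF sf, of i])
      show "0 \<le> f i q" for i
        unfolding f_def using \<kappa>(1)[of i] by (intro mult_nonneg_nonneg bump_range(1)) simp
      show "0 < f i q" 
        unfolding f_def using i by (intro mult_pos_pos \<kappa>(1) bump_support(1)[OF c(2), THEN iffD2])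
    qed
    have "norm (\<Sum>i. f i q) \<le> (\<Sum>i. (1/2) ^ Suc i * m q)"
      using le_m(1)[OF q] geo by (intro norm_suminf_le) (auto simp: sums_iff)
    then show "(\<Sum>i. f i q) \<le> m q" using geo[of "m q"] by (simp add: sums_iff)
    have "norm (\<Sum>i. G i q) \<le> (\<Sum>i. (1/2) ^ Suc i * m q)"
      using le_m(2)[OF q] geo by (intro norm_suminf_le) (auto simp: sums_iff)
    then show "norm (\<Sum>i. G i q) \<le> m q" using geo[of "m q"] by (simp add: sums_iff)
  qed
qed

lemma GDERIV_integral:
  fixes f :: "'a::euclidean_space \<Rightarrow> 'b::euclidean_space \<Rightarrow> real"
  assumes "open V" "convex V"
    and f: "\<And>q y. q \<in> V \<Longrightarrow> y \<in> cbox a b \<Longrightarrow> GDERIV (\<lambda>q. f q y) q :> H q y"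
      "\<And>q. q \<in> V \<Longrightarrow> continuous_on (cbox a b) (f q)"
    and H: "continuous_on (V \<times> cbox a b) (\<lambda>(q, y). H q y)"
  shows "q \<in> V \<Longrightarrow> GDERIV (\<lambda>q. integral (cbox a b) (f q)) q :> integral (cbox a b) (H q)"
    and "continuous_on V (\<lambda>q. integral (cbox a b) (H q))"
proof -
  show "continuous_on V (\<lambda>q. integral (cbox a b) (H q))" by (rule integral_continuous_on_param[OF H])
  assume q: "q \<in> V"
  have "continuous_on (cbox a b) (\<lambda>y. case (q, y) of (q, y) \<Rightarrow> H q y)"
    by (rule continuous_on_compose2[OF H]) (use q in \<open>auto intro!: continuous_on_Pair continuous_on_const continuous_on_id\<close>)
  then have cH: "continuous_on (cbox a b) (H q)" by simp
  have "((\<lambda>q. integral (cbox a b) (f q)) has_derivative integral (cbox a b) (\<lambda>y. blinfun_inner_left (H q y))) (at q within V)"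
  proof (rule leibniz_rule)
    show "((\<lambda>q. f q y) has_derivative blinfun_apply (blinfun_inner_left (H p y))) (at p within V)" if "p \<in> V" "y \<in> cbox a b" for p y
      using f(1)[OF that] by (simp add: gderiv_def has_derivative_at_withinI)
    show "f p integrable_on cbox a b" if "p \<in> V" for p using f(2)[OF that] by (rule integrable_continuous)
    have "continuous_on (V \<times> cbox a b) (\<lambda>z. blinfun_inner_left (case z of (q, y) \<Rightarrow> H q y))"
      by (rule bounded_linear.continuous_on[OF bounded_linear_blinfun_inner_left H])
    then show "continuous_on (V \<times> cbox a b) (\<lambda>(q, y). blinfun_inner_left (H q y))" by (simp add: case_prod_unfold)
  qed (use q assms(2) in auto)
  moreover have "blinfun_apply (integral (cbox a b) (\<lambda>y. blinfun_inner_left (H q y))) h = h \<bullet> integral (cbox a b) (H q)" for h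
  proof -
    have "integral (cbox a b) (\<lambda>y. blinfun_inner_left (H q y)) = blinfun_inner_left (integral (cbox a b) (H q))"
      using integral_linear[OF integrable_continuous[OF cH] bounded_linear_blinfun_inner_left] by (simp add: o_def)
    then show ?thesis by simp
  qed
  then have "blinfun_apply (integral (cbox a b) (\<lambda>y. blinfun_inner_left (H q y))) = (\<lambda>h. h \<bullet> integral (cbox a b) (H q))"
    by (rule ext)
  ultimately have "((\<lambda>q. integral (cbox a b) (f q)) has_derivative (\<lambda>h. h \<bullet> integral (cbox a b) (H q))) (at q within V)"
    by (simp only:)
  then show "GDERIV (\<lambda>q. integral (cbox a b) (f q)) q :> integral (cbox a b) (H q)"
    using at_within_open[OF q \<open>open V\<close>] by (simp add: gderiv_def)
qed

text \<open>Up to normalization, \<open>s\<close> is the reciprocal of the radius. With \<open>s\<close> instead of the radius the kernel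
is a polynomial expression in \<open>s\<close>, \<open>q\<close> and \<open>y\<close>, apart from the positive part.\<close>

definition mollifier :: "real \<Rightarrow> 'a::real_inner \<Rightarrow> 'a \<Rightarrow> real" where
  "mollifier s q y = (max 0 (1 - s\<^sup>2 * ((y - q) \<bullet> (y - q))))\<^sup>2"

lemma mollifier_range: "0 \<le> mollifier s q y"
  by (simp add: mollifier_def)

lemma mollifier_support:
  assumes "0 < r" "r \<le> norm (y - q)"
  shows "mollifier (1 / r) q y = 0"
proof -
  have "r\<^sup>2 \<le> (norm (y - q))\<^sup>2" using assms by (intro power_mono) auto
  then have "1 \<le> (1 / r)\<^sup>2 * ((y - q) \<bullet> (y - q))"
    using assms(1) by (simp add: power2_norm_eq_inner power_divide field_simps)
  then show ?thesis by (simp add: mollifier_def)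
qed

lemma mollifier_rescale: "r \<noteq> 0 \<Longrightarrow> mollifier (1 / r) q (r *\<^sub>R z + q) = mollifier 1 0 z"
  by (simp add: mollifier_def power2_eq_square)

lemma continuous_mollifier: "continuous_on X (mollifier s q)"
  unfolding mollifier_def by (intro continuous_intros)

text \<open>The average of \<open>w\<close> over the ball with centre \<open>q\<close> and radius \<open>r q\<close>. In this form the Lipschitz
constants of \<open>w\<close> are inherited; \<open>mollify_eq_convolution\<close> gives the form that shows smoothness.\<close>

definition mollify :: "('a::euclidean_space \<Rightarrow> real) \<Rightarrow> ('a \<Rightarrow> real) \<Rightarrow> 'a \<Rightarrow> real" where
  "mollify r w q = integral (cbox (- One) One) (\<lambda>z. w (q + r q *\<^sub>R z) * mollifier 1 0 z) /
     integral (cbox (- One) One) (mollifier 1 (0::'a))"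

lemma mollifier_mass_pos: "0 < integral (cbox (- One) One) (mollifier 1 (0::'a::euclidean_space))"
proof -
  let ?k = "mollifier 1 (0::'a)"
  have int: "?k integrable_on cbox (- One) One" by (intro integrable_continuous continuous_mollifier)
  have "integral (cbox (- One) One) ?k \<noteq> 0"
  proof
    assume "integral (cbox (- One) One) ?k = 0"
    then have "(?k has_integral 0) (cbox (- One) One)" using int by (metis integrable_integral)
    moreover have "box (- One) (One::'a) \<noteq> {}" by (simp add: box_ne_empty)
    ultimately have "?k 0 = 0"
      by (intro has_integral_0_cbox_imp_0[of "- One" One ?k] continuous_mollifier mollifier_range) (auto simp: mem_box)
    then show False by (simp add: mollifier_def)
  qed
  moreover have "0 \<le> integral (cbox (- One) One) ?k" using int mollifier_range by (intro integral_nonneg) auto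
  ultimately show ?thesis by simp
qed

text \<open>A constant radius \<open>s\<close> on one side allows to compare two points as well as, with \<open>s = 0\<close>, the average with
\<open>w\<close> itself.\<close>

lemma mollify_diff_bound:
  fixes w :: "'a::euclidean_space \<Rightarrow> real"
  assumes w: "continuous_on UNIV w"
    and le: "\<And>z. norm z < 1 \<Longrightarrow> \<bar>w (q + r q *\<^sub>R z) - w (p + s *\<^sub>R z)\<bar> \<le> c"
  shows "\<bar>mollify r w q - mollify (\<lambda>_. s) w p\<bar> \<le> c"
proof -
  let ?Q = "cbox (- One) (One::'a)" and ?k = "mollifier 1 (0::'a)"
  have int: "(\<lambda>z. w (q + t *\<^sub>R z) * ?k z) integrable_on ?Q" for q t
    by (intro integrable_continuous continuous_intros continuous_mollifier continuous_on_compose2[OF w]) auto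
  have "integral ?Q (\<lambda>z. w (q + r q *\<^sub>R z) * ?k z) - integral ?Q (\<lambda>z. w (p + s *\<^sub>R z) * ?k z)
      = integral ?Q (\<lambda>z. w (q + r q *\<^sub>R z) * ?k z - w (p + s *\<^sub>R z) * ?k z)"
    by (intro integral_diff[symmetric] int)
  also have "norm \<dots> \<le> integral ?Q (\<lambda>z. c * ?k z)"
  proof (rule integral_norm_bound_integral)
    show "(\<lambda>z. w (q + r q *\<^sub>R z) * ?k z - w (p + s *\<^sub>R z) * ?k z) integrable_on ?Q" by (intro integrable_diff int)
    show "(\<lambda>z. c * ?k z) integrable_on ?Q" by (intro integrable_continuous continuous_intros continuous_mollifier)
    show "norm (w (q + r q *\<^sub>R z) * ?k z - w (p + s *\<^sub>R z) * ?k z) \<le> c * ?k z" for z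
    proof (cases "norm z < 1")
      case True
      have "norm ((w (q + r q *\<^sub>R z) - w (p + s *\<^sub>R z)) * ?k z) \<le> c * ?k z"
        using le[OF True] mollifier_range[of 1 0 z] by (simp add: abs_mult mult_right_mono)
      then show ?thesis by (simp add: left_diff_distrib)
    next
      case False
      then have "?k z = 0" using mollifier_support[of 1 z 0] by simp
      then show ?thesis by simp
    qed
  qed
  also have "\<dots> = c * integral ?Q ?k" by simp
  finally have "\<bar>integral ?Q (\<lambda>z. w (q + r q *\<^sub>R z) * ?k z) - integral ?Q (\<lambda>z. w (p + s *\<^sub>R z) * ?k z)\<bar> / integral ?Q ?k \<le> c"
    using mollifier_mass_pos[where 'a='a] by (simp add: pos_divide_le_eq)
  then show ?thesis
    using mollifier_mass_pos[where 'a='a] by (simp add: mollify_def diff_divide_distrib[symmetric] abs_divide)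
qed

lemma mollify_0: "mollify (\<lambda>_. 0) w p = w (p::'a::euclidean_space)"
  using mollifier_mass_pos[where 'a='a] by (simp add: mollify_def)

lemma mollify_eq_convolution:
  fixes w :: "'a::euclidean_space \<Rightarrow> real"
  assumes w: "continuous_on UNIV w" and "0 < r q" and sub: "cbox (q - r q *\<^sub>R One) (q + r q *\<^sub>R One) \<subseteq> cbox a b"
  shows "mollify r w q = (1 / r q) ^ DIM('a) * integral (cbox a b) (\<lambda>y. w y * mollifier (1 / r q) q y) /
     integral (cbox (- One) One) (mollifier 1 (0::'a))"
proof -
  let ?f = "\<lambda>y. w y * mollifier (1 / r q) q y" and ?B = "cbox (q - r q *\<^sub>R One) (q + r q *\<^sub>R One)"
  have int: "(?f has_integral integral ?B ?f) ?B"
    by (intro integrable_integral integrable_continuous continuous_intros continuous_mollifier continuous_on_subset[OF w]) auto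
  have "((\<lambda>z. ?f (r q *\<^sub>R z + q)) has_integral integral ?B ?f /\<^sub>R r q ^ DIM('a))
      (cbox ((q - r q *\<^sub>R One - q) /\<^sub>R r q) ((q + r q *\<^sub>R One - q) /\<^sub>R r q))"
    by (rule has_integral_affinity'[OF int \<open>0 < r q\<close>])
  moreover have "(q - r q *\<^sub>R One - q) /\<^sub>R r q = - One" "(q + r q *\<^sub>R One - q) /\<^sub>R r q = One"
    using \<open>0 < r q\<close> by simp_all
  ultimately have "((\<lambda>z. w (q + r q *\<^sub>R z) * mollifier 1 0 z) has_integral integral ?B ?f /\<^sub>R r q ^ DIM('a)) (cbox (- One) One)"
    using \<open>0 < r q\<close> mollifier_rescale[of "r q" q] by (simp add: add.commute)
  then have 1: "integral (cbox (- One) One) (\<lambda>z. w (q + r q *\<^sub>R z) * mollifier 1 0 z) = integral ?B ?f /\<^sub>R r q ^ DIM('a)"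
    by (rule integral_unique)
  have "(?f has_integral integral ?B ?f) (cbox a b)"
  proof (rule has_integral_on_superset[OF int _ sub])
    fix y assume "y \<notin> ?B"
    then obtain i where i: "i \<in> Basis" "\<not> ((q - r q *\<^sub>R One) \<bullet> i \<le> y \<bullet> i \<and> y \<bullet> i \<le> (q + r q *\<^sub>R One) \<bullet> i)"
      by (auto simp: mem_box)
    then have "r q < \<bar>(y - q) \<bullet> i\<bar>" by (auto simp: inner_diff_left inner_add_left)
    then have "r q \<le> norm (y - q)" using Basis_le_norm[OF i(1), of "y - q"] by linarith
    then show "?f y = 0" using mollifier_support[OF \<open>0 < r q\<close>, of y q] by simp
  qed
  then have "integral (cbox a b) ?f = integral ?B ?f" by (rule integral_unique)
  then show ?thesis unfolding mollify_def 1 by (simp add: power_divide divide_inverse power_inverse)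
qed

lemma GDERIV_mollifier:
  assumes "GDERIV s q :> s'"
  shows "GDERIV (\<lambda>q. mollifier (s q) q y) q :>
    (2 * max 0 (1 - (s q)\<^sup>2 * ((y - q) \<bullet> (y - q)))) *\<^sub>R ((- 2 * s q * ((y - q) \<bullet> (y - q))) *\<^sub>R s' + (2 * (s q)\<^sup>2) *\<^sub>R (y - q))"
proof -
  have "((\<lambda>q. 1 - (s q)\<^sup>2 * ((y - q) \<bullet> (y - q))) has_derivative
     (\<lambda>h. h \<bullet> ((- 2 * s q * ((y - q) \<bullet> (y - q))) *\<^sub>R s' + (2 * (s q)\<^sup>2) *\<^sub>R (y - q)))) (at q)"
    using assms[unfolded gderiv_def]
    by (auto intro!: derivative_eq_intros simp: fun_eq_iff inner_commute algebra_simps power2_eq_square)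
  then show ?thesis
    unfolding mollifier_def by (intro GDERIV_DERIV_compose[OF _ DERIV_max_0_squared]) (simp add: gderiv_def)
qed

text \<open>Locally the average is an integral over a fixed box in which \<open>q\<close> occurs only in the kernel, so it can
be differentiated under the integral sign. The local gradients agree by uniqueness.\<close>

lemma mollify_C1:
  fixes w :: "'a::euclidean_space \<Rightarrow> real"
  assumes w: "continuous_on UNIV w" and "open U"
    and r: "\<And>q. q \<in> U \<Longrightarrow> GDERIV r q :> r' q" "continuous_on U r'" "\<And>q. q \<in> U \<Longrightarrow> 0 < r q"
  obtains p where "\<And>q. q \<in> U \<Longrightarrow> GDERIV (mollify r w) q :> p q" "continuous_on U p"
proof -
  note result = that
  have loc: "\<exists>d>0. \<exists>p. ball c d \<subseteq> U \<and> (\<forall>q\<in>ball c d. GDERIV (mollify r w) q :> p q) \<and> continuous_on (ball c d) p"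
    if c: "c \<in> U" for c
  proof -
    have cr: "continuous_on U r"
      using r(1) by (intro continuous_at_imp_continuous_on ballI) (auto simp: gderiv_def intro: has_derivative_continuous)
    obtain d1 where d1: "d1 > 0" "ball c d1 \<subseteq> U" using \<open>open U\<close> c openE by blast
    obtain d2 where d2: "d2 > 0" "\<And>q. q \<in> U \<Longrightarrow> dist q c < d2 \<Longrightarrow> dist (r q) (r c) < 1"
      using cr c unfolding continuous_on_iff by (metis zero_less_one)
    define d where "d = min d1 d2"
    have d: "0 < d" "ball c d \<subseteq> U" "\<And>q. q \<in> ball c d \<Longrightarrow> r q \<le> r c + 1"
    proof -
      show "r q \<le> r c + 1" if "q \<in> ball c d" for q
        using d2(2)[of q] d1(2) that by (auto simp: d_def dist_real_def dist_commute subset_iff)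
    qed (use d1 d2 in \<open>auto simp: d_def\<close>)
    define a where "a = c - (d + r c + 1) *\<^sub>R (One::'a)"
    define b where "b = c + (d + r c + 1) *\<^sub>R (One::'a)"
    have sub: "cbox (q - r q *\<^sub>R One) (q + r q *\<^sub>R One) \<subseteq> cbox a b" if q: "q \<in> ball c d" for q
    proof
      fix y assume y: "y \<in> cbox (q - r q *\<^sub>R One) (q + r q *\<^sub>R One)"
      show "y \<in> cbox a b"
        unfolding mem_box
      proof
        fix i :: 'a assume i: "i \<in> Basis"
        have "\<bar>(q - c) \<bullet> i\<bar> < d" using Basis_le_norm[OF i, of "q - c"] q by (simp add: dist_norm norm_minus_commute)
        moreover have "(q - r q *\<^sub>R One) \<bullet> i \<le> y \<bullet> i \<and> y \<bullet> i \<le> (q + r q *\<^sub>R One) \<bullet> i" using y i by (simp add: mem_box)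
        ultimately show "a \<bullet> i \<le> y \<bullet> i \<and> y \<bullet> i \<le> b \<bullet> i"
          using d(3)[OF q] i by (simp add: a_def b_def inner_diff_left inner_add_left abs_less_iff)
      qed
    qed
    define s where "s q = 1 / r q" for q
    define s' where "s' q = - (inverse (r q))\<^sup>2 *\<^sub>R r' q" for q
    have s: "GDERIV s q :> s' q" if "q \<in> ball c d" for q
    proof -
      have "q \<in> U" using that d(2) by blast
      then have "GDERIV (\<lambda>q. inverse (r q)) q :> s' q"
        unfolding s'_def using r(3)[of q] by (intro GDERIV_inverse r(1)) auto
      then show ?thesis by (simp add: s_def[abs_def] inverse_eq_divide)
    qed
    have rpos: "0 < r q" if "q \<in> ball c d" for q using that d(2) r(3) by blast
    have cs: "continuous_on (ball c d) s" "continuous_on (ball c d) s'"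
      unfolding s_def s'_def using less_imp_neq[OF rpos, symmetric]
      by (intro continuous_intros continuous_on_subset[OF cr d(2)] continuous_on_subset[OF r(2) d(2)]; blast)+
    define H where "H q y = w y *\<^sub>R ((2 * max 0 (1 - (s q)\<^sup>2 * ((y - q) \<bullet> (y - q)))) *\<^sub>R ((- 2 * s q * ((y - q) \<bullet> (y - q))) *\<^sub>R s' q + (2 * (s q)\<^sup>2) *\<^sub>R (y - q)))" for q y
    have Hd: "GDERIV (\<lambda>q. w y * mollifier (s q) q y) q :> H q y" if "q \<in> ball c d" for q y
      using GDERIV_mult[OF GDERIV_const[of "w y" q] GDERIV_mollifier[OF s[OF that], of y]] by (simp add: H_def)
    have cH: "continuous_on (ball c d \<times> cbox a b) (\<lambda>(q, y). H q y)"
    proof -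
      have 1: "continuous_on (ball c d \<times> cbox a b) (\<lambda>z. s (fst z))" "continuous_on (ball c d \<times> cbox a b) (\<lambda>z. s' (fst z))"
        by (rule continuous_on_compose2[OF cs(1)] continuous_on_compose2[OF cs(2)], auto intro: continuous_on_fst continuous_on_id)+
      have 2: "continuous_on (ball c d \<times> cbox a b) (\<lambda>z. w (snd z))"
        by (rule continuous_on_compose2[OF w]) (auto intro: continuous_on_snd continuous_on_id)
      show ?thesis unfolding H_def case_prod_unfold by (intro continuous_intros 1 2)
    qed
    note int = GDERIV_integral[OF open_ball convex_ball, of c d a b "\<lambda>q y. w y * mollifier (s q) q y" H, OF Hd _ cH]
    have cf: "continuous_on (cbox a b) (\<lambda>y. w y * mollifier (s q) q y)" for q
      by (intro continuous_intros continuous_mollifier continuous_on_subset[OF w]) auto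
    define I where "I q = integral (cbox a b) (\<lambda>y. w y * mollifier (s q) q y)" for q
    define J where "J q = integral (cbox a b) (H q)" for q
    have IJ: "GDERIV I q :> J q" if "q \<in> ball c d" for q
      unfolding I_def J_def using that cf by (intro int(1))
    have cJ: "continuous_on (ball c d) J" unfolding J_def using cf by (intro int(2))
    have cI: "continuous_on (ball c d) I"
      using IJ by (intro continuous_at_imp_continuous_on ballI) (auto simp: gderiv_def intro: has_derivative_continuous)
    define C where "C = integral (cbox (- One) One) (mollifier 1 (0::'a))"
    define p where "p q = (1 / C) *\<^sub>R ((s q) ^ DIM('a) *\<^sub>R J q + I q *\<^sub>R ((real (DIM('a)) * s q ^ (DIM('a) - 1)) *\<^sub>R s' q))" for q
    have "GDERIV (mollify r w) q :> p q" if q: "q \<in> ball c d" for q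
    proof -
      have pw: "GDERIV (\<lambda>q. s q ^ DIM('a)) q :> (real (DIM('a)) * s q ^ (DIM('a) - 1)) *\<^sub>R s' q"
        by (rule GDERIV_DERIV_compose[OF s[OF q]]) (auto intro!: derivative_eq_intros)
      have "GDERIV (\<lambda>q. (1 / C) * (s q ^ DIM('a) * I q)) q :> p q"
        using GDERIV_mult[OF GDERIV_const[of "1 / C" q] GDERIV_mult[OF pw IJ[OF q]]] by (simp add: p_def)
      then show ?thesis
        unfolding gderiv_def
      proof (rule has_derivative_transform_within_open[OF _ open_ball q])
        fix x assume x: "x \<in> ball c d"
        then show "1 / C * (s x ^ DIM('a) * I x) = mollify r w x"
          using mollify_eq_convolution[of w r x, OF w rpos[OF x] sub[OF x]] by (simp add: C_def I_def s_def)
      qed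
    qed
    moreover have "continuous_on (ball c d) p" unfolding p_def by (intro continuous_intros cs cI cJ)
    ultimately show ?thesis using d(1,2) by blast
  qed
  define p where "p q = (SOME D. GDERIV (mollify r w) q :> D)" for q
  have p: "p q = D" if "GDERIV (mollify r w) q :> D" for q D
    unfolding p_def using that by (rule some_equality) (rule GDERIV_unique[OF _ that])
  show thesis
  proof (rule result[of p])
    show "GDERIV (mollify r w) q :> p q" if "q \<in> U" for q
      using loc[OF that] p by (metis centre_in_ball)
    show "continuous_on U p"
    proof (rule continuous_at_imp_continuous_on, rule ballI)
      fix c assume "c \<in> U"
      then obtain d p' where d: "d > 0" "\<And>q. q \<in> ball c d \<Longrightarrow> GDERIV (mollify r w) q :> p' q" "continuous_on (ball c d) p'"
        using loc by blast
      have "continuous_on (ball c d) p" using d(3) p[OF d(2)] by (simp cong: continuous_on_cong_simp)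
      then show "isCont p c" using d(1) by (meson centre_in_ball continuous_on_eq_continuous_at open_ball)
    qed
  qed
qed

text \<open>Moving the centre by \<open>h\<close> moves every point that enters the average by at most \<open>|h|\<close> plus the change of
the radius. As the gradient of the radius is small compared with \<open>\<delta>\<close>, the resulting factor
\<open>1 + 3 \<delta> / 4\<close> is compensated by the local Lipschitz constant \<open>1 - \<delta>\<close> of \<open>w\<close>.\<close>

lemma strict_smoothing:
  fixes w :: "'a::euclidean_space \<Rightarrow> real"
  assumes "open U" and w: "continuous_on UNIV w"
    and \<delta>: "continuous_on U \<delta>" "\<And>q. q \<in> U \<Longrightarrow> 0 < \<delta> q" "\<And>q. q \<in> U \<Longrightarrow> \<delta> q \<le> 1"
    and lip: "\<And>q x y. q \<in> U \<Longrightarrow> x \<in> ball q (\<delta> q) \<Longrightarrow> y \<in> ball q (\<delta> q) \<Longrightarrow> \<bar>w x - w y\<bar> \<le> (1 - \<delta> q) * norm (x - y)"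
    and m: "continuous_on U m" "\<And>q. q \<in> U \<Longrightarrow> 0 < m q"
  obtains v p where "\<And>q. q \<in> U \<Longrightarrow> GDERIV v q :> p q" "continuous_on U p"
    "\<And>q. q \<in> U \<Longrightarrow> norm (p q) < 1" "\<And>q. q \<in> U \<Longrightarrow> \<bar>v q - w q\<bar> \<le> m q"
proof -
  note result = that
  have M1: "continuous_on U (\<lambda>q. min (\<delta> q / 2) (m q))" using \<delta>(1) m(1) by (intro continuous_intros) auto
  have M2: "0 < min (\<delta> q / 2) (m q)" if "q \<in> U" for q using \<delta>(2) m(2) that by simp
  obtain r r' where r: "\<And>q. GDERIV r q :> r' q" "continuous_on UNIV r'" "\<And>q. q \<in> U \<Longrightarrow> 0 < r q"
    "\<And>q. q \<in> U \<Longrightarrow> r q \<le> min (\<delta> q / 2) (m q)" "\<And>q. q \<in> U \<Longrightarrow> norm (r' q) \<le> min (\<delta> q / 2) (m q)"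
    by (rule smooth_minorant[OF \<open>open U\<close> M1 M2], assumption, rule that)
  obtain p where p: "\<And>q. q \<in> U \<Longrightarrow> GDERIV (mollify r w) q :> p q" "continuous_on U p"
    by (rule mollify_C1[OF w \<open>open U\<close> r(1) continuous_on_subset[OF r(2) subset_UNIV] r(3)], assumption, rule that)
  show thesis
  proof (rule result[OF p])
    fix q assume q: "q \<in> U"
    have \<delta>q: "0 < \<delta> q" "\<delta> q \<le> 1" using \<delta> q by auto
    have rq: "0 < r q" "r q \<le> \<delta> q / 2" "r q \<le> m q" "norm (r' q) \<le> \<delta> q / 2" using r(3-5)[OF q] by auto
    have in_ball: "q + x \<in> ball q (\<delta> q)" if "norm x < \<delta> q" for x using that by (simp add: dist_norm)
    have "\<bar>mollify r w q - mollify (\<lambda>_. 0) w q\<bar> \<le> r q"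
    proof (rule mollify_diff_bound[OF w])
      fix z :: 'a assume z: "norm z < 1"
      have rz: "norm (r q *\<^sub>R z) \<le> r q" using rq(1) z by (simp add: mult_left_le)
      have "\<bar>w (q + r q *\<^sub>R z) - w (q + 0 *\<^sub>R z)\<bar> \<le> (1 - \<delta> q) * norm (q + r q *\<^sub>R z - (q + 0 *\<^sub>R z))"
      proof (intro lip[OF q] in_ball)
        show "norm (r q *\<^sub>R z) < \<delta> q" using rz rq(2) \<delta>q by linarith
        show "norm (0 *\<^sub>R z) < \<delta> q" using \<delta>q by simp
      qed
      also have "\<dots> \<le> 1 * r q" using rz \<delta>q by (intro mult_mono) auto
      finally show "\<bar>w (q + r q *\<^sub>R z) - w (q + 0 *\<^sub>R z)\<bar> \<le> r q" by simp
    qed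
    then show "\<bar>mollify r w q - w q\<bar> \<le> m q" using rq(3) by (simp add: mollify_0)
    \<comment> \<open>Half of \<open>\<delta>\<close> bounds the gradient of the radius, and a quarter its linearization error.\<close>
    define L where "L = (1 - \<delta> q) * (1 + 3 / 4 * \<delta> q)"
    have "L = 1 - \<delta> q / 4 - 3 / 4 * (\<delta> q * \<delta> q)" by (simp add: L_def field_simps)
    then have "L < 1" using \<delta>q(1) mult_pos_pos[OF \<delta>q(1) \<delta>q(1)] by linarith
    have "0 \<le> L" using \<delta>q by (simp add: L_def)
    obtain d where d: "d > 0" "\<And>h::'a. norm h < d \<Longrightarrow> \<bar>r (q + h) - r q - h \<bullet> r' q\<bar> \<le> \<delta> q / 4 * norm h"
      using r(1)[of q, unfolded GDERIV_iff] \<delta>q(1) by (metis divide_pos_pos zero_less_numeral)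
    have "norm (p q) \<le> L"
    proof (rule GDERIV_norm_bound[OF p(1)[OF q], of "min d (\<delta> q / 4)"])
      fix h :: 'a assume h: "norm h < min d (\<delta> q / 4)"
      have "\<bar>h \<bullet> r' q\<bar> \<le> norm h * (\<delta> q / 2)"
        using rq(4) by (intro order_trans[OF Cauchy_Schwarz_ineq2 mult_left_mono]) auto
      then have "\<bar>h \<bullet> r' q\<bar> \<le> 1 / 2 * (\<delta> q * norm h)" by (simp add: mult.commute)
      moreover have "\<bar>r (q + h) - r q - h \<bullet> r' q\<bar> \<le> 1 / 4 * (\<delta> q * norm h)" using d(2)[of h] h by simp
      ultimately have "\<bar>r (q + h) - r q\<bar> \<le> 3 / 4 * (\<delta> q * norm h)" by linarith
      then have rh: "\<bar>r (q + h) - r q\<bar> \<le> 3 / 4 * \<delta> q * norm h" by (simp only: mult.assoc)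
      have "3 / 4 * \<delta> q * norm h \<le> 3 / 4 * 1 * (\<delta> q / 4)" using h \<delta>q by (intro mult_mono) auto
      then have rb: "\<bar>r (q + h)\<bar> \<le> 11 / 16 * \<delta> q" using rh rq by linarith
      have "\<bar>mollify r w (q + h) - mollify (\<lambda>_. r q) w q\<bar> \<le> L * norm h"
      proof (rule mollify_diff_bound[OF w])
        fix z :: 'a assume z: "norm z < 1"
        have "norm (r (q + h) *\<^sub>R z) \<le> 11 / 16 * \<delta> q * 1" unfolding norm_scaleR using rb z by (intro mult_mono) auto
        then have "norm (h + r (q + h) *\<^sub>R z) < \<delta> q" using norm_triangle_ineq[of h "r (q + h) *\<^sub>R z"] h \<delta>q by linarith
        then have 1: "q + h + r (q + h) *\<^sub>R z \<in> ball q (\<delta> q)"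
          unfolding add.assoc by (rule in_ball)
        have "norm (r q *\<^sub>R z) \<le> r q" using rq(1) z by (simp add: mult_left_le)
        then have 2: "q + r q *\<^sub>R z \<in> ball q (\<delta> q)" using rq(2) \<delta>q by (intro in_ball) linarith
        have "\<bar>w (q + h + r (q + h) *\<^sub>R z) - w (q + r q *\<^sub>R z)\<bar> \<le> (1 - \<delta> q) * norm (q + h + r (q + h) *\<^sub>R z - (q + r q *\<^sub>R z))"
          by (rule lip[OF q 1 2])
        also have "q + h + r (q + h) *\<^sub>R z - (q + r q *\<^sub>R z) = h + (r (q + h) - r q) *\<^sub>R z" by (simp add: algebra_simps)
        also have "(1 - \<delta> q) * norm (h + (r (q + h) - r q) *\<^sub>R z) \<le> (1 - \<delta> q) * (norm h + 3 / 4 * \<delta> q * norm h * 1)"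
        proof (rule mult_left_mono, rule norm_triangle_le, rule add_left_mono)
          show "0 \<le> 1 - \<delta> q" using \<delta>q by simp
          show "norm ((r (q + h) - r q) *\<^sub>R z) \<le> 3 / 4 * \<delta> q * norm h * 1"
            unfolding norm_scaleR using rh z \<delta>q by (intro mult_mono) auto
        qed
        also have "(1 - \<delta> q) * (norm h + 3 / 4 * \<delta> q * norm h * 1) = L * norm h"
          by (simp add: L_def algebra_simps)
        finally show "\<bar>w (q + h + r (q + h) *\<^sub>R z) - w (q + r q *\<^sub>R z)\<bar> \<le> L * norm h" .
      qed
      then show "\<bar>mollify r w (q + h) - mollify r w q\<bar> \<le> L * norm h" by (simp add: mollify_def)
    qed (use d \<delta>q \<open>0 \<le> L\<close> in auto)
    then show "norm (p q) < 1" using \<open>L < 1\<close> by simp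
  qed
qed

section \<open>Softplus and the logistic function\<close>

definition softplus :: "real \<Rightarrow> real" where "softplus t = ln (1 + exp t)"
definition logistic :: "real \<Rightarrow> real" where "logistic t = exp t / (1 + exp t)"

lemma one_plus_exp_pos: "0 < 1 + exp (t::real)"
  by (simp add: add_pos_pos)

lemma DERIV_softplus: "(softplus has_real_derivative logistic t) (at t)"
  unfolding softplus_def logistic_def
  by (rule derivative_eq_intros refl one_plus_exp_pos | simp)+

lemma logistic_range: "0 < logistic t" "logistic t < 1"
  using one_plus_exp_pos[of t] by (simp_all add: logistic_def)

lemma DERIV_logistic: "(logistic has_real_derivative logistic t * (1 - logistic t)) (at t)"
proof -
  have n: "1 + exp t \<noteq> 0" using one_plus_exp_pos[of t] by simp
  have "(logistic has_real_derivative (exp t * (1 + exp t) - exp t * exp t) / ((1 + exp t) * (1 + exp t))) (at t)"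
    unfolding logistic_def using n by (auto intro!: derivative_eq_intros)
  moreover have "(exp t * (1 + exp t) - exp t * exp t) / ((1 + exp t) * (1 + exp t)) = logistic t * (1 - logistic t)"
    using n by (simp add: logistic_def field_simps)
  ultimately show ?thesis by simp
qed

lemma logistic_strict_mono: "s < t \<Longrightarrow> logistic s < logistic t"
  by (rule DERIV_pos_imp_increasing) (use DERIV_logistic logistic_range in \<open>auto intro!: exI mult_pos_pos\<close>)

lemma logistic_mono: "s \<le> t \<Longrightarrow> logistic s \<le> logistic t"
  using logistic_strict_mono[of s t] by (cases "s = t") auto

lemma logistic_lipschitz: "s \<le> t \<Longrightarrow> logistic t - logistic s \<le> t - s"
proof (cases "s = t")
  case False
  assume "s \<le> t"
  then have "s < t" using False by simp
  then obtain z where z: "logistic t - logistic s = (t - s) * (logistic z * (1 - logistic z))"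
    using MVT2[of s t logistic "\<lambda>z. logistic z * (1 - logistic z)"] DERIV_logistic by blast
  have "logistic z * (1 - logistic z) \<le> 1 * 1" using logistic_range[of z] by (intro mult_mono) auto
  then show ?thesis unfolding z using \<open>s < t\<close> by (simp add: mult_left_le)
qed simp

lemma softplus_lipschitz_below:
  assumes "s \<le> c" "t \<le> c"
  shows "\<bar>softplus s - softplus t\<bar> \<le> logistic c * \<bar>s - t\<bar>"
proof -
  have *: "\<bar>softplus t - softplus s\<bar> \<le> logistic c * \<bar>t - s\<bar>" if st: "s < t" "t \<le> c" for s t
  proof -
    obtain z where z: "s < z" "z < t" "softplus t - softplus s = (t - s) * logistic z"
      using MVT2[of s t softplus logistic] st(1) DERIV_softplus by blast
    have "\<bar>softplus t - softplus s\<bar> = logistic z * \<bar>t - s\<bar>" using z logistic_range(1)[of z] by (simp add: abs_mult)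
    also have "\<dots> \<le> logistic c * \<bar>t - s\<bar>" using z st by (intro mult_right_mono logistic_mono) auto
    finally show ?thesis .
  qed
  show ?thesis using *[of s t] *[of t s] assms by (cases s t rule: linorder_cases) (auto simp: abs_minus_commute)
qed

lemma id_minus_softplus_lipschitz_above:
  assumes "c \<le> s" "c \<le> t"
  shows "\<bar>(s - softplus s) - (t - softplus t)\<bar> \<le> (1 - logistic c) * \<bar>s - t\<bar>"
proof -
  have *: "\<bar>(t - softplus t) - (s - softplus s)\<bar> \<le> (1 - logistic c) * \<bar>t - s\<bar>" if st: "s < t" "c \<le> s" for s t
  proof -
    obtain z where z: "s < z" "z < t" "softplus t - softplus s = (t - s) * logistic z"
      using MVT2[of s t softplus logistic] st(1) DERIV_softplus by blast
    have "(t - softplus t) - (s - softplus s) = (1 - logistic z) * (t - s)" using z(3) by (simp add: algebra_simps)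
    then have "\<bar>(t - softplus t) - (s - softplus s)\<bar> = (1 - logistic z) * \<bar>t - s\<bar>" using logistic_range(2)[of z] by (simp add: abs_mult)
    also have "\<dots> \<le> (1 - logistic c) * \<bar>t - s\<bar>" using z st logistic_mono[of c z] by (intro mult_right_mono) auto
    finally show ?thesis .
  qed
  show ?thesis using *[of s t] *[of t s] assms by (cases s t rule: linorder_cases) (auto simp: abs_minus_commute)
qed

lemma softplus_strict_mono: "s < t \<Longrightarrow> softplus s < softplus t" "s < t \<Longrightarrow> s - softplus s < t - softplus t"
proof -
  assume "s < t"
  then obtain z where z: "softplus t - softplus s = (t - s) * logistic z"
    using MVT2[of s t softplus logistic] DERIV_softplus by blast
  have "0 < (t - s) * logistic z" "0 < (t - s) * (1 - logistic z)"
    using \<open>s < t\<close> logistic_range[of z] by (intro mult_pos_pos; simp)+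
  then show "softplus s < softplus t" "s - softplus s < t - softplus t" using z by (simp_all add: algebra_simps)
qed

section \<open>The extremal Lipschitz extensions\<close>

text \<open>The right-hand side with \<open>\<rho> = |z|\<close> is \<open>(|z|\<^sup>2 + |z + h|\<^sup>2) / (2 |z|)\<close>, which is at least \<open>|z + h|\<close> by
the inequality between the arithmetic and the geometric mean.\<close>

lemma norm_add_le_tangent:
  fixes z h :: "'a::real_inner"
  assumes "0 < \<rho>" "\<rho> \<le> norm z"
  shows "norm (z + h) \<le> norm z + h \<bullet> ((1 / norm z) *\<^sub>R z) + (norm h)\<^sup>2 / (2 * \<rho>)"
proof -
  have z: "0 < norm z" using assms by linarith
  have sq: "(norm (z + h))\<^sup>2 = (norm z)\<^sup>2 + 2 * (h \<bullet> z) + (norm h)\<^sup>2"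
    by (simp add: power2_norm_eq_inner inner_add_left inner_add_right inner_commute)
  have "0 \<le> (norm (z + h) - norm z)\<^sup>2" by simp
  then have "2 * norm z * norm (z + h) \<le> (norm (z + h))\<^sup>2 + (norm z)\<^sup>2" by (simp add: power2_eq_square algebra_simps)
  then have "2 * norm z * norm (z + h) \<le> 2 * norm z * (norm z + h \<bullet> ((1 / norm z) *\<^sub>R z) + (norm h)\<^sup>2 / (2 * norm z))"
  proof -
    have "2 * norm z * (norm z + h \<bullet> ((1 / norm z) *\<^sub>R z) + (norm h)\<^sup>2 / (2 * norm z)) = 2 * (norm z)\<^sup>2 + 2 * (h \<bullet> z) + (norm h)\<^sup>2"
      using z by (simp add: distrib_left power2_eq_square)
    then show ?thesis using \<open>2 * norm z * norm (z + h) \<le> _\<close> unfolding sq by linarith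
  qed
  then have "norm (z + h) \<le> norm z + h \<bullet> ((1 / norm z) *\<^sub>R z) + (norm h)\<^sup>2 / (2 * norm z)"
    using z by simp
  moreover have "(norm h)\<^sup>2 / (2 * norm z) \<le> (norm h)\<^sup>2 / (2 * \<rho>)"
    using assms by (intro divide_left_mono mult_pos_pos) auto
  ultimately show ?thesis by linarith
qed

definition upper_envelope :: "('a::euclidean_space \<Rightarrow> real) \<Rightarrow> 'a set \<Rightarrow> 'a \<Rightarrow> real" where
  "upper_envelope u F x = (INF y\<in>F. u y + norm (x - y))"

definition lower_envelope :: "('a::euclidean_space \<Rightarrow> real) \<Rightarrow> 'a set \<Rightarrow> 'a \<Rightarrow> real" where
  "lower_envelope u F x = - upper_envelope (\<lambda>y. - u y) F x"

locale lipschitz_data =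
  fixes F :: "'a::euclidean_space set" and u :: "'a \<Rightarrow> real"
  assumes closed: "closed F" and nonempty: "F \<noteq> {}"
    and lipschitz: "x \<in> F \<Longrightarrow> y \<in> F \<Longrightarrow> \<bar>u x - u y\<bar> \<le> norm (x - y)"
begin

lemma cone_bound: "y \<in> F \<Longrightarrow> y' \<in> F \<Longrightarrow> u y' - norm (x - y') \<le> u y + norm (x - y)"
  using lipschitz[of y y'] norm_triangle_ineq4[of "x - y" "x - y'"] by (simp add: norm_minus_commute)

lemma upper_le: "y \<in> F \<Longrightarrow> upper_envelope u F x \<le> u y + norm (x - y)"
  unfolding upper_envelope_def using nonempty cone_bound by (intro cINF_lower bdd_belowI2) auto

lemma le_upper: "(\<And>y. y \<in> F \<Longrightarrow> c \<le> u y + norm (x - y)) \<Longrightarrow> c \<le> upper_envelope u F x"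
  unfolding upper_envelope_def using nonempty by (intro cINF_greatest)

lemma upper_boundary: "x \<in> F \<Longrightarrow> upper_envelope u F x = u x"
  using upper_le[of x x] le_upper[of "u x" x] cone_bound[of _ x x] by (intro antisym) auto

lemma upper_lipschitz: "\<bar>upper_envelope u F x - upper_envelope u F x'\<bar> \<le> norm (x - x')"
proof -
  have "upper_envelope u F x - norm (x - x') \<le> upper_envelope u F x'" for x x'
  proof (rule le_upper)
    fix y assume "y \<in> F"
    then show "upper_envelope u F x - norm (x - x') \<le> u y + norm (x' - y)"
      using upper_le[of y x] norm_triangle_ineq[of "x - x'" "x' - y"] by simp
  qed
  from this[of x x'] this[of x' x] show ?thesis by (simp add: norm_minus_commute)
qed

text \<open>Each cone lies below a paraboloid that touches it at \<open>x\<close>, with a curvature controlled by the distance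
from \<open>x\<close> to \<open>F\<close>. The infimum over the cones need not be attained, since \<open>F\<close> may be unbounded; but the
directions of a minimizing sequence of cones have a limit point on the unit sphere.\<close>

lemma upper_semiconcave:
  assumes "x \<notin> F"
  obtains e C where "norm e = 1" "0 \<le> C" "\<And>h. upper_envelope u F (x + h) \<le> upper_envelope u F x + h \<bullet> e + C * (norm h)\<^sup>2"
proof -
  obtain \<rho> where \<rho>: "0 < \<rho>" "\<And>y. y \<in> F \<Longrightarrow> \<rho> \<le> norm (x - y)"
  proof -
    have "open (- F)" "x \<in> - F" using closed assms by auto
    then obtain \<rho> where "0 < \<rho>" "ball x \<rho> \<subseteq> - F" by (rule openE)
    then show thesis by (intro that[of \<rho>]) (auto simp: subset_iff dist_norm not_less[symmetric])
  qed
  have "\<exists>y\<in>F. u y + norm (x - y) < upper_envelope u F x + inverse (real (Suc n))" for n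
    using le_upper[of "upper_envelope u F x + inverse (real (Suc n))" x] by (smt (verit) inverse_positive_iff_positive of_nat_0_less_iff zero_less_Suc)
  then obtain y where y: "\<And>n. y n \<in> F" "\<And>n. u (y n) + norm (x - y n) < upper_envelope u F x + inverse (real (Suc n))" by metis
  define e where "e n = (1 / norm (x - y n)) *\<^sub>R (x - y n)" for n
  have e1: "norm (e n) = 1" for n
  proof -
    have "0 < norm (x - y n)" using \<rho>(1) \<rho>(2)[OF y(1)[of n]] by linarith
    then show ?thesis by (simp add: e_def)
  qed
  then have "\<forall>n. e n \<in> sphere 0 1" by simp
  then obtain l s where l: "l \<in> sphere 0 1" "strict_mono s" "(e \<circ> s) \<longlonglongrightarrow> l"
    using compact_sphere[of 0 1] unfolding compact_def by metis
  have "upper_envelope u F (x + h) \<le> upper_envelope u F x + h \<bullet> l + 1 / (2 * \<rho>) * (norm h)\<^sup>2" for h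
  proof (rule LIMSEQ_le_const)
    have "(\<lambda>n. inverse (real (Suc (s n)))) \<longlonglongrightarrow> 0"
      using LIMSEQ_subseq_LIMSEQ[OF LIMSEQ_inverse_real_of_nat l(2)] by (simp add: o_def)
    then have "(\<lambda>n. (upper_envelope u F x + inverse (real (Suc (s n)))) + h \<bullet> (e \<circ> s) n + 1 / (2 * \<rho>) * (norm h)\<^sup>2) \<longlonglongrightarrow>
       (upper_envelope u F x + 0) + h \<bullet> l + 1 / (2 * \<rho>) * (norm h)\<^sup>2"
      by (intro tendsto_intros l(3))
    then show "(\<lambda>n. (upper_envelope u F x + inverse (real (Suc (s n)))) + h \<bullet> (e \<circ> s) n + 1 / (2 * \<rho>) * (norm h)\<^sup>2) \<longlonglongrightarrow>
       upper_envelope u F x + h \<bullet> l + 1 / (2 * \<rho>) * (norm h)\<^sup>2" by simp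
    have "upper_envelope u F (x + h) \<le> (upper_envelope u F x + inverse (real (Suc (s n)))) + h \<bullet> (e \<circ> s) n + 1 / (2 * \<rho>) * (norm h)\<^sup>2" for n
      using upper_le[OF y(1)[of "s n"], of "x + h"] y(2)[of "s n"] norm_add_le_tangent[OF \<rho>(1) \<rho>(2)[OF y(1)[of "s n"]], of h]
      by (simp add: e_def algebra_simps)
    then show "\<exists>N. \<forall>n\<ge>N. upper_envelope u F (x + h) \<le> (upper_envelope u F x + inverse (real (Suc (s n)))) + h \<bullet> (e \<circ> s) n + 1 / (2 * \<rho>) * (norm h)\<^sup>2"
      by blast
  qed
  then show thesis using l(1) \<rho>(1) by (intro that[of l "1 / (2 * \<rho>)"]) auto
qed

lemma negated: "lipschitz_data F (\<lambda>y. - u y)"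
  using lipschitz by unfold_locales (auto simp: closed nonempty abs_minus_commute)

lemma lower_boundary: "x \<in> F \<Longrightarrow> lower_envelope u F x = u x"
  using lipschitz_data.upper_boundary[OF negated] by (simp add: lower_envelope_def)

lemma lower_lipschitz: "\<bar>lower_envelope u F x - lower_envelope u F x'\<bar> \<le> norm (x - x')"
  using lipschitz_data.upper_lipschitz[OF negated, of x x'] by (simp add: lower_envelope_def abs_minus_commute)

lemma lower_ge_cone: "y \<in> F \<Longrightarrow> u y - norm (x - y) \<le> lower_envelope u F x"
  using lipschitz_data.upper_le[OF negated, of y x] by (simp add: lower_envelope_def)

lemma lower_le_upper: "lower_envelope u F x \<le> upper_envelope u F x"
proof (rule le_upper)
  fix y assume y: "y \<in> F"
  have "- (u y + norm (x - y)) \<le> upper_envelope (\<lambda>y. - u y) F x"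
    using cone_bound[OF y] by (intro lipschitz_data.le_upper[OF negated]) (simp add: algebra_simps)
  then show "lower_envelope u F x \<le> u y + norm (x - y)" by (simp add: lower_envelope_def)
qed

text \<open>The function \<open>v\<close> is squeezed between two paraboloids that meet at \<open>x\<close>. Their slopes at \<open>x\<close> must
agree, for otherwise the lower one would exceed the upper one near \<open>x\<close>.\<close>

lemma GDERIV_between_envelopes:
  assumes "x \<notin> F" and touch: "lower_envelope u F x = upper_envelope u F x"
    and v: "\<And>q. lower_envelope u F q \<le> v q" "\<And>q. v q \<le> upper_envelope u F q"
  obtains e where "norm e = 1" "GDERIV v x :> e"
proof -
  obtain e C where e: "norm e = 1" "0 \<le> C" "\<And>h. upper_envelope u F (x + h) \<le> upper_envelope u F x + h \<bullet> e + C * (norm h)\<^sup>2"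
    using upper_semiconcave[OF \<open>x \<notin> F\<close>] by blast
  obtain e' C' where e': "0 \<le> C'" "\<And>h. lower_envelope u F (x + h) \<ge> lower_envelope u F x - h \<bullet> e' - C' * (norm h)\<^sup>2"
    using lipschitz_data.upper_semiconcave[OF negated \<open>x \<notin> F\<close>] unfolding lower_envelope_def by (smt (verit))
  have vx: "v x = upper_envelope u F x" using v[of x] touch by simp
  have upper: "v (x + h) \<le> v x + h \<bullet> e + C * (norm h)\<^sup>2" and lower: "v (x + h) \<ge> v x - h \<bullet> e' - C' * (norm h)\<^sup>2" for h
    using v[of "x + h"] e(3)[of h] e'(2)[of h] vx touch by linarith+
  have "e = - e'"
  proof (rule ccontr)
    assume "e \<noteq> - e'"
    define g where "g = - (e + e')"
    have g: "0 < g \<bullet> g" using \<open>e \<noteq> - e'\<close> eq_neg_iff_add_eq_0[of e e']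
      by (simp only: g_def inner_gt_zero_iff neg_equal_0_iff_equal) simp
    define t where "t = 1 / (C + C' + 1)"
    have t: "0 < t" "(C + C') * t < 1" using e(2) e'(1) by (auto simp: t_def field_simps)
    have "- ((t *\<^sub>R g) \<bullet> e) - (t *\<^sub>R g) \<bullet> e' \<le> (C + C') * (norm (t *\<^sub>R g))\<^sup>2"
      using upper[of "t *\<^sub>R g"] lower[of "t *\<^sub>R g"] by (simp add: algebra_simps)
    moreover have "- ((t *\<^sub>R g) \<bullet> e) - (t *\<^sub>R g) \<bullet> e' = t * (g \<bullet> g)"
      by (simp add: g_def inner_add_right inner_diff_right algebra_simps)
    moreover have "(norm (t *\<^sub>R g))\<^sup>2 = t * t * (g \<bullet> g)" unfolding power2_norm_eq_inner by simp
    ultimately have "t * (g \<bullet> g) * 1 \<le> t * (g \<bullet> g) * ((C + C') * t)" by (simp add: algebra_simps)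
    then show False using g t by (simp only: mult_le_cancel_left_pos mult_pos_pos)
  qed
  have "GDERIV v x :> e"
    unfolding GDERIV_iff
  proof (intro allI impI)
    fix \<epsilon> :: real assume "0 < \<epsilon>"
    show "\<exists>d>0. \<forall>h. norm h < d \<longrightarrow> \<bar>v (x + h) - v x - h \<bullet> e\<bar> \<le> \<epsilon> * norm h"
    proof (intro exI[of _ "\<epsilon> / (C + C' + 1)"] conjI allI impI)
      show "0 < \<epsilon> / (C + C' + 1)" using \<open>0 < \<epsilon>\<close> e(2) e'(1) by simp
      fix h :: 'a assume "norm h < \<epsilon> / (C + C' + 1)"
      then have "norm h * (C + C' + 1) \<le> \<epsilon>" using e(2) e'(1) by (simp add: pos_less_divide_eq less_imp_le)
      then have "norm h * (C + C' + 1) * norm h \<le> \<epsilon> * norm h" by (rule mult_right_mono) simp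
      then have 1: "C * (norm h)\<^sup>2 + C' * (norm h)\<^sup>2 + (norm h)\<^sup>2 \<le> \<epsilon> * norm h" by (simp add: power2_eq_square algebra_simps)
      have 2: "0 \<le> C * (norm h)\<^sup>2" "0 \<le> C' * (norm h)\<^sup>2" "0 \<le> (norm h)\<^sup>2" using e(2) e'(1) by auto
      have "h \<bullet> e' = - (h \<bullet> e)" using \<open>e = - e'\<close> by simp
      then show "\<bar>v (x + h) - v x - h \<bullet> e\<bar> \<le> \<epsilon> * norm h"
        using upper[of h] lower[of h] 1 2 by linarith
    qed
  qed
  then show thesis using that e(1) by blast
qed

text \<open>Since the derivative of softplus lies in \<open>(0,1)\<close> and increases strictly,
\<open>b - softplus b + softplus a\<close> lies strictly between \<open>a < b\<close>, and locally it has a Lipschitz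
constant of about \<open>1 - logistic b + logistic a < 1\<close>. This leaves room for \<open>strict_smoothing\<close>.\<close>

lemma strict_interposition:
  obtains v p where
    "\<And>q. lower_envelope u F q < upper_envelope u F q \<Longrightarrow> GDERIV v q :> p q"
    "continuous_on {q. lower_envelope u F q < upper_envelope u F q} p"
    "\<And>q. lower_envelope u F q < upper_envelope u F q \<Longrightarrow> norm (p q) < 1"
    "\<And>q. lower_envelope u F q < upper_envelope u F q \<Longrightarrow> lower_envelope u F q < v q \<and> v q < upper_envelope u F q"
proof -
  note result = that
  let ?a = "lower_envelope u F" and ?b = "upper_envelope u F"
  define U where "U = {q. ?a q < ?b q}"
  have ca: "continuous_on X ?a" and cb: "continuous_on X ?b" for X
    using lower_lipschitz upper_lipschitz
    by (auto intro!: lipschitz_on_continuous_on[of 1] lipschitz_onI simp: dist_norm)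
  have "open U" unfolding U_def using ca cb by (rule open_Collect_less)
  have csp: "continuous_on X (\<lambda>q. softplus (f q))" if "continuous_on X f" for X and f :: "'a \<Rightarrow> real"
    by (rule continuous_on_compose2[OF _ that, of UNIV softplus])
       (auto intro!: DERIV_continuous_on DERIV_softplus[THEN has_field_derivative_at_within])
  have clg: "continuous_on X (\<lambda>q. logistic (f q))" if "continuous_on X f" for X and f :: "'a \<Rightarrow> real"
    by (rule continuous_on_compose2[OF _ that, of UNIV logistic])
       (auto intro!: DERIV_continuous_on DERIV_logistic[THEN has_field_derivative_at_within])
  \<comment> \<open>The division by \<open>3\<close> in \<open>\<delta>\<close> below leaves room for the variation of the envelopes on the ball.\<close>
  define w where "w q = ?b q - softplus (?b q) + softplus (?a q)" for q
  have cw: "continuous_on X w" for X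
    unfolding w_def by (intro continuous_on_add continuous_on_diff csp ca cb)
  define \<delta> where "\<delta> q = (logistic (?b q) - logistic (?a q)) / 3" for q
  define m where "m q = min (?b q - w q) (w q - ?a q) / 2" for q
  have m0: "0 < m q" if "q \<in> U" for q
    using that softplus_strict_mono[of "?a q" "?b q"] by (simp add: m_def w_def U_def)
  have \<delta>: "0 < \<delta> q" "\<delta> q \<le> 1" if "q \<in> U" for q
  proof -
    show "0 < \<delta> q" using that logistic_strict_mono[of "?a q" "?b q"] by (simp add: \<delta>_def U_def)
    have "logistic (?b q) - logistic (?a q) < 1" using logistic_range[of "?a q"] logistic_range[of "?b q"] by linarith
    then show "\<delta> q \<le> 1" by (simp add: \<delta>_def)
  qed
  have lip: "\<bar>w x - w y\<bar> \<le> (1 - \<delta> q) * norm (x - y)"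
    if q: "q \<in> U" and x: "x \<in> ball q (\<delta> q)" and y: "y \<in> ball q (\<delta> q)" for q x y
  proof -
    let ?s = "?b q - \<delta> q" and ?t = "?a q + \<delta> q"
    have near: "\<bar>?b z - ?b q\<bar> \<le> \<delta> q" "\<bar>?a z - ?a q\<bar> \<le> \<delta> q" if "z \<in> ball q (\<delta> q)" for z
      using upper_lipschitz[of z q] lower_lipschitz[of z q] that by (simp_all add: dist_norm norm_minus_commute)
    have 1: "\<bar>(?b x - softplus (?b x)) - (?b y - softplus (?b y))\<bar> \<le> (1 - logistic ?s) * norm (x - y)"
    proof -
      have "\<bar>(?b x - softplus (?b x)) - (?b y - softplus (?b y))\<bar> \<le> (1 - logistic ?s) * \<bar>?b x - ?b y\<bar>"
        using near[OF x] near[OF y] by (intro id_minus_softplus_lipschitz_above) linarith+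
      also have "\<dots> \<le> (1 - logistic ?s) * norm (x - y)"
        using upper_lipschitz logistic_range(2)[of ?s] by (intro mult_left_mono) auto
      finally show ?thesis .
    qed
    have 2: "\<bar>softplus (?a x) - softplus (?a y)\<bar> \<le> logistic ?t * norm (x - y)"
    proof -
      have "\<bar>softplus (?a x) - softplus (?a y)\<bar> \<le> logistic ?t * \<bar>?a x - ?a y\<bar>"
        using near[OF x] near[OF y] by (intro softplus_lipschitz_below) linarith+
      also have "\<dots> \<le> logistic ?t * norm (x - y)"
        using lower_lipschitz logistic_range(1)[of ?t] by (intro mult_left_mono) auto
      finally show ?thesis .
    qed
    have "logistic (?b q) - logistic ?s \<le> \<delta> q" "logistic ?t - logistic (?a q) \<le> \<delta> q"
      using logistic_lipschitz[of ?s "?b q"] logistic_lipschitz[of "?a q" ?t] \<delta>[OF q] by auto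
    then have 3: "1 - logistic ?s + logistic ?t \<le> 1 - \<delta> q" by (simp add: \<delta>_def field_simps)
    have "\<bar>w x - w y\<bar> \<le> (1 - logistic ?s) * norm (x - y) + logistic ?t * norm (x - y)"
      using 1 2 unfolding w_def by linarith
    also have "\<dots> = (1 - logistic ?s + logistic ?t) * norm (x - y)" by (simp add: algebra_simps)
    also have "\<dots> \<le> (1 - \<delta> q) * norm (x - y)" using 3 by (rule mult_right_mono) simp
    finally show ?thesis .
  qed
  have c\<delta>: "continuous_on U \<delta>" unfolding \<delta>_def by (intro continuous_on_divide continuous_on_diff clg ca cb continuous_on_const) auto
  have cm: "continuous_on U m" unfolding m_def by (intro continuous_on_divide continuous_on_min continuous_on_diff cw ca cb continuous_on_const) auto
  obtain v p where vp: "\<And>q. q \<in> U \<Longrightarrow> GDERIV v q :> p q" "continuous_on U p"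
    "\<And>q. q \<in> U \<Longrightarrow> norm (p q) < 1" "\<And>q. q \<in> U \<Longrightarrow> \<bar>v q - w q\<bar> \<le> m q"
    by (rule strict_smoothing[OF \<open>open U\<close> cw c\<delta> \<delta> lip cm m0], assumption+, rule that)
  show thesis
  proof (rule result[of v p])
    fix q assume "?a q < ?b q"
    then have q: "q \<in> U" by (simp add: U_def)
    show "GDERIV v q :> p q" "norm (p q) < 1" using vp(1,3) q by blast+
    have "2 * m q \<le> ?b q - w q" "2 * m q \<le> w q - ?a q" by (simp_all add: m_def)
    then show "?a q < v q \<and> v q < ?b q" using vp(4)[OF q] m0[OF q] by (intro conjI) linarith+
  qed (use vp(2) in \<open>simp add: U_def\<close>)
qed

end

section \<open>Existence of almost classical solutions\<close>

text \<open>Working on the whole complement of \<open>F\<close>, and not only on \<open>\<Omega>\<close>, takes care of the segments between points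
of \<open>\<Omega>\<close> that leave \<open>\<Omega>\<close>.\<close>

theorem almost_classical_extension:
  fixes F :: "(real^2) set" and u :: "real^2 \<Rightarrow> real"
  assumes "closed F" "F \<noteq> {}" and "\<And>x y. x \<in> F \<Longrightarrow> y \<in> F \<Longrightarrow> \<bar>u x - u y\<bar> \<le> norm (x - y)"
  obtains v p where "\<And>x. x \<in> F \<Longrightarrow> v x = u x" "\<And>x y. \<bar>v x - v y\<bar> \<le> norm (x - y)"
    "\<And>x. x \<notin> F \<Longrightarrow> GDERIV v x :> p x" "\<And>x. x \<notin> F \<Longrightarrow> norm (p x) \<le> 1"
    "AE x in lborel. x \<notin> F \<longrightarrow> norm (p x) = 1"
proof -
  note result = that
  interpret lipschitz_data F u by unfold_locales (use assms in auto)
  let ?a = "lower_envelope u F" and ?b = "upper_envelope u F"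
  define U where "U = {q. ?a q < ?b q}"
  have ca: "continuous_on X ?a" and cb: "continuous_on X ?b" for X
    using lower_lipschitz upper_lipschitz
    by (auto intro!: lipschitz_on_continuous_on[of 1] lipschitz_onI simp: dist_norm)
  have "open U" unfolding U_def using ca cb by (rule open_Collect_less)
  obtain v\<^sub>0 p\<^sub>0 where v\<^sub>0: "\<And>q. ?a q < ?b q \<Longrightarrow> GDERIV v\<^sub>0 q :> p\<^sub>0 q" "continuous_on {q. ?a q < ?b q} p\<^sub>0"
    "\<And>q. ?a q < ?b q \<Longrightarrow> norm (p\<^sub>0 q) < 1" "\<And>q. ?a q < ?b q \<Longrightarrow> ?a q < v\<^sub>0 q \<and> v\<^sub>0 q < ?b q"
    by (rule strict_interposition) (rule that)
  define m where "m q = min (?b q - v\<^sub>0 q) (v\<^sub>0 q - ?a q)" for q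
  have v\<^sub>0U: "\<And>q. q \<in> U \<Longrightarrow> GDERIV v\<^sub>0 q :> p\<^sub>0 q" "continuous_on U p\<^sub>0" "\<And>q. q \<in> U \<Longrightarrow> norm (p\<^sub>0 q) < 1"
    using v\<^sub>0(1-3) by (auto simp: U_def)
  have "continuous_on U v\<^sub>0"
    using v\<^sub>0U(1) by (intro continuous_at_imp_continuous_on ballI) (auto simp: gderiv_def intro: has_derivative_continuous)
  then have cm: "continuous_on U m" unfolding m_def by (intro continuous_on_min continuous_on_diff ca cb)
  have m0: "0 < m q" if "q \<in> U" for q using v\<^sub>0(4)[of q] that by (simp add: m_def U_def)
  obtain v\<^sub>1 p\<^sub>1 where v\<^sub>1: "\<And>q. q \<notin> U \<Longrightarrow> v\<^sub>1 q = v\<^sub>0 q" "\<And>q. q \<in> U \<Longrightarrow> \<bar>v\<^sub>1 q - v\<^sub>0 q\<bar> \<le> m q"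
    "\<And>q. q \<in> U \<Longrightarrow> GDERIV v\<^sub>1 q :> p\<^sub>1 q" "\<And>q. q \<in> U \<Longrightarrow> norm (p\<^sub>1 q) \<le> 1"
    "AE q in lborel. q \<in> U \<longrightarrow> norm (p\<^sub>1 q) = 1"
    by (rule eikonal_saturation[OF \<open>open U\<close> v\<^sub>0U cm m0], assumption+, rule that)
  define v where "v q = (if q \<in> U then v\<^sub>1 q else ?b q)" for q
  have sandwich: "?a q \<le> v q" "v q \<le> ?b q" for q
  proof -
    have "?a q \<le> v q \<and> v q \<le> ?b q"
    proof (cases "q \<in> U")
      case True
      then show ?thesis using v\<^sub>1(2)[OF True] unfolding v_def m_def by (simp add: abs_le_iff)
    qed (use lower_le_upper in \<open>simp add: v_def\<close>)
    then show "?a q \<le> v q" "v q \<le> ?b q" by auto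
  qed
  have on_F: "v x = u x" if "x \<in> F" for x
    using sandwich[of x] lower_boundary[OF that] upper_boundary[OF that] by simp
  have grad_U: "GDERIV v q :> p\<^sub>1 q" if q: "q \<in> U" for q
    using v\<^sub>1(3)[OF q] unfolding gderiv_def
    by (rule has_derivative_transform_within_open[OF _ \<open>open U\<close> q]) (simp add: v_def)
  have touching: "\<exists>e. norm e = 1 \<and> GDERIV v q :> e" if "q \<notin> U" "q \<notin> F" for q
  proof -
    have "?a q = ?b q" using that(1) lower_le_upper[of q] by (simp add: U_def)
    then show ?thesis by (rule GDERIV_between_envelopes[OF that(2) _ sandwich]) blast
  qed
  define p where "p q = (if q \<in> U then p\<^sub>1 q else SOME e. norm e = 1 \<and> GDERIV v q :> e)" for q
  have p_touch: "norm (p q) = 1" "GDERIV v q :> p q" if "q \<notin> U" "q \<notin> F" for q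
    using someI_ex[OF touching[OF that]] that by (simp_all add: p_def)
  have grad: "GDERIV v q :> p q" if "q \<notin> F" for q
    using grad_U[of q] p_touch(2)[OF _ that] by (cases "q \<in> U") (simp_all add: p_def)
  have norm_p: "norm (p q) \<le> 1" if "q \<notin> F" for q
    using v\<^sub>1(4)[of q] p_touch(1)[OF _ that] by (cases "q \<in> U") (simp_all add: p_def)
  have lip: "\<bar>v x - v y\<bar> \<le> norm (x - y)" for x y
  proof (cases "closed_segment x y \<inter> F = {}")
    case True
    have "\<bar>v x - v y\<bar> \<le> 1 * norm (x - y)"
    proof (rule GDERIV_imp_lipschitz_bound[of "closed_segment x y"])
      show "GDERIV v q :> p q" if "q \<in> closed_segment x y" for q using True that by (intro grad) auto
      show "norm (p q) \<le> 1" if "q \<in> closed_segment x y" for q using True that by (intro norm_p) auto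
    qed auto
    then show ?thesis by simp
  next
    case False
    then obtain z where z: "z \<in> closed_segment x y" "z \<in> F" by auto
    have "dist x y = dist x z + dist z y" using z(1) by (simp add: between_mem_segment[symmetric] between)
    moreover have "\<bar>v q - u z\<bar> \<le> norm (q - z)" for q
      using sandwich[of q] upper_le[OF z(2), of q] lower_ge_cone[OF z(2), of q] by linarith
    from this[of x] this[of y] have "\<bar>v x - v y\<bar> \<le> norm (x - z) + norm (y - z)" by linarith
    ultimately show ?thesis by (simp add: dist_norm norm_minus_commute)
  qed
  have ae: "AE x in lborel. x \<notin> F \<longrightarrow> norm (p x) = 1"
    using v\<^sub>1(5)
  proof eventually_elim
    case (elim x)
    then show ?case using p_touch(1)[of x] by (cases "x \<in> U") (simp_all add: p_def)
  qed
  show thesis by (rule result[of v p, OF on_F lip grad norm_p ae])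
qed

theorem proposition5p1:
  fixes \<Omega> :: "(real^2) set" and u\<^sub>0 :: "real^2 \<Rightarrow> real"
  assumes "open \<Omega>"
    and "1-lipschitz_on (frontier \<Omega>) u\<^sub>0"
  shows "\<exists>w :: real^2 \<Rightarrow> real.
    1-lipschitz_on (closure \<Omega>) w \<and> almost_classical_solution \<Omega> u\<^sub>0 w"
proof -
  have "\<exists>w p. (\<forall>x\<in>frontier \<Omega>. w x = u\<^sub>0 x) \<and> (\<forall>x y. \<bar>w x - w y\<bar> \<le> norm (x - y)) \<and>
    (\<forall>x\<in>\<Omega>. GDERIV w x :> p x \<and> norm (p x) \<le> 1) \<and> (AE x in lborel. x \<in> \<Omega> \<longrightarrow> norm (p x) = 1)"
  proof (cases "frontier \<Omega> = {}")
    case True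
    have "GDERIV (\<lambda>x. x \<bullet> e) q :> e" for q e :: "real^2"
      by (simp add: gderiv_def bounded_linear_imp_has_derivative bounded_linear_inner_left)
    moreover have "\<bar>x \<bullet> axis 1 1 - y \<bullet> axis 1 1\<bar> \<le> norm (x - y)" for x y :: "real^2"
      using Cauchy_Schwarz_ineq2[of "x - y" "axis 1 1"] by (simp add: inner_diff_left norm_axis_1)
    ultimately show ?thesis
      using True by (intro exI[of _ "\<lambda>x. x \<bullet> axis 1 1"] exI[of _ "\<lambda>_. axis 1 1"]) (simp add: norm_axis_1)
  next
    case False
    have u\<^sub>0: "\<bar>u\<^sub>0 x - u\<^sub>0 y\<bar> \<le> norm (x - y)" if "x \<in> frontier \<Omega>" "y \<in> frontier \<Omega>" for x y
      using lipschitz_onD[OF assms(2) that] by (simp add: dist_norm)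
    obtain w p where w: "\<And>x. x \<in> frontier \<Omega> \<Longrightarrow> w x = u\<^sub>0 x" "\<And>x y. \<bar>w x - w y\<bar> \<le> norm (x - y)"
      "\<And>x. x \<notin> frontier \<Omega> \<Longrightarrow> GDERIV w x :> p x" "\<And>x. x \<notin> frontier \<Omega> \<Longrightarrow> norm (p x) \<le> 1"
      "AE x in lborel. x \<notin> frontier \<Omega> \<longrightarrow> norm (p x) = 1"
      by (rule almost_classical_extension[OF frontier_closed False u\<^sub>0], assumption+, rule that)
    have off: "x \<notin> frontier \<Omega>" if "x \<in> \<Omega>" for x
      using that assms(1) by (simp add: frontier_def interior_open)
    have "AE x in lborel. x \<in> \<Omega> \<longrightarrow> norm (p x) = 1" using w(5) by eventually_elim (use off in blast)
    then show ?thesis using w(1-4) off by (intro exI[of _ w] exI[of _ p]) blast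
  qed
  then obtain w p where w: "\<And>x. x \<in> frontier \<Omega> \<Longrightarrow> w x = u\<^sub>0 x" "\<And>x y. \<bar>w x - w y\<bar> \<le> norm (x - y)"
    "\<And>x. x \<in> \<Omega> \<Longrightarrow> GDERIV w x :> p x" "\<And>x. x \<in> \<Omega> \<Longrightarrow> norm (p x) \<le> 1"
    "AE x in lborel. x \<in> \<Omega> \<longrightarrow> norm (p x) = 1"
    by blast
  have lip: "1-lipschitz_on X w" for X
    using w(2) by (intro lipschitz_onI) (simp_all add: dist_norm)
  have grad: "gradient w x = p x" if "x \<in> \<Omega>" for x
    unfolding gradient_def using w(3)[OF that] by (rule the_equality) (rule GDERIV_unique[OF _ w(3)[OF that]])
  have "AE x in lebesgue. x \<in> \<Omega> \<longrightarrow> norm (p x) = 1"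
    using w(5) by (rule AE_completion)
  then have "AE x in lebesgue. x \<in> \<Omega> \<longrightarrow> norm (gradient w x) = 1"
    by eventually_elim (simp add: grad)
  moreover have "w differentiable (at x)" if "x \<in> \<Omega>" for x
    using w(3)[OF that] unfolding gderiv_def differentiable_def by blast
  ultimately have "almost_classical_solution \<Omega> u\<^sub>0 w"
    unfolding almost_classical_solution_def
    using w(1,4) grad lipschitz_on_continuous_on[OF lip] by simp
  then show ?thesis using lip by blast
qed

end
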